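(* Let $k\ge 0$ be an integer. For real $s>\frac12$ with $k<s-\frac12$, the function $N\mapsto\mathsf{Q}(k;s,N)$ (on positive integers $N$), where $\mathsf{Q}(k;s,N)=\mathbb{E}_N^{(s)}\left(\operatorname{Tr}\left(|\mathbf{H}|^{2k+2}+|\mathbf{H}|^{2k}\right)\right)$, is a polynomial in $N$ with coefficients which are rational functions in $s$. That is, for each fixed $k$ there is a polynomial in $N$ whose coefficients are rational functions of $s$ that equals $\mathsf{Q}(k;s,N)$ for all integers $N\ge1$ and all real $s>k+\frac12$.
   Context: $\mathbb{E}_N^{(s)}$ denotes expectation when $\mathbf{H}$ is an $N\times N$ complex Hermitian random matrix distributed according to the generalized Cauchy (Hua-Pickrell) measure, i.e. the probability measure on Hermitian matrices proportional to $\det\left((1+\mathbf{X}^2)^{-s-N}\right)d\mathbf{X}$, with $d\mathbf{X}$ Lebesgue measure. For an exponent $z$, $\operatorname{Tr}|\mathbf{H}|^{z}=\sum_{j=1}^N|\lambda_j|^z$ with $\lambda_j$ the eigenvalues of $\mathbf{H}$. *)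

theory Defs
  imports
    "HOL-Analysis.Analysis"
    "HOL-Computational_Algebra.Polynomial"
    "Jordan_Normal_Form.Char_Poly"
    "Jordan_Normal_Form.Schur_Decomposition"
begin

definition hermitian_mats :: "nat \<Rightarrow> complex mat set" where
  "hermitian_mats N = {A \<in> carrier_mat N N. mat_adjoint A = A}"

text \<open>The \<open>N\<^sup>2\<close> real coordinates of a Hermitian matrix: the diagonal entry at \<open>(i, i)\<close>; for
  \<open>i < j\<close>, the real part of the \<open>(i, j)\<close> entry is stored at \<open>(i, j)\<close> and its imaginary part at
  \<open>(j, i)\<close>.\<close>

definition herm_of_coords :: "nat \<Rightarrow> (nat \<times> nat \<Rightarrow> real) \<Rightarrow> complex mat" where
  "herm_of_coords N x = Matrix.mat N N (\<lambda>(i, j).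
     if i = j then complex_of_real (x (i, i))
     else if i < j then Complex (x (i, j)) (x (j, i))
     else Complex (x (j, i)) (- x (i, j)))"

definition herm_lebesgue :: "nat \<Rightarrow> complex mat measure" where
  "herm_lebesgue N =
     embed_measure (Pi\<^sub>M ({..<N} \<times> {..<N}) (\<lambda>_. lborel)) (herm_of_coords N)"

definition unitarily_diagonalizes ::
  "complex mat \<Rightarrow> (nat \<Rightarrow> real) \<Rightarrow> complex mat \<Rightarrow> bool" where
  "unitarily_diagonalizes U d A \<longleftrightarrow>
     U \<in> carrier_mat (dim_row A) (dim_row A) \<and>
     mat_adjoint U * U = 1\<^sub>m (dim_row A) \<and>
     A = U * mat_diag (dim_row A) (\<lambda>i. complex_of_real (d i)) * mat_adjoint U"

text \<open>Real power of a positive definite Hermitian matrix by functional calculus. The value does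
  not depend on the diagonalization that is chosen.\<close>

definition herm_powr :: "complex mat \<Rightarrow> real \<Rightarrow> complex mat" where
  "herm_powr A p =
     (let (U, d) = (SOME (U, d). unitarily_diagonalizes U d A)
      in U * mat_diag (dim_row A) (\<lambda>i. complex_of_real (d i powr p)) * mat_adjoint U)"

definition cauchy_weight :: "real \<Rightarrow> nat \<Rightarrow> complex mat \<Rightarrow> real" where
  "cauchy_weight s N X = Re (Determinant.det (herm_powr (1\<^sub>m N + X * X) (- s - real N)))"

definition hua_pickrell :: "real \<Rightarrow> nat \<Rightarrow> complex mat measure" where
  "hua_pickrell s N = density (herm_lebesgue N)
     (\<lambda>X. ennreal (cauchy_weight s N X)
           / (\<integral>\<^sup>+ Y. ennreal (cauchy_weight s N Y) \<partial>herm_lebesgue N))"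

text \<open>\<open>proots (char_poly H)\<close> is the multiset of eigenvalues, with algebraic multiplicity.\<close>

definition trace_abs_power :: "complex mat \<Rightarrow> nat \<Rightarrow> real" where
  "trace_abs_power H m = (\<Sum>z\<in>#proots (char_poly H). norm z ^ m)"

definition Q_moment :: "nat \<Rightarrow> real \<Rightarrow> nat \<Rightarrow> real" where
  "Q_moment k s N = (\<integral>H. trace_abs_power H (2 * k + 2) + trace_abs_power H (2 * k)
                \<partial>hua_pickrell s N)"

lemma mat_adjoint_index:
  fixes A :: "complex mat"
  assumes "A \<in> carrier_mat n n" "i < n" "j < n"
  shows "mat_adjoint A $$ (i, j) = cnj (A $$ (j, i))"
  using assms unfolding mat_adjoint_def by (simp add: mat_of_rows_index)

lemma herm_of_coords_hermitian: "herm_of_coords N x \<in> hermitian_mats N"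
proof -
  have c: "herm_of_coords N x \<in> carrier_mat N N"
    by (simp add: herm_of_coords_def)
  have "mat_adjoint (herm_of_coords N x) = herm_of_coords N x"
  proof (rule eq_matI)
    fix i j assume ij: "i < dim_row (herm_of_coords N x)" "j < dim_col (herm_of_coords N x)"
    hence ij': "i < N" "j < N" using c by auto
    show "mat_adjoint (herm_of_coords N x) $$ (i, j) = herm_of_coords N x $$ (i, j)"
      unfolding mat_adjoint_index[OF c ij'] using ij'
      by (auto simp: herm_of_coords_def complex_eq_iff)
  qed (use c in \<open>auto simp: mat_adjoint_def\<close>)
  with c show ?thesis by (simp add: hermitian_mats_def)
qed

lemma inj_on_herm_of_coords:
  "inj_on (herm_of_coords N) (space (Pi\<^sub>M ({..<N} \<times> {..<N}) (\<lambda>_. lborel)))"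
proof (rule inj_onI)
  fix x y :: "nat \<times> nat \<Rightarrow> real"
  assume x: "x \<in> space (Pi\<^sub>M ({..<N} \<times> {..<N}) (\<lambda>_. lborel))"
    and y: "y \<in> space (Pi\<^sub>M ({..<N} \<times> {..<N}) (\<lambda>_. lborel))"
    and eq: "herm_of_coords N x = herm_of_coords N y"
  have *: "x (i, j) = y (i, j)" if "i < N" "j < N" for i j
  proof -
    have "herm_of_coords N x $$ (i, j) = herm_of_coords N y $$ (i, j)"
      using eq by simp
    thus ?thesis using that
      by (auto simp: herm_of_coords_def split: if_splits)
  qed
  show "x = y"
    using x y unfolding space_PiM by (rule PiE_ext) (use * in auto)
qed

lemma space_herm_lebesgue: "space (herm_lebesgue N) = hermitian_mats N"
proof -
  have "A \<in> herm_of_coords N ` space (Pi\<^sub>M ({..<N} \<times> {..<N}) (\<lambda>_. lborel))"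
    if A: "A \<in> hermitian_mats N" for A
  proof -
    define x where "x = restrict (\<lambda>(i, j). if i \<le> j then Re (A $$ (i, j)) else Im (A $$ (j, i)))
                          ({..<N} \<times> {..<N})"
    from A have c: "A \<in> carrier_mat N N" and h: "mat_adjoint A = A"
      by (auto simp: hermitian_mats_def)
    have h': "A $$ (i, j) = cnj (A $$ (j, i))" if "i < N" "j < N" for i j
      using mat_adjoint_index[OF c that] h by simp
    have "A = herm_of_coords N x"
    proof (rule eq_matI)
      fix i j assume "i < dim_row (herm_of_coords N x)" "j < dim_col (herm_of_coords N x)"
      hence ij: "i < N" "j < N" by (auto simp: herm_of_coords_def)
      show "A $$ (i, j) = herm_of_coords N x $$ (i, j)"
        using ij h'[OF ij] by (auto simp: herm_of_coords_def x_def complex_eq_iff)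
    qed (use c in \<open>auto simp: herm_of_coords_def\<close>)
    moreover have "x \<in> space (Pi\<^sub>M ({..<N} \<times> {..<N}) (\<lambda>_. lborel))"
      by (auto simp: space_PiM x_def)
    ultimately show ?thesis by blast
  qed
  thus ?thesis
    using herm_of_coords_hermitian by (auto simp: herm_lebesgue_def space_embed_measure)
qed

end

theory Submission
  imports Defs "Jordan_Normal_Form.Spectral_Radius"
begin

text \<open>Integrate by parts the field \<open>H\<^sup>j (1 + H\<^sup>2) Tr H\<^bsup>m\<^sub>1\<^esup> Tr H\<^bsup>m\<^sub>2\<^esup> \<cdots>\<close> against the weight
  \<open>det (1 + H\<^sup>2)\<^bsup>-s-N\<^esup>\<close>. The factor \<open>1 + H\<^sup>2\<close> cancels the inverse produced by the weight, so the
  result is a linear relation between averages of products of traces. In its top degree \<open>n\<close> the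
  dependence on \<open>N\<close> cancels: \<open>2 s\<close> times one average equals a combination of other averages of
  degree \<open>n\<close>, with nonnegative integer coefficients of sum \<open>n - 1\<close>, plus terms of degree \<open>n - 2\<close>
  whose coefficients involve \<open>N\<close> only through \<open>Tr 1 = N\<close>. For \<open>2 s > n - 1\<close> this system is strictly
  diagonally dominant, and Cramer's rule gives the claim by induction on the even number \<open>n\<close>.

  The averages exist in exactly this range. If \<open>H\<close> is bordered by a column \<open>v\<close> and a diagonal entry
  \<open>t\<close>, then \<open>det (1 + H\<^sup>2)\<close> is multiplied by \<open>(1 + q)\<^sup>2 + (t - r)\<^sup>2\<close>, where \<open>q\<close> is a positive definite
  form in \<open>v\<close>; integrating over \<open>t\<close> and then over \<open>v\<close> lowers both \<open>N\<close> and the exponent by one.\<close>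

unbundle no vec_syntax

section \<open>Hermitian matrices\<close>

text \<open>Differentiating H^j splits one trace into two, so the relations close only on all
  products of traces of a given degree, not on single traces. The analytic obstacle is the critical
  range. A field whose divergence has degree n has degree n + 1 itself, so its average against the
  weight need not exist. The integration by parts is therefore done with the cutoff (1 + e (1 + Tr
  H^2))^(-p). Differentiating the cutoff raises the degree to n + 2, but brings a factor e and one
  more cutoff factor. These bound the extra term by degree n, and dominated convergence removes it
  as e tends to 0. The factorization 1 + H^2 = (1 + iH)(1 - iH) turns the weight into a power of
  |det (1 + iH)|. The matrix 1 + iH is affine in the entries, so bordering H borders this matrix and
  one elimination step gives the quadratic in t. On the algebraic side the matrix of the system
  contains s but not N. Its determinant is a polynomial in s alone, nonzero on the whole half-line,
  and N enters polynomially through the right-hand sides.\<close>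

lemma mat_adjoint_carrier [simp]:
  "A \<in> carrier_mat n m \<Longrightarrow> mat_adjoint A \<in> carrier_mat m n"
  by (auto simp: mat_adjoint_def)

lemma mat_adjoint_dim [simp]:
  "dim_row (mat_adjoint A) = dim_col A" "dim_col (mat_adjoint A) = dim_row A"
  by (auto simp: mat_adjoint_def)

lemma mat_adjoint_entry:
  fixes A :: "complex mat"
  assumes "A \<in> carrier_mat n m" "i < m" "j < n"
  shows "mat_adjoint A $$ (i, j) = cnj (A $$ (j, i))"
  using assms unfolding mat_adjoint_def by (simp add: mat_of_rows_index)

lemma mat_adjoint_mult:
  fixes A B :: "complex mat"
  assumes "A \<in> carrier_mat n m" "B \<in> carrier_mat m p"
  shows "mat_adjoint (A * B) = mat_adjoint B * mat_adjoint A"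
proof (rule eq_matI)
  fix i j assume "i < dim_row (mat_adjoint B * mat_adjoint A)" "j < dim_col (mat_adjoint B * mat_adjoint A)"
  hence ij: "i < p" "j < n" using assms by auto
  have AB: "A * B \<in> carrier_mat n p" using assms by auto
  show "mat_adjoint (A * B) $$ (i, j) = (mat_adjoint B * mat_adjoint A) $$ (i, j)"
    unfolding mat_adjoint_entry[OF AB ij]
    using assms ij
    by (auto simp: scalar_prod_def mat_adjoint_entry[OF assms(1)] mat_adjoint_entry[OF assms(2)]
        mult.commute intro!: sum.cong)
qed (use assms in auto)

lemma mat_adjoint_one [simp]: "mat_adjoint (1\<^sub>m n :: complex mat) = 1\<^sub>m n"
  by (intro eq_matI) (auto simp: mat_adjoint_entry[of _ n n])

lemma unitary_right:
  fixes U :: "complex mat"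
  assumes "U \<in> carrier_mat n n" "mat_adjoint U * U = 1\<^sub>m n"
  shows "U * mat_adjoint U = 1\<^sub>m n"
  using mat_mult_left_right_inverse[of "mat_adjoint U" n U] assms by simp

text \<open>The Householder reflection in \<open>v - e\<^sub>0\<close> exchanges \<open>e\<^sub>0\<close> and the unit vector \<open>v\<close>; over the
  complex numbers this requires \<open>v\<^sub>0\<close> to be real.\<close>

lemma householder:
  fixes v :: "nat \<Rightarrow> complex"
  assumes n: "n > 0" and norm: "(\<Sum>i<n. cmod (v i)^2) = 1" and v0: "v 0 = complex_of_real a"
  obtains U where "U \<in> carrier_mat n n" "mat_adjoint U = U" "U * U = 1\<^sub>m n"
    "\<And>i. i < n \<Longrightarrow> U $$ (i, 0) = v i"
proof (cases "a = 1")
  case True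
  have "(\<Sum>i<n. cmod (v i)^2) = cmod (v 0)^2 + (\<Sum>i\<in>{..<n} - {0}. cmod (v i)^2)"
    using n by (subst sum.remove[of _ 0]) auto
  hence "(\<Sum>i\<in>{..<n} - {0}. cmod (v i)^2) = 0" using norm v0 True by simp
  hence "v i = 0" if "i < n" "i \<noteq> 0" for i
    using that by (subst (asm) sum_nonneg_eq_0_iff) auto
  thus ?thesis using n v0 True by (intro that[of "1\<^sub>m n"]) auto
next
  case False
  define c where "c = 1 - complex_of_real a"
  define r where "r = inverse c"
  have "c \<noteq> 0" using False by (simp add: c_def)
  hence rc: "r * c = 1" by (simp add: r_def)
  have cr: "cnj r = r" by (simp add: r_def c_def)
  define w where "w i = v i - (if i = 0 then 1 else 0)" for i
  \<comment> \<open>The usual factor 2 / |w|^2 of a reflection is 1 / c = \<open>r\<close> by this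
    identity. For \<open>a = 1\<close> the vector \<open>v\<close> is e_0 itself and
    \<open>w\<close> vanishes, hence the separate case.\<close>
  have ww: "(\<Sum>i<n. w i * cnj (w i)) = 2 * c"
  proof -
    have "(\<Sum>i<n. w i * cnj (w i)) = (\<Sum>i<n. v i * cnj (v i) + (if i = 0 then 1 - v 0 - cnj (v 0) else 0))"
      by (intro sum.cong) (auto simp: w_def algebra_simps)
    also have "\<dots> = (\<Sum>i<n. complex_of_real (cmod (v i)^2)) + (1 - v 0 - cnj (v 0))"
      using n by (simp add: sum.distrib flip: complex_norm_square)
    also have "(\<Sum>i<n. complex_of_real (cmod (v i)^2)) = complex_of_real (\<Sum>i<n. cmod (v i)^2)"
      by simp
    finally show ?thesis by (simp only: norm v0) (simp add: c_def)
  qed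
  define U where "U = Matrix.mat n n (\<lambda>(i, j). (if i = j then 1 else 0) - w i * cnj (w j) * r)"
  have Uc: "U \<in> carrier_mat n n" by (simp add: U_def)
  have "mat_adjoint U = U"
    using Uc by (intro eq_matI) (auto simp: mat_adjoint_entry[OF Uc], auto simp: U_def cr)
  moreover have "U * U = 1\<^sub>m n"
  proof (rule eq_matI)
    fix i j assume "i < dim_row (1\<^sub>m n :: complex mat)" "j < dim_col (1\<^sub>m n :: complex mat)"
    hence ij: "i < n" "j < n" by auto
    have "(U * U) $$ (i, j) = (\<Sum>k<n. ((if i = k then 1 else 0) - w i * cnj (w k) * r) *
        ((if k = j then 1 else 0) - w k * cnj (w j) * r))"
      using ij by (auto simp: U_def scalar_prod_def atLeast0LessThan intro!: sum.cong)
    also have "\<dots> = (\<Sum>k<n. (if k = i then (if i = j then 1 else 0) - w i * cnj (w j) * r else 0)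
        + (if k = j then - w i * cnj (w j) * r else 0)
        + w i * cnj (w j) * r^2 * (w k * cnj (w k)))"
      by (intro sum.cong) (auto simp: algebra_simps power2_eq_square)
    also have "\<dots> = (if i = j then 1 else 0) - w i * cnj (w j) * r - w i * cnj (w j) * r
        + w i * cnj (w j) * r^2 * (\<Sum>k<n. w k * cnj (w k))"
      using ij by (simp add: sum.distrib sum_distrib_left)
    also have "\<dots> = (if i = j then 1 else 0)"
    proof -
      have "w i * cnj (w j) * r^2 * (2 * c) = 2 * (w i * cnj (w j)) * r * (r * c)"
        by (simp add: power2_eq_square)
      thus ?thesis unfolding ww rc by simp
    qed
    finally show "(U * U) $$ (i, j) = 1\<^sub>m n $$ (i, j)" using ij by simp
  qed (use Uc in auto)
  moreover have "U $$ (i, 0) = v i" if "i < n" for i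
  proof -
    have "cnj (w 0) = - c" by (simp add: w_def v0 c_def)
    hence "U $$ (i, 0) = (if i = 0 then 1 else 0) + w i * (r * c)"
      using that n by (simp add: U_def mult_ac)
    thus ?thesis by (simp add: rc w_def)
  qed
  ultimately show ?thesis using that Uc by blast
qed

text \<open>An eigenvector may be multiplied by a unimodular phase; this makes its first coordinate
  real, which is the normalization that \<open>householder\<close> asks for.\<close>

lemma unit_eigenvector:
  fixes A :: "complex mat"
  assumes A: "A \<in> carrier_mat n n" and n: "n > 0"
  obtains v a e where "(\<Sum>i<n. cmod (v i)^2) = 1" "v 0 = complex_of_real a"
    "\<And>i. i < n \<Longrightarrow> (\<Sum>j<n. A $$ (i, j) * v j) = e * v i"
proof -
  from spectrum_non_empty[OF A n] obtain e where "eigenvalue A e"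
    by (auto simp: spectrum_def)
  then obtain u where u: "u \<in> carrier_vec n" "u \<noteq> 0\<^sub>v n" "A *\<^sub>v u = e \<cdot>\<^sub>v u"
    using A by (auto simp: eigenvalue_def eigenvector_def)
  define r where "r = sqrt (\<Sum>i<n. cmod (u $ i)^2)"
  have "(\<Sum>i<n. cmod (u $ i)^2) \<noteq> 0"
  proof
    assume "(\<Sum>i<n. cmod (u $ i)^2) = 0"
    hence "\<forall>i<n. u $ i = 0" by (subst (asm) sum_nonneg_eq_0_iff) auto
    with u show False by (metis eq_vecI carrier_vecD index_zero_vec)
  qed
  moreover have "(\<Sum>i<n. cmod (u $ i)^2) \<ge> 0" by (intro sum_nonneg) auto
  ultimately have r: "r > 0" "r^2 = (\<Sum>i<n. cmod (u $ i)^2)" by (auto simp: r_def)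
  \<comment> \<open>The conjugate phase of the first coordinate; any unit serves if that coordinate
    is 0.\<close>
  define p where "p = (if u $ 0 = 0 then 1 else cnj (u $ 0) / complex_of_real (cmod (u $ 0)))"
  have p: "cmod p = 1" by (simp add: p_def norm_divide)
  define v where "v i = p / complex_of_real r * u $ i" for i
  have "(\<Sum>i<n. cmod (v i)^2) = (\<Sum>i<n. cmod (u $ i)^2) / r^2"
    unfolding sum_divide_distrib
    using r(1) p by (intro sum.cong) (auto simp: v_def norm_mult norm_divide power_mult_distrib power_divide)
  hence "(\<Sum>i<n. cmod (v i)^2) = 1" using r(1) unfolding r(2)[symmetric] by simp
  moreover have "v 0 = complex_of_real (cmod (u $ 0) / r)"
  proof (cases "u $ 0 = 0")
    case False
    have "cnj (u $ 0) * u $ 0 = complex_of_real (cmod (u $ 0)) * complex_of_real (cmod (u $ 0))"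
      using complex_norm_square[of "u $ 0"] by (simp add: power2_eq_square mult.commute)
    thus ?thesis using False by (simp add: v_def p_def)
  qed (simp add: v_def p_def)
  moreover have "(\<Sum>j<n. A $$ (i, j) * v j) = e * v i" if "i < n" for i
  proof -
    have "(A *\<^sub>v u) $ i = e * u $ i" unfolding u(3) using u(1) that by simp
    hence "(\<Sum>j<n. A $$ (i, j) * u $ j) = e * u $ i"
      using A that u(1) by (simp add: scalar_prod_def atLeast0LessThan)
    hence "p / complex_of_real r * (\<Sum>j<n. A $$ (i, j) * u $ j) = p / complex_of_real r * (e * u $ i)"
      by simp
    thus ?thesis by (simp add: v_def sum_distrib_left algebra_simps)
  qed
  ultimately show ?thesis using that by blast
qed

lemma mat_adjoint_four_block:
  fixes A :: "complex mat"
  assumes "A \<in> carrier_mat n1 m1" "B \<in> carrier_mat n1 m2" "C \<in> carrier_mat n2 m1" "D \<in> carrier_mat n2 m2"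
  shows "mat_adjoint (four_block_mat A B C D) =
    four_block_mat (mat_adjoint A) (mat_adjoint C) (mat_adjoint B) (mat_adjoint D)"
proof -
  have c: "four_block_mat A B C D \<in> carrier_mat (n1 + n2) (m1 + m2)" using assms by auto
  show ?thesis
    using assms
    by (intro eq_matI) (auto simp: mat_adjoint_entry[OF c] mat_adjoint_entry[OF assms(1)]
      mat_adjoint_entry[OF assms(2)] mat_adjoint_entry[OF assms(3)] mat_adjoint_entry[OF assms(4)])
qed

text \<open>Deflation: conjugation by a reflection whose first column is a unit eigenvector turns
  the first column into e times e_0. Being Hermitian then forces e to be real and clears the first
  row, which leaves a Hermitian block of size \<open>n\<close> for the induction.\<close>

theorem hermitian_unitarily_diagonalizable:
  assumes "A \<in> carrier_mat n n" "mat_adjoint A = A"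
  shows "\<exists>U d. unitarily_diagonalizes U d A"
  using assms
proof (induction n arbitrary: A)
  case 0
  thus ?case by (intro exI[of _ "1\<^sub>m 0"] exI[of _ "\<lambda>_. 0"]) (auto simp: unitarily_diagonalizes_def)
next
  case (Suc n)
  note A = Suc.prems(1) and hA = Suc.prems(2)
  obtain v a e where v: "(\<Sum>i<Suc n. cmod (v i)^2) = 1"
    "v 0 = complex_of_real a" and ev: "\<And>i. i < Suc n \<Longrightarrow> (\<Sum>j<Suc n. A $$ (i, j) * v j) = e * v i"
    by (rule unit_eigenvector[OF A zero_less_Suc]) blast
  obtain H where H: "H \<in> carrier_mat (Suc n) (Suc n)" "mat_adjoint H = H"
    "H * H = 1\<^sub>m (Suc n)" "\<And>i. i < Suc n \<Longrightarrow> H $$ (i, 0) = v i"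
    by (rule householder[OF zero_less_Suc v]) blast
  note assoc = assoc_mult_mat[of _ "Suc n" "Suc n" _ "Suc n" _ "Suc n"]
  define B where "B = H * (A * H)"
  have Bc: "B \<in> carrier_mat (Suc n) (Suc n)" using A H by (simp add: B_def)
  have hB: "mat_adjoint B = B"
    using A H hA by (simp add: B_def mat_adjoint_mult[of _ "Suc n" "Suc n" _ "Suc n"] assoc)
  have AH: "(A * H) $$ (i, 0) = e * H $$ (i, 0)" if "i < Suc n" for i
  proof -
    have "(A * H) $$ (i, 0) = (\<Sum>j<Suc n. A $$ (i, j) * H $$ (j, 0))"
      using that A H(1) by (simp add: scalar_prod_def atLeast0LessThan del: sum.lessThan_Suc)
    also have "\<dots> = e * H $$ (i, 0)" using ev[OF that] H(4) that by (simp del: sum.lessThan_Suc)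
    finally show ?thesis .
  qed
  have B0: "B $$ (i, 0) = e * (if i = 0 then 1 else 0)" if "i < Suc n" for i
  proof -
    have "B $$ (i, 0) = (\<Sum>j<Suc n. H $$ (i, j) * (A * H) $$ (j, 0))"
      using that A H(1) by (simp add: B_def scalar_prod_def atLeast0LessThan del: sum.lessThan_Suc)
    also have "\<dots> = e * (\<Sum>j<Suc n. H $$ (i, j) * H $$ (j, 0))"
      using AH unfolding sum_distrib_left by (intro sum.cong) auto
    also have "(\<Sum>j<Suc n. H $$ (i, j) * H $$ (j, 0)) = (H * H) $$ (i, 0)"
      using that H(1) by (simp add: scalar_prod_def atLeast0LessThan del: sum.lessThan_Suc)
    finally show ?thesis using that H(3) by simp
  qed
  have Badj: "B $$ (i, j) = cnj (B $$ (j, i))" if "i < Suc n" "j < Suc n" for i j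
    using mat_adjoint_entry[OF Bc that] hB by simp
  have B00: "B $$ (0, 0) = e" using B0[of 0] by simp
  have "e = cnj e" using Badj[of 0 0, unfolded B00] by blast
  then obtain r where r: "e = complex_of_real r" by (metis Reals_cases Reals_cnj_iff)
  define C where "C = Matrix.mat n n (\<lambda>(i, j). B $$ (Suc i, Suc j))"
  have Cc: "C \<in> carrier_mat n n" by (simp add: C_def)
  have "mat_adjoint C = C"
  proof (rule eq_matI)
    fix i j assume "i < dim_row C" "j < dim_col C"
    hence ij: "i < n" "j < n" using Cc by auto
    show "mat_adjoint C $$ (i, j) = C $$ (i, j)"
      unfolding mat_adjoint_entry[OF Cc ij] using ij Badj[of "Suc i" "Suc j"] by (simp add: C_def)
  qed (use Cc in auto)
  from Suc.IH[OF Cc this] obtain U d where "unitarily_diagonalizes U d C" by blast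
  hence U: "U \<in> carrier_mat n n" "mat_adjoint U * U = 1\<^sub>m n"
    and C: "C = U * mat_diag n (\<lambda>i. complex_of_real (d i)) * mat_adjoint U"
    using Cc by (auto simp: unitarily_diagonalizes_def)
  define V where "V = four_block_mat (1\<^sub>m 1) (0\<^sub>m 1 n) (0\<^sub>m n 1) U"
  have Vc: "V \<in> carrier_mat (Suc n) (Suc n)"
    using four_block_carrier_mat[of "1\<^sub>m 1" 1 1 U n n] U by (simp add: V_def)
  have adj0: "mat_adjoint (0\<^sub>m n m :: complex mat) = 0\<^sub>m m n" for n m
    by (intro eq_matI) (auto simp: mat_adjoint_entry[of _ n m])
  have aV: "mat_adjoint V = four_block_mat (1\<^sub>m 1) (0\<^sub>m 1 n) (0\<^sub>m n 1) (mat_adjoint U)"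
    using U(1) unfolding V_def by (subst mat_adjoint_four_block[of _ 1 1 _ n _ n]) (auto simp: adj0)
  have VV: "mat_adjoint V * V = 1\<^sub>m (Suc n)"
    unfolding aV unfolding V_def using U by (subst mult_four_block_mat[of _ 1 1 _ n _ n _ _ 1 _ n]) auto
  define f where "f = case_nat r d"
  define D where "D = mat_diag (Suc n) (\<lambda>i. complex_of_real (f i))"
  have Dc: "D \<in> carrier_mat (Suc n) (Suc n)" by (simp add: D_def)
  have D: "D = four_block_mat (mat_diag 1 (\<lambda>_. e)) (0\<^sub>m 1 n) (0\<^sub>m n 1) (mat_diag n (\<lambda>i. complex_of_real (d i)))"
    by (intro eq_matI) (auto simp: D_def mat_diag_def f_def r split: nat.splits)
  have one1: "1\<^sub>m 1 = mat_diag 1 (\<lambda>_. 1 :: complex)" by simp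
  have blk: "four_block_mat (mat_diag 1 (\<lambda>_. a)) (0\<^sub>m 1 n) (0\<^sub>m n 1) P *
      four_block_mat (mat_diag 1 (\<lambda>_. b)) (0\<^sub>m 1 n) (0\<^sub>m n 1) Q =
      four_block_mat (mat_diag 1 (\<lambda>_. a * b)) (0\<^sub>m 1 n) (0\<^sub>m n 1) (P * Q)"
    if "P \<in> carrier_mat n n" "Q \<in> carrier_mat n n" for P Q and a b :: complex
    using that left_add_zero_mat[of "P * Q" n n]
      right_mult_zero_mat[OF mat_diag_dim[of 1 "\<lambda>_. a"], of n]
      left_mult_zero_mat[OF mat_diag_dim[of 1 "\<lambda>_. b"], of n]
    by (subst mult_four_block_mat[of _ 1 1 _ n _ n _ _ 1 _ n]) (auto simp del: One_nat_def)
  have BVD: "B = V * D * mat_adjoint V"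
  proof -
    have "V * D * mat_adjoint V = four_block_mat (mat_diag 1 (\<lambda>_. e)) (0\<^sub>m 1 n) (0\<^sub>m n 1) C"
      unfolding aV D C unfolding V_def one1
      using U(1) by (simp add: blk mult_carrier_mat[of _ n n] del: mat_diag_one One_nat_def)
    also have "\<dots> = B"
    proof (rule eq_matI)
      fix i j assume "i < dim_row B" "j < dim_col B"
      hence ij: "i < Suc n" "j < Suc n" using Bc by auto
      show "four_block_mat (mat_diag 1 (\<lambda>_. e)) (0\<^sub>m 1 n) (0\<^sub>m n 1) C $$ (i, j) = B $$ (i, j)"
      proof (cases "i = 0")
        case True
        have "B $$ (0, j) = e * (if j = 0 then 1 else 0)"
          by (subst Badj) (use ij B0[of j] r in auto)
        thus ?thesis using True ij Cc by (auto simp: mat_diag_def)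
      next
        case False
        thus ?thesis using ij B0[of i] by (cases "j = 0") (auto simp: C_def mat_diag_def)
      qed
    qed (use Bc Cc in \<open>auto simp: mat_diag_def\<close>)
    finally show ?thesis by simp
  qed
  have "A = H * B * H"
  proof -
    have "H * B * H = (H * H) * A * (H * H)" using A H(1) by (simp add: B_def assoc)
    thus ?thesis using A H(3) by simp
  qed
  also have "\<dots> = (H * V) * D * mat_adjoint (H * V)"
    using H(1,2) Vc Dc by (simp add: BVD mat_adjoint_mult[of _ "Suc n" "Suc n" _ "Suc n"] assoc
      mult_carrier_mat[of _ "Suc n" "Suc n" _ "Suc n"])
  finally have 1: "A = (H * V) * D * mat_adjoint (H * V)" .
  have "mat_adjoint (H * V) * (H * V) = mat_adjoint V * ((H * H) * V)"
    using H(1,2) Vc by (simp add: mat_adjoint_mult[of _ "Suc n" "Suc n" _ "Suc n"] assoc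
      mult_carrier_mat[of _ "Suc n" "Suc n" _ "Suc n"])
  hence "mat_adjoint (H * V) * (H * V) = 1\<^sub>m (Suc n)" using H(3) Vc VV by simp
  with 1 have "unitarily_diagonalizes (H * V) f A"
    using A H(1) Vc by (auto simp: unitarily_diagonalizes_def D_def)
  thus ?case by blast
qed

section \<open>Trace, determinant and eigenvalues read off a unitary diagonalization\<close>

definition mtrace :: "complex mat \<Rightarrow> complex" where
  "mtrace A = (\<Sum>i<dim_row A. A $$ (i, i))"

lemma mtrace_mult_commute:
  assumes "A \<in> carrier_mat n m" "B \<in> carrier_mat m n"
  shows "mtrace (A * B) = mtrace (B * A)"
proof -
  have "mtrace (A * B) = (\<Sum>i<n. \<Sum>j<m. A $$ (i, j) * B $$ (j, i))"
    using assms by (auto simp: mtrace_def scalar_prod_def atLeast0LessThan intro!: sum.cong)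
  also have "\<dots> = (\<Sum>j<m. \<Sum>i<n. B $$ (j, i) * A $$ (i, j))"
    by (subst sum.swap) (simp add: mult.commute)
  also have "\<dots> = mtrace (B * A)"
    using assms by (auto simp: mtrace_def scalar_prod_def atLeast0LessThan intro!: sum.cong)
  finally show ?thesis .
qed

context
  fixes A U :: "complex mat" and d :: "nat \<Rightarrow> real" and n :: nat
  assumes A: "A \<in> carrier_mat n n" and dg: "unitarily_diagonalizes U d A"
begin

lemma diagonalization:
  shows "U \<in> carrier_mat n n" "mat_adjoint U * U = 1\<^sub>m n" "U * mat_adjoint U = 1\<^sub>m n"
    "A = U * mat_diag n (\<lambda>i. complex_of_real (d i)) * mat_adjoint U"
    "similar_mat_wit A (mat_diag n (\<lambda>i. complex_of_real (d i))) U (mat_adjoint U)"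
proof -
  show U: "U \<in> carrier_mat n n" "mat_adjoint U * U = 1\<^sub>m n"
    "A = U * mat_diag n (\<lambda>i. complex_of_real (d i)) * mat_adjoint U"
    using A dg by (auto simp: unitarily_diagonalizes_def)
  show U': "U * mat_adjoint U = 1\<^sub>m n" by (rule unitary_right[OF U(1,2)])
  show "similar_mat_wit A (mat_diag n (\<lambda>i. complex_of_real (d i))) U (mat_adjoint U)"
    unfolding similar_mat_wit_def Let_def using U U' A by auto
qed

lemma det_diagonalization: "Determinant.det A = (\<Prod>i<n. complex_of_real (d i))"
proof -
  have "similar_mat A (mat_diag n (\<lambda>i. complex_of_real (d i)))"
    using diagonalization(5) by (auto simp: similar_mat_def)
  hence "Determinant.det A = Determinant.det (mat_diag n (\<lambda>i. complex_of_real (d i)))"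
    by (rule det_similar)
  also have "\<dots> = prod_list (diag_mat (mat_diag n (\<lambda>i. complex_of_real (d i))))"
    by (rule det_upper_triangular[of _ n]) (auto simp: mat_diag_def)
  also have "diag_mat (mat_diag n (\<lambda>i. complex_of_real (d i))) = map (\<lambda>i. complex_of_real (d i)) [0..<n]"
    by (auto simp: diag_mat_def mat_diag_def)
  finally show ?thesis by (simp add: prod.distinct_set_conv_list[symmetric] atLeast0LessThan)
qed

lemma proots_char_poly_diagonalization:
  "proots (char_poly A) = image_mset (\<lambda>i. complex_of_real (d i)) (mset_set {..<n})"
proof -
  have "similar_mat A (mat_diag n (\<lambda>i. complex_of_real (d i)))"
    using diagonalization(5) by (auto simp: similar_mat_def)
  hence "char_poly A = char_poly (mat_diag n (\<lambda>i. complex_of_real (d i)))"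
    by (rule char_poly_similar)
  also have "\<dots> = (\<Prod>a\<leftarrow>diag_mat (mat_diag n (\<lambda>i. complex_of_real (d i))). [:- a, 1:])"
    by (rule char_poly_upper_triangular[of _ n]) (auto simp: mat_diag_def)
  also have "diag_mat (mat_diag n (\<lambda>i. complex_of_real (d i))) = map (\<lambda>i. complex_of_real (d i)) [0..<n]"
    by (auto simp: diag_mat_def mat_diag_def)
  also have "(\<Prod>a\<leftarrow>map (\<lambda>i. complex_of_real (d i)) [0..<n]. [:- a, 1:]) =
      (\<Prod>i<n. [:- complex_of_real (d i), 1:])"
    by (simp add: prod.distinct_set_conv_list[symmetric] atLeast0LessThan o_def)
  finally have "proots (char_poly A) = (\<Sum>i<n. proots [:- complex_of_real (d i), 1:])"
    by (simp add: proots_prod)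
  also have "\<dots> = image_mset (\<lambda>i. complex_of_real (d i)) (mset_set {..<n})"
    by (induction n) (auto simp: lessThan_Suc)
  finally show ?thesis .
qed

lemma mtrace_pow_diagonalization: "mtrace (A ^\<^sub>m m) = (\<Sum>i<n. complex_of_real (d i ^ m))"
proof -
  define D where "D = mat_diag n (\<lambda>i. complex_of_real (d i))"
  have Dp: "D ^\<^sub>m m = mat_diag n (\<lambda>i. complex_of_real (d i) ^ m)"
    by (induction m) (auto simp: D_def mult.commute mat_diag_dim[THEN carrier_matD(1)])
  have "A ^\<^sub>m m = U * D ^\<^sub>m m * mat_adjoint U"
    using similar_mat_wit_pow_id[OF diagonalization(5)] by (simp add: D_def)
  hence "mtrace (A ^\<^sub>m m) = mtrace (U * (D ^\<^sub>m m * mat_adjoint U))"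
    using diagonalization(1) by (simp add: D_def assoc_mult_mat[of _ n n _ n _ n])
  also have "\<dots> = mtrace ((D ^\<^sub>m m * mat_adjoint U) * U)"
    using diagonalization(1)
    by (intro mtrace_mult_commute[of _ n n] mult_carrier_mat[of _ n n]) (auto simp: D_def)
  also have "(D ^\<^sub>m m * mat_adjoint U) * U = D ^\<^sub>m m"
    using diagonalization(1,2)
    by (simp add: D_def assoc_mult_mat[of _ n n _ n _ n] right_mult_one_mat[of _ n n])
  finally show ?thesis by (simp add: Dp mtrace_def mat_diag_def)
qed

end

lemma mat_adjoint_eq_transpose: "mat_adjoint A = transpose_mat (map_mat cnj A)"
  by (intro eq_matI) (auto simp: mat_adjoint_entry[of A "dim_row A" "dim_col A"])

lemma det_mat_adjoint:
  assumes "A \<in> carrier_mat n n"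
  shows "Determinant.det (mat_adjoint A) = cnj (Determinant.det A)"
proof -
  interpret comm_ring_hom cnj by standard auto
  have "Determinant.det (mat_adjoint A) = Determinant.det (map_mat cnj A)"
    using assms by (simp add: mat_adjoint_eq_transpose det_transpose[of _ n])
  thus ?thesis by (simp add: hom_det)
qed

text \<open>Conjugating by U turns 1 + X^2 into 1 + Y' Y, where Y = X U and Y' is its adjoint. The
  i-th eigenvalue is thus 1 plus the squared norm of the i-th column of Y.\<close>

lemma one_plus_square_eigenvalue_ge_1:
  assumes X: "X \<in> carrier_mat n n" "mat_adjoint X = X"
    and dg: "unitarily_diagonalizes U e (1\<^sub>m n + X * X)" and i: "i < n"
  shows "e i \<ge> 1"
proof -
  define A where "A = 1\<^sub>m n + X * X"
  have A: "A \<in> carrier_mat n n" using X by (simp add: A_def)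
  have dg: "unitarily_diagonalizes U e A" using dg by (simp add: A_def)
  note D = diagonalization[OF A dg]
  note assoc = assoc_mult_mat[of _ n n _ n _ n]
  define E where "E = mat_diag n (\<lambda>i. complex_of_real (e i))"
  have "mat_adjoint U * A * U = (mat_adjoint U * U) * E * (mat_adjoint U * U)"
    using D(1) by (subst D(4)) (simp add: assoc E_def mult_carrier_mat[of _ n n])
  hence 1: "mat_adjoint U * A * U = E" using D(2)
    by (simp add: E_def right_mult_one_mat[of _ n n] left_mult_one_mat[of _ n n])
  have XU: "X * U \<in> carrier_mat n n" using X D(1) by auto
  have "mat_adjoint U * A * U = mat_adjoint U * (A * U)" using D(1) A by (simp add: assoc)
  also have "A * U = U + X * (X * U)"
    using X D(1) by (simp add: A_def add_mult_distrib_mat[of _ n n] assoc)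
  also have "mat_adjoint U * (U + X * (X * U)) = 1\<^sub>m n + mat_adjoint (X * U) * (X * U)"
    using X D(1) XU by (simp add: mult_add_distrib_mat[of _ n n _ n] D(2) mat_adjoint_mult[of _ n n _ n] assoc)
  finally have "E $$ (i, i) = (1\<^sub>m n + mat_adjoint (X * U) * (X * U)) $$ (i, i)" by (simp add: 1)
  moreover have "(1\<^sub>m n + mat_adjoint Y * Y) $$ (i, i) = 1 + (\<Sum>k<n. cnj (Y $$ (k, i)) * Y $$ (k, i))"
    if "Y \<in> carrier_mat n n" for Y :: "complex mat"
    using i that by (simp add: scalar_prod_def atLeast0LessThan mat_adjoint_entry[OF that])
  ultimately have "complex_of_real (e i) = 1 + (\<Sum>k<n. cnj ((X * U) $$ (k, i)) * (X * U) $$ (k, i))"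
    using i XU by (simp add: E_def mat_diag_def del: index_mult_mat(1) index_add_mat(1))
  also have "\<dots> = complex_of_real (1 + (\<Sum>k<n. cmod ((X * U) $$ (k, i))^2))"
    by (simp only: of_real_add of_real_1 of_real_sum complex_norm_square mult.commute)
  finally have "e i = 1 + (\<Sum>k<n. cmod ((X * U) $$ (k, i))^2)" by (simp only: of_real_eq_iff)
  thus ?thesis by (simp add: sum_nonneg)
qed

text \<open>\<open>herm_powr\<close> works with whichever diagonalization \<open>SOME\<close>
  returns. The determinant does not see this choice: it is the product of the powers of the
  eigenvalues, hence the power of the determinant of 1 + X^2.\<close>

lemma
  assumes X: "X \<in> carrier_mat n n" "mat_adjoint X = X"
  shows det_one_plus_square: "\<exists>r\<ge>1. Determinant.det (1\<^sub>m n + X * X) = complex_of_real r"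
    and cauchy_weight_eq_det:
      "cauchy_weight s n X = Re (Determinant.det (1\<^sub>m n + X * X)) powr (- s - real n)"
proof -
  define A where "A = 1\<^sub>m n + X * X"
  have A: "A \<in> carrier_mat n n" using X by (simp add: A_def)
  have "mat_adjoint A = A"
  proof (rule eq_matI)
    fix i j assume "i < dim_row A" "j < dim_col A"
    hence ij: "i < n" "j < n" using A by auto
    have "mat_adjoint (X * X) = X * X" using X by (simp add: mat_adjoint_mult[of _ n n _ n])
    hence "cnj ((X * X) $$ (j, i)) = (X * X) $$ (i, j)"
      using mat_adjoint_entry[of "X * X" n n i j] X ij by (simp del: index_mult_mat(1))
    thus "mat_adjoint A $$ (i, j) = A $$ (i, j)"
      unfolding mat_adjoint_entry[OF A ij] using X ij by (simp add: A_def del: index_mult_mat(1))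
  qed (use A in auto)
  from hermitian_unitarily_diagonalizable[OF A this]
  have ex: "\<exists>p. case p of (U, d) \<Rightarrow> unitarily_diagonalizes U d A" by auto
  obtain U e where Ue: "(SOME (U, d). unitarily_diagonalizes U d A) = (U, e)"
    by (rule prod.exhaust)
  with someI_ex[OF ex] have dg: "unitarily_diagonalizes U e A" by simp
  have e1: "e i \<ge> 1" if "i < n" for i
    using one_plus_square_eigenvalue_ge_1[OF X] dg that by (simp add: A_def)
  have detA: "Determinant.det A = complex_of_real (\<Prod>i<n. e i)"
    by (simp add: det_diagonalization[OF A dg])
  moreover have "(\<Prod>i<n. e i) \<ge> 1" using e1 by (intro prod_ge_1) auto
  ultimately show "\<exists>r\<ge>1. Determinant.det (1\<^sub>m n + X * X) = complex_of_real r"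
    unfolding A_def by blast
  define p where "p = - s - real n"
  define B where "B = herm_powr A p"
  have B: "B = U * mat_diag n (\<lambda>i. complex_of_real (e i powr p)) * mat_adjoint U"
    using A by (simp add: B_def herm_powr_def Ue)
  have Bc: "B \<in> carrier_mat n n" using diagonalization(1)[OF A dg] by (simp add: B mult_carrier_mat[of _ n n])
  have "unitarily_diagonalizes U (\<lambda>i. e i powr p) B"
    using diagonalization(1,2)[OF A dg] B Bc by (auto simp: unitarily_diagonalizes_def)
  hence "Re (Determinant.det B) = (\<Prod>i<n. e i powr p)"
    by (simp add: det_diagonalization[OF Bc] flip: of_real_prod)
  also have "\<dots> = (\<Prod>i<n. e i) powr p"
    by (rule prod_powr_distrib[symmetric])
  finally show "cauchy_weight s n X = Re (Determinant.det (1\<^sub>m n + X * X)) powr (- s - real n)"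
    using detA by (simp add: cauchy_weight_def B_def A_def p_def del: of_real_prod)
qed

text \<open>Evenness of the exponent enters here: the absolute values disappear, so a function of
  the eigenvalues becomes a polynomial in the matrix entries, which can be differentiated
  entrywise.\<close>

lemma trace_abs_power_even:
  assumes X: "X \<in> carrier_mat n n" "mat_adjoint X = X"
  shows "complex_of_real (trace_abs_power X (2 * m)) = mtrace (X ^\<^sub>m (2 * m))"
proof -
  obtain U d where dg: "unitarily_diagonalizes U d X"
    using hermitian_unitarily_diagonalizable[OF X] by blast
  have "trace_abs_power X (2 * m) = (\<Sum>i<n. \<bar>d i\<bar> ^ (2 * m))"
    unfolding trace_abs_power_def proots_char_poly_diagonalization[OF X(1) dg]
      sum_unfold_sum_mset image_mset.compositionality o_def norm_of_real ..
  thus ?thesis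
    by (simp add: mtrace_pow_diagonalization[OF X(1) dg] power_mult)
qed

section \<open>Integrability against the Cauchy weight\<close>

lemma nn_integral_cauchy_powr_finite:
  fixes g :: real
  assumes "g > 1 / 2"
  shows "(\<integral>\<^sup>+y. ennreal ((1 + y\<^sup>2) powr (- g)) \<partial>lborel) < \<infinity>"
proof -
  have tail: "(\<integral>\<^sup>+y. ennreal (\<bar>y\<bar> powr (- 2 * g)) * indicator {1..} y \<partial>lborel) < \<infinity>"
  proof -
    have "(\<integral>\<^sup>+y. ennreal (\<bar>y\<bar> powr (- 2 * g)) * indicator {1..} y \<partial>lborel)
        = 0 - 1 powr (1 - 2 * g) / (1 - 2 * g)"
    proof (rule nn_integral_FTC_atLeast[where F = "\<lambda>y. y powr (1 - 2 * g) / (1 - 2 * g)" and T = 0])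
      fix y :: real assume "1 \<le> y"
      thus "((\<lambda>y. y powr (1 - 2 * g) / (1 - 2 * g)) has_real_derivative \<bar>y\<bar> powr (- 2 * g)) (at y)"
        using assms by (auto intro!: derivative_eq_intros)
    next
      have "((\<lambda>y :: real. y powr (1 - 2 * g)) \<longlongrightarrow> 0) at_top"
        using assms by (intro tendsto_neg_powr filterlim_ident) auto
      thus "((\<lambda>y. y powr (1 - 2 * g) / (1 - 2 * g)) \<longlongrightarrow> 0) at_top"
        by (rule tendsto_divide_zero)
    qed auto
    thus ?thesis by simp
  qed
  have tail': "(\<integral>\<^sup>+y. ennreal (\<bar>y\<bar> powr (- 2 * g)) * indicator {..-1} y \<partial>lborel) < \<infinity>"
  proof -
    have "(\<integral>\<^sup>+y. ennreal (\<bar>y\<bar> powr (- 2 * g)) * indicator {..-1} y \<partial>lborel)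
      = (\<integral>\<^sup>+y. ennreal (\<bar>y\<bar> powr (- 2 * g)) * indicator {1..} y \<partial>lborel)"
      by (subst nn_integral_real_affine[of _ "-1" 0]) (auto intro!: nn_integral_cong simp: indicator_def)
    thus ?thesis using tail by simp
  qed
  have "(\<integral>\<^sup>+y. ennreal ((1 + y\<^sup>2) powr (- g)) \<partial>lborel) \<le>
     (\<integral>\<^sup>+y. indicator {-1..1} y + (ennreal (\<bar>y\<bar> powr (- 2 * g)) * indicator {1..} y
        + ennreal (\<bar>y\<bar> powr (- 2 * g)) * indicator {..-1} y) \<partial>lborel)"
  proof (rule nn_integral_mono)
    fix y :: real
    have 1: "(1 + y\<^sup>2) powr (- g) \<le> 1"
      using assms powr_mono2'[of "- g" 1 "1 + y\<^sup>2"] by simp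
    have 2: "(1 + y\<^sup>2) powr (- g) \<le> \<bar>y\<bar> powr (- 2 * g)" if "\<bar>y\<bar> \<ge> 1"
    proof -
      have "(1 + y\<^sup>2) powr (- g) \<le> (\<bar>y\<bar>\<^sup>2) powr (- g)"
        using assms that by (intro powr_mono2') auto
      also have "\<dots> = \<bar>y\<bar> powr (- 2 * g)"
      proof -
        have "\<bar>y\<bar> > 0" using that by linarith
        hence "\<bar>y\<bar> powr 2 = \<bar>y\<bar>\<^sup>2" by (intro powr_numeral) auto
        moreover have "(\<bar>y\<bar> powr 2) powr (- g) = \<bar>y\<bar> powr (- 2 * g)" unfolding powr_powr by simp
        ultimately show ?thesis by (simp only:)
      qed
      finally show ?thesis .
    qed
    consider "\<bar>y\<bar> \<le> 1" | "y > 1" | "y < -1" by linarith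
    thus "ennreal ((1 + y\<^sup>2) powr (- g)) \<le> indicator {-1..1} y + (ennreal (\<bar>y\<bar> powr (- 2 * g)) * indicator {1..} y
        + ennreal (\<bar>y\<bar> powr (- 2 * g)) * indicator {..-1} y)"
    proof cases
      case 1
      hence "(indicator {-1..1} y :: ennreal) = 1" by (auto simp: indicator_def)
      moreover have "ennreal ((1 + y\<^sup>2) powr (- g)) \<le> 1" using \<open>(1 + y\<^sup>2) powr (- g) \<le> 1\<close> by simp
      ultimately show ?thesis by (metis add_increasing2 zero_le)
    qed (use 2 in \<open>auto simp: indicator_def intro!: ennreal_leI\<close>)
  qed
  also have "\<dots> = emeasure lborel {-1..1 :: real} + ((\<integral>\<^sup>+y. ennreal (\<bar>y\<bar> powr (- 2 * g)) * indicator {1..} y \<partial>lborel)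
      + (\<integral>\<^sup>+y. ennreal (\<bar>y\<bar> powr (- 2 * g)) * indicator {..-1} y \<partial>lborel))"
    by (simp add: nn_integral_add)
  also have "\<dots> < \<infinity>" using tail tail' by (simp add: ennreal_add_less_top)
  finally show ?thesis .
qed

text \<open>For g > 1/2 this is sqrt(pi) Gamma(g - 1/2) / Gamma(g). For g at most 1/2 the integral
  is infinite and \<open>enn2real\<close> returns 0.\<close>

definition cauchy_const :: "real \<Rightarrow> real" where
  "cauchy_const g = enn2real (\<integral>\<^sup>+y. ennreal ((1 + y\<^sup>2) powr (- g)) \<partial>lborel)"

lemma cauchy_const_nonneg [simp]: "cauchy_const g \<ge> 0"
  by (simp add: cauchy_const_def)

text \<open>An affine substitution pulls A out of the quadratic. The effect to remember: integrating
  out one real variable raises the exponent of A from -g to 1/2 - g and costs 1 / sqrt b.\<close>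

lemma nn_integral_cauchy_quadratic:
  fixes g A b r :: real
  assumes "g > 1 / 2" "A > 0" "b > 0"
  shows "(\<integral>\<^sup>+y. ennreal ((A + b * (y - r)\<^sup>2) powr (- g)) \<partial>lborel)
    = ennreal (cauchy_const g * A powr (1 / 2 - g) / sqrt b)"
proof -
  \<comment> \<open>The scale for which b c^2 = A, so that the quadratic becomes A (1 +
    y^2).\<close>
  define c where "c = sqrt (A / b)"
  have c: "c > 0" "b * c\<^sup>2 = A" using assms by (auto simp: c_def)
  have "(\<integral>\<^sup>+y. ennreal ((A + b * (y - r)\<^sup>2) powr (- g)) \<partial>lborel)
     = ennreal c * (\<integral>\<^sup>+y. ennreal ((A + b * (r + c * y - r)\<^sup>2) powr (- g)) \<partial>lborel)"
    using c by (subst nn_integral_real_affine[of _ c r]) auto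
  also have "(\<lambda>y. ennreal ((A + b * (r + c * y - r)\<^sup>2) powr (- g))) =
      (\<lambda>y. ennreal (A powr (- g)) * ennreal ((1 + y\<^sup>2) powr (- g)))"
  proof
    fix y :: real
    have "A + b * (r + c * y - r)\<^sup>2 = A + (b * c\<^sup>2) * y\<^sup>2" by (simp add: power_mult_distrib)
    also have "\<dots> = A * (1 + y\<^sup>2)" by (simp add: c algebra_simps)
    finally show "ennreal ((A + b * (r + c * y - r)\<^sup>2) powr (- g)) =
        ennreal (A powr (- g)) * ennreal ((1 + y\<^sup>2) powr (- g))"
      using assms by (simp add: powr_mult ennreal_mult)
  qed
  also have "(\<integral>\<^sup>+y. ennreal (A powr (- g)) * ennreal ((1 + y\<^sup>2) powr (- g)) \<partial>lborel) =
      ennreal (A powr (- g)) * ennreal (cauchy_const g)"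
    using nn_integral_cauchy_powr_finite[OF assms(1)]
    by (simp add: nn_integral_cmult cauchy_const_def)
  also have "ennreal c * (ennreal (A powr (- g)) * ennreal (cauchy_const g)) =
      ennreal (c * (A powr (- g) * cauchy_const g))"
    using c by (simp add: ennreal_mult)
  also have "c = A powr (1 / 2) / sqrt b" using assms by (simp add: c_def real_sqrt_divide powr_half_sqrt)
  also have "A powr (1 / 2) / sqrt b * (A powr (- g) * cauchy_const g) =
      cauchy_const g * (A powr (1 / 2) * A powr (- g)) / sqrt b" by simp
  also have "A powr (1 / 2) * A powr (- g) = A powr (1 / 2 - g)" by (simp flip: powr_add)
  finally show ?thesis .
qed

subsection \<open>Integrals of inverse powers of positive definite Hermitian forms\<close>

text \<open>Forms are given by functions on indices with the size as a separate argument, so that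
  passing to a Schur complement merely lowers \<open>m\<close>.\<close>

definition sesq :: "(nat \<Rightarrow> nat \<Rightarrow> complex) \<Rightarrow> nat \<Rightarrow> (nat \<Rightarrow> complex) \<Rightarrow> complex" where
  "sesq M m z = (\<Sum>i<m. \<Sum>j<m. cnj (z i) * M i j * z j)"

definition posdef :: "(nat \<Rightarrow> nat \<Rightarrow> complex) \<Rightarrow> nat \<Rightarrow> bool" where
  "posdef M m \<longleftrightarrow> (\<forall>i<m. \<forall>j<m. M i j = cnj (M j i)) \<and> (\<forall>z. (\<exists>i<m. z i \<noteq> 0) \<longrightarrow> Re (sesq M m z) > 0)"

lemma posdef_hermitian: "posdef M m \<Longrightarrow> i < m \<Longrightarrow> j < m \<Longrightarrow> M i j = cnj (M j i)"
  unfolding posdef_def by blast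

lemma posdef_pos:
  assumes "posdef M m" "i < m" "z i \<noteq> 0" shows "Re (sesq M m z) > 0"
proof -
  have "(\<exists>i<m. z i \<noteq> 0) \<longrightarrow> Re (sesq M m z) > 0" using assms(1) unfolding posdef_def by (elim conjE spec)
  thus ?thesis using assms(2,3) by blast
qed

lemma sesq_cong: "(\<And>i. i < m \<Longrightarrow> z i = z' i) \<Longrightarrow> sesq M m z = sesq M m z'"
  unfolding sesq_def by (intro sum.cong) auto

lemma posdef_nonneg:
  assumes "posdef M m" shows "Re (sesq M m z) \<ge> 0"
proof (cases "\<exists>i<m. z i \<noteq> 0")
  case True
  thus ?thesis using posdef_pos[OF assms] by (meson less_imp_le)
next
  case False
  hence "sesq M m z = sesq M m (\<lambda>_. 0)" by (intro sesq_cong) auto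
  thus ?thesis by (simp add: sesq_def)
qed

definition schur_compl :: "(nat \<Rightarrow> nat \<Rightarrow> complex) \<Rightarrow> nat \<Rightarrow> nat \<Rightarrow> nat \<Rightarrow> complex" where
  "schur_compl M m i j = M i j - M i m * M m j / M m m"

context
  fixes M :: "nat \<Rightarrow> nat \<Rightarrow> complex" and m :: nat
  assumes pd: "posdef M (Suc m)"
begin

lemma posdef_pivot: obtains d where "d > 0" "M m m = complex_of_real d"
proof -
  have "M m m = cnj (M m m)" by (rule posdef_hermitian[OF pd]) auto
  then obtain d where d: "M m m = complex_of_real d" by (metis Reals_cases Reals_cnj_iff)
  have "Re (sesq M (Suc m) (\<lambda>i. if i = m then 1 else 0)) > 0"
    by (rule posdef_pos[OF pd, of m]) auto
  hence "d > 0" by (simp add: sesq_def d)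
  with d that show ?thesis by blast
qed

text \<open>Completing the square in the last coordinate: the cross terms are absorbed by a shift of
  \<open>z m\<close>, and what they leave over is exactly the correction in the Schur
  complement.\<close>

lemma sesq_complete_square:
  assumes d: "M m m = complex_of_real d" "d > 0"
  shows "sesq M (Suc m) z = complex_of_real (d * cmod (z m + (\<Sum>j<m. M m j * z j) / M m m)^2) + sesq (schur_compl M m) m z"
proof -
  define b where "b = (\<Sum>j<m. M m j * z j)"
  note h = posdef_hermitian[OF pd]
  have "M i m = cnj (M m i)" if "i < m" for i
    by (rule h) (use that in auto)
  hence cb: "(\<Sum>i<m. cnj (z i) * M i m) = cnj b"
    unfolding b_def cnj_sum by (intro sum.cong) auto
  have "sesq M (Suc m) z = (\<Sum>i<m. (\<Sum>j<m. cnj (z i) * M i j * z j) + cnj (z i) * M i m * z m)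
      + ((\<Sum>j<m. cnj (z m) * M m j * z j) + cnj (z m) * M m m * z m)"
    by (simp add: sesq_def)
  also have "\<dots> = (\<Sum>i<m. \<Sum>j<m. cnj (z i) * M i j * z j) + cnj b * z m + (cnj (z m) * b + cnj (z m) * M m m * z m)"
    unfolding cb[symmetric] unfolding b_def
    by (simp add: sum.distrib sum_distrib_left sum_distrib_right mult.assoc)
  finally have 1: "sesq M (Suc m) z = (\<Sum>i<m. \<Sum>j<m. cnj (z i) * M i j * z j) + cnj b * z m + (cnj (z m) * b + cnj (z m) * M m m * z m)" .
  have "(\<Sum>i<m. \<Sum>j<m. cnj (z i) * (M i m * M m j / M m m) * z j) = (\<Sum>i<m. cnj (z i) * M i m) * b / M m m"
    unfolding b_def sum_product sum_divide_distrib by (intro sum.cong refl) simp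
  hence 2: "sesq (schur_compl M m) m z = (\<Sum>i<m. \<Sum>j<m. cnj (z i) * M i j * z j) - cnj b * b / M m m"
    unfolding sesq_def schur_compl_def cb by (simp add: algebra_simps sum_subtractf)
  have "complex_of_real (d * cmod (z m + b / M m m)^2) = M m m * ((z m + b / M m m) * cnj (z m + b / M m m))"
    by (simp only: of_real_mult complex_norm_square d)
  also have "\<dots> = cnj b * z m + (cnj (z m) * b + cnj (z m) * M m m * z m) + cnj b * b / M m m"
    using d by (simp add: field_simps)
  finally show ?thesis unfolding 1 2 b_def[symmetric] by simp
qed

lemma posdef_schur_compl: "posdef (schur_compl M m) m"
proof -
  obtain d where d: "d > 0" "M m m = complex_of_real d" by (rule posdef_pivot)
  note h = posdef_hermitian[OF pd]
  have "schur_compl M m i j = cnj (schur_compl M m j i)" if "i < m" "j < m" for i j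
    using h[of i j] h[of i m] h[of m j] that d by (simp add: schur_compl_def)
  moreover have "Re (sesq (schur_compl M m) m z) > 0" if z: "\<exists>i<m. z i \<noteq> 0" for z
  proof -
    \<comment> \<open>The last coordinate is chosen so that the completed square vanishes; the full
      form at \<open>z'\<close> is then the form of the Schur complement at
      \<open>z\<close>.\<close>
    define z' where "z' i = (if i = m then - (\<Sum>j<m. M m j * z j) / M m m else z i)" for i
    obtain i where "i < m" "z i \<noteq> 0" using z by blast
    hence "Re (sesq M (Suc m) z') > 0" by (intro posdef_pos[OF pd, of i]) (auto simp: z'_def)
    moreover have "(\<Sum>j<m. M m j * z' j) = (\<Sum>j<m. M m j * z j)"
      by (intro sum.cong) (auto simp: z'_def)
    moreover have "sesq (schur_compl M m) m z' = sesq (schur_compl M m) m z"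
      by (intro sesq_cong) (auto simp: z'_def)
    ultimately show ?thesis
      unfolding sesq_complete_square[OF d(2,1)] by (simp add: z'_def)
  qed
  ultimately show ?thesis unfolding posdef_def by blast
qed

text \<open>Column operations with the last column as pivot, collected in the unit lower triangular
  matrix \<open>E\<close>, clear the last row up to the pivot and put the Schur complement into the
  leading block.\<close>

lemma det_schur_compl:
  "Determinant.det (Matrix.mat (Suc m) (Suc m) (\<lambda>(i, j). M i j)) =
    Determinant.det (Matrix.mat m m (\<lambda>(i, j). schur_compl M m i j)) * M m m"
proof -
  obtain d where d: "d > 0" "M m m = complex_of_real d" by (rule posdef_pivot)
  define A where "A = Matrix.mat (Suc m) (Suc m) (\<lambda>(i, j). M i j)"
  define E where "E = Matrix.mat (Suc m) (Suc m)
    (\<lambda>(i, j). if i = j then 1 else if i = m then - M m j / M m m else 0)"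
  have Ec: "E \<in> carrier_mat (Suc m) (Suc m)" by (simp add: E_def)
  have AE: "(A * E) $$ (i, j) = (if j = m then M i m else schur_compl M m i j)"
    if "i < Suc m" "j < Suc m" for i j
  proof -
    have "(A * E) $$ (i, j) = (\<Sum>k<Suc m. M i k * (if k = j then 1 else if k = m then - M m j / M m m else 0))"
      using that by (simp add: A_def E_def scalar_prod_def atLeast0LessThan)
    also have "\<dots> = (\<Sum>k<m. if k = j then M i k else 0) + M i m * (if j = m then 1 else - M m j / M m m)"
      unfolding sum.lessThan_Suc by (intro arg_cong2[of _ _ _ _ "(+)"] sum.cong) auto
    also have "\<dots> = (if j = m then M i m else schur_compl M m i j)"
      using that by (auto simp: schur_compl_def less_Suc_eq)
    finally show ?thesis .
  qed
  have "A * E = four_block_mat (Matrix.mat m m (\<lambda>(i, j). schur_compl M m i j)) (Matrix.mat m 1 (\<lambda>(i, j). M i m))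
      (0\<^sub>m 1 m) (Matrix.mat 1 1 (\<lambda>(i, j). M m m))" (is "_ = ?B")
  proof (rule eq_matI)
    fix i j assume "i < dim_row ?B" "j < dim_col ?B"
    hence ij: "i < Suc m" "j < Suc m" by auto
    show "(A * E) $$ (i, j) = ?B $$ (i, j)"
      unfolding AE[OF ij] using ij d by (auto simp: schur_compl_def less_Suc_eq)
  qed (auto simp: A_def E_def)
  hence "Determinant.det (A * E) = Determinant.det (Matrix.mat m m (\<lambda>(i, j). schur_compl M m i j)) *
      Determinant.det (Matrix.mat 1 1 (\<lambda>(i, j). M m m))"
    by (simp add: det_four_block_mat_lower_left_zero[of _ m _ 1])
  moreover have "diag_mat E = replicate (Suc m) 1"
    by (intro nth_equalityI) (auto simp: diag_mat_def E_def simp del: upt_Suc replicate_Suc)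
  moreover have "Determinant.det E = prod_list (diag_mat E)"
    by (rule det_lower_triangular[of "Suc m"]) (auto simp: E_def)
  moreover have "Determinant.det (A * E) = Determinant.det A * Determinant.det E"
    by (rule det_mult) (use Ec in \<open>auto simp: A_def\<close>)
  ultimately show ?thesis by (simp add: A_def det_single del: replicate_Suc)
qed

end

abbreviation lebesgue_on_coords :: "(nat \<times> nat) set \<Rightarrow> (nat \<times> nat \<Rightarrow> real) measure" where
  "lebesgue_on_coords J \<equiv> Pi\<^sub>M J (\<lambda>_. lborel)"

abbreviation coord_measure :: "nat \<Rightarrow> (nat \<times> nat \<Rightarrow> real) measure" where
  "coord_measure N \<equiv> lebesgue_on_coords ({..<N} \<times> {..<N})"

interpretation coords: product_sigma_finite "\<lambda>_ :: nat \<times> nat. lborel :: real measure"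
  by standard

lemma measurable_coord:
  "c \<in> J \<Longrightarrow> (\<lambda>x. x c) \<in> borel_measurable (lebesgue_on_coords J)"
  using measurable_component_singleton[of c J "\<lambda>_. lborel"] by simp

lemma measurable_Complex [measurable (raw)]:
  "f \<in> borel_measurable M \<Longrightarrow> g \<in> borel_measurable M \<Longrightarrow> (\<lambda>x. Complex (f x) (g x)) \<in> borel_measurable M"
  unfolding Complex_eq
  by (intro borel_measurable_add borel_measurable_times borel_measurable_const)
     (auto intro!: measurable_compose[of _ M borel complex_of_real] borel_measurable_continuous_onI
        continuous_intros)

text \<open>The border column strictly above the diagonal. The value 0 from index \<open>n\<close>
  on makes it independent of the diagonal coordinate \<open>(n, n)\<close>.\<close>

definition colvec :: "(nat \<times> nat \<Rightarrow> real) \<Rightarrow> nat \<Rightarrow> nat \<Rightarrow> complex" where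
  "colvec x n i = (if i < n then Complex (x (i, n)) (x (n, i)) else 0)"

text \<open>The real coordinates of the first \<open>m\<close> entries of column \<open>n\<close>.
  The number \<open>m\<close> is kept apart from \<open>n\<close> so that the entries can be
  integrated out one at a time.\<close>

definition cross :: "nat \<Rightarrow> nat \<Rightarrow> (nat \<times> nat) set" where
  "cross m n = {..<m} \<times> {n} \<union> {n} \<times> {..<m}"

lemma finite_cross [simp]: "finite (cross m n)" by (simp add: cross_def)

lemma cross_0 [simp]: "cross 0 n = {}" by (simp add: cross_def)

lemma cross_Suc: "cross (Suc m) n = insert (m, n) (insert (n, m) (cross m n))"
  by (auto simp: cross_def less_Suc_eq)

lemma measurable_colvec:
  assumes "i < m" "cross m n \<subseteq> J"
  shows "(\<lambda>x. colvec x n i) \<in> borel_measurable (lebesgue_on_coords J)"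
proof -
  have [measurable]: "(\<lambda>x. x (i, n)) \<in> borel_measurable (lebesgue_on_coords J)"
    "(\<lambda>x. x (n, i)) \<in> borel_measurable (lebesgue_on_coords J)"
    using assms by (auto simp: cross_def intro!: measurable_coord)
  show ?thesis unfolding colvec_def by measurable
qed

lemma measurable_sesq:
  assumes "cross m n \<subseteq> J"
  shows "(\<lambda>x. sesq M m (colvec x n)) \<in> borel_measurable (lebesgue_on_coords J)"
  unfolding sesq_def
  by (intro borel_measurable_sum borel_measurable_times borel_measurable_const
      borel_measurable_continuous_on[OF continuous_on_cnj[OF continuous_on_id]] measurable_colvec[OF _ assms]) auto

text \<open>One complex variable is two real ones: the first is integrated at exponent g, the second
  at g - 1/2, and g - 1 remains for the other \<open>m\<close> variables.\<close>

fun cauchy_form_const :: "real \<Rightarrow> nat \<Rightarrow> real" where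
  "cauchy_form_const g 0 = 1"
| "cauchy_form_const g (Suc m) = cauchy_const g * cauchy_const (g - 1 / 2) * cauchy_form_const (g - 1) m"

text \<open>Induction on the number of complex variables. After completing the square, the real and
  the imaginary part of the last variable are integrated in turn, each costing 1 / sqrt d for the
  pivot d. The Schur complement is left, and the pivots multiply up to the determinant. The
  statement carries the existence of \<open>d\<close> because the determinant is a complex
  number.\<close>

lemma nn_integral_posdef_form:
  assumes "m \<le> n" "posdef M m" "g > real m" "A > 0"
  shows "\<exists>d>0. Determinant.det (Matrix.mat m m (\<lambda>(i, j). M i j)) = complex_of_real d \<and>
    (\<integral>\<^sup>+x. ennreal ((A + Re (sesq M m (colvec x n))) powr (- g)) \<partial>lebesgue_on_coords (cross m n))
      = ennreal (cauchy_form_const g m * A powr (real m - g) / d)"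
  using assms
proof (induction m arbitrary: M g)
  case 0
  show ?case by (rule exI[of _ 1]) (simp add: coords.nn_integral_empty sesq_def del: nn_integral_const)
next
  case (Suc m)
  have mn: "m < n" and g: "g - 1 > real m" using Suc.prems by auto
  note pd = \<open>posdef M (Suc m)\<close>
  obtain d where d: "d > 0" "M m m = complex_of_real d" by (rule posdef_pivot[OF pd])
  define q where "q x = Re (sesq (schur_compl M m) m (colvec x n))" for x
  have q0: "q x \<ge> 0" for x unfolding q_def by (rule posdef_nonneg[OF posdef_schur_compl[OF pd]])
  obtain d' where d': "d' > 0"
    "Determinant.det (Matrix.mat m m (\<lambda>(i, j). schur_compl M m i j)) = complex_of_real d'"
    and IH: "(\<integral>\<^sup>+x. ennreal ((A + q x) powr (- (g - 1))) \<partial>lebesgue_on_coords (cross m n))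
      = ennreal (cauchy_form_const (g - 1) m * A powr (real m - (g - 1)) / d')"
    using Suc.IH[OF _ posdef_schur_compl[OF pd] g \<open>A > 0\<close>] mn unfolding q_def by auto
  define b where "b x = (\<Sum>j<m. M m j * colvec x n j) / M m m" for x
  have inv: "colvec (x(c := y)) n j = colvec x n j" if "j < m" "c = (m, n) \<or> c = (n, m)" for x y c j
    using that mn by (auto simp: colvec_def)
  have qinv: "q (x(c := y)) = q x" "b (x(c := y)) = b x" if "c = (m, n) \<or> c = (n, m)" for x y c
    unfolding q_def b_def using inv that by (auto intro!: arg_cong[of _ _ Re] sesq_cong sum.cong)
  \<comment> \<open>Everything that does not involve the real part \<open>x (m, n)\<close> of the
    last variable: it plays the role of the constant in the first one-dimensional integral.\<close>
  define B where "B x = A + q x + d * (x (n, m) + Im (b x))\<^sup>2" for x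
  have B: "B x > 0" for x using q0[of x] \<open>A > 0\<close> d by (simp add: B_def add_pos_nonneg)
  have form: "A + Re (sesq M (Suc m) (colvec x n)) = B x + d * (x (m, n) - (- Re (b x)))\<^sup>2" for x
  proof -
    have "Re (sesq M (Suc m) (colvec x n)) = d * cmod (colvec x n m + b x)^2 + q x"
      by (subst sesq_complete_square[OF pd d(2,1)]) (simp add: b_def q_def)
    thus ?thesis using mn by (simp add: B_def cmod_power2 colvec_def algebra_simps)
  qed
  have meas_q: "q \<in> borel_measurable (lebesgue_on_coords J)" "b \<in> borel_measurable (lebesgue_on_coords J)"
    if "cross m n \<subseteq> J" for J
  proof -
    show "q \<in> borel_measurable (lebesgue_on_coords J)"
      unfolding q_def using measurable_sesq[OF that] by measurable
    show "b \<in> borel_measurable (lebesgue_on_coords J)"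
      unfolding b_def
      by (intro borel_measurable_divide borel_measurable_sum borel_measurable_times
          borel_measurable_const measurable_colvec[OF _ that]) auto
  qed
  have meas_B: "B \<in> borel_measurable (lebesgue_on_coords J)" if "insert (n, m) (cross m n) \<subseteq> J" for J
  proof -
    have [measurable]: "(\<lambda>x. x (n, m)) \<in> borel_measurable (lebesgue_on_coords J)" "q \<in> borel_measurable (lebesgue_on_coords J)" "b \<in> borel_measurable (lebesgue_on_coords J)"
      using that meas_q by (auto intro!: measurable_coord)
    show ?thesis unfolding B_def by measurable
  qed
  have "(\<integral>\<^sup>+x. ennreal ((A + Re (sesq M (Suc m) (colvec x n))) powr (- g)) \<partial>lebesgue_on_coords (cross (Suc m) n))
    = (\<integral>\<^sup>+x. (\<integral>\<^sup>+y. ennreal ((A + Re (sesq M (Suc m) (colvec (x((m, n) := y)) n))) powr (- g)) \<partial>lborel)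
        \<partial>lebesgue_on_coords (insert (n, m) (cross m n)))"
    unfolding cross_Suc
  proof (rule coords.product_nn_integral_insert)
    show "(m, n) \<notin> insert (n, m) (cross m n)" using mn by (auto simp: cross_def)
    have [measurable]: "(\<lambda>x. sesq M (Suc m) (colvec x n)) \<in> borel_measurable
      (lebesgue_on_coords (insert (m, n) (insert (n, m) (cross m n))))"
      by (rule measurable_sesq) (simp add: cross_Suc)
    show "(\<lambda>x. ennreal ((A + Re (sesq M (Suc m) (colvec x n))) powr - g))
      \<in> borel_measurable (lebesgue_on_coords (insert (m, n) (insert (n, m) (cross m n))))"
      by measurable
  qed auto
  also have "\<dots> = (\<integral>\<^sup>+x. ennreal (cauchy_const g / sqrt d) * ennreal (B x powr (- (g - 1 / 2)))
        \<partial>lebesgue_on_coords (insert (n, m) (cross m n)))"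
  proof (intro nn_integral_cong)
    fix x
    have "B (x((m, n) := y)) = B x" for y using mn by (simp add: B_def qinv)
    hence "(\<integral>\<^sup>+y. ennreal ((A + Re (sesq M (Suc m) (colvec (x((m, n) := y)) n))) powr (- g)) \<partial>lborel)
      = (\<integral>\<^sup>+y. ennreal ((B x + d * (y - (- Re (b x)))\<^sup>2) powr (- g)) \<partial>lborel)"
      unfolding form by (simp add: qinv)
    also have "\<dots> = ennreal (cauchy_const g * B x powr (1 / 2 - g) / sqrt d)"
      by (rule nn_integral_cauchy_quadratic) (use g d B in auto)
    also have "\<dots> = ennreal (cauchy_const g / sqrt d) * ennreal (B x powr (- (g - 1 / 2)))"
      using d by (simp flip: ennreal_mult)
    finally show "(\<integral>\<^sup>+y. ennreal ((A + Re (sesq M (Suc m) (colvec (x((m, n) := y)) n))) powr (- g)) \<partial>lborel)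
      = ennreal (cauchy_const g / sqrt d) * ennreal (B x powr (- (g - 1 / 2)))" .
  qed
  also have "\<dots> = ennreal (cauchy_const g / sqrt d) *
     (\<integral>\<^sup>+x. ennreal (B x powr (- (g - 1 / 2))) \<partial>lebesgue_on_coords (insert (n, m) (cross m n)))"
    by (intro nn_integral_cmult) (use meas_B[OF subset_refl] in measurable)
  also have "(\<integral>\<^sup>+x. ennreal (B x powr (- (g - 1 / 2))) \<partial>lebesgue_on_coords (insert (n, m) (cross m n)))
     = (\<integral>\<^sup>+x. (\<integral>\<^sup>+y. ennreal (B (x((n, m) := y)) powr (- (g - 1 / 2))) \<partial>lborel) \<partial>lebesgue_on_coords (cross m n))"
    by (rule coords.product_nn_integral_insert)
       (use meas_B[OF subset_refl] mn in \<open>auto simp: cross_def\<close>)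
  also have "\<dots> = (\<integral>\<^sup>+x. ennreal (cauchy_const (g - 1 / 2) / sqrt d) * ennreal ((A + q x) powr (- (g - 1)))
       \<partial>lebesgue_on_coords (cross m n))"
  proof (intro nn_integral_cong)
    fix x
    have "(\<integral>\<^sup>+y. ennreal (B (x((n, m) := y)) powr (- (g - 1 / 2))) \<partial>lborel)
      = (\<integral>\<^sup>+y. ennreal ((A + q x + d * (y - (- Im (b x)))\<^sup>2) powr (- (g - 1 / 2))) \<partial>lborel)"
      unfolding B_def by (simp add: qinv)
    also have "\<dots> = ennreal (cauchy_const (g - 1 / 2) * (A + q x) powr (1 / 2 - (g - 1 / 2)) / sqrt d)"
      by (rule nn_integral_cauchy_quadratic) (use g d q0[of x] \<open>A > 0\<close> in auto)
    also have "\<dots> = ennreal (cauchy_const (g - 1 / 2) / sqrt d) * ennreal ((A + q x) powr (- (g - 1)))"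
      using d by (simp flip: ennreal_mult)
    finally show "(\<integral>\<^sup>+y. ennreal (B (x((n, m) := y)) powr (- (g - 1 / 2))) \<partial>lborel)
      = ennreal (cauchy_const (g - 1 / 2) / sqrt d) * ennreal ((A + q x) powr (- (g - 1)))" .
  qed
  also have "\<dots> = ennreal (cauchy_const (g - 1 / 2) / sqrt d) *
      (\<integral>\<^sup>+x. ennreal ((A + q x) powr (- (g - 1))) \<partial>lebesgue_on_coords (cross m n))"
    by (intro nn_integral_cmult) (use meas_q[OF subset_refl] in measurable)
  also note IH
  also have "ennreal (cauchy_const g / sqrt d) * (ennreal (cauchy_const (g - 1 / 2) / sqrt d) *
      ennreal (cauchy_form_const (g - 1) m * A powr (real m - (g - 1)) / d'))
    = ennreal (cauchy_const g / sqrt d * (cauchy_const (g - 1 / 2) / sqrt d *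
      (cauchy_form_const (g - 1) m * A powr (real m - (g - 1)) / d')))"
  proof -
    have "cauchy_const g / sqrt d \<ge> 0" "cauchy_const (g - 1 / 2) / sqrt d \<ge> 0" using d by simp_all
    thus ?thesis by (simp only: ennreal_mult')
  qed
  also have "cauchy_const g / sqrt d * (cauchy_const (g - 1 / 2) / sqrt d *
      (cauchy_form_const (g - 1) m * A powr (real m - (g - 1)) / d')) =
      cauchy_form_const g (Suc m) * A powr (real (Suc m) - g) / (d' * d)"
  proof -
    have e: "real m - (g - 1) = real (Suc m) - g" by simp
    have "sqrt d * sqrt d = d" using d by simp
    thus ?thesis unfolding e by (simp add: field_simps)
  qed
  finally show ?case
    using d d' det_schur_compl[OF pd]
    by (intro exI[of _ "d' * d"]) simp
qed

subsection \<open>Bordering a Hermitian matrix by one row and column\<close>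

text \<open>The entries of \<open>herm_of_coords\<close> without reference to the size, so that a
  matrix and its leading block can be compared through one coordinate function.\<close>

definition herm_entry :: "(nat \<times> nat \<Rightarrow> real) \<Rightarrow> nat \<Rightarrow> nat \<Rightarrow> complex" where
  "herm_entry x i j = (if i = j then complex_of_real (x (i, i))
     else if i < j then Complex (x (i, j)) (x (j, i)) else Complex (x (j, i)) (- x (i, j)))"

lemma herm_of_coords_eq: "herm_of_coords N x = Matrix.mat N N (\<lambda>(i, j). herm_entry x i j)"
  by (simp add: herm_of_coords_def herm_entry_def[abs_def])

lemma herm_entry_cnj: "cnj (herm_entry x j i) = herm_entry x i j"
  by (auto simp: herm_entry_def complex_eq_iff)

lemma herm_entry_colvec:
  "i < n \<Longrightarrow> herm_entry x i n = colvec x n i" "i < n \<Longrightarrow> herm_entry x n i = cnj (colvec x n i)"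
  by (auto simp: herm_entry_def colvec_def complex_eq_iff)

lemma sum_herm_entry_real: "(\<Sum>i<N. cnj (z i) * (\<Sum>j<N. herm_entry x i j * z j)) \<in> \<real>"
proof -
  have "cnj (\<Sum>i<N. cnj (z i) * (\<Sum>j<N. herm_entry x i j * z j)) =
      (\<Sum>i<N. \<Sum>j<N. z i * herm_entry x j i * cnj (z j))"
    by (simp add: sum_distrib_left herm_entry_cnj mult.assoc)
  also have "\<dots> = (\<Sum>i<N. cnj (z i) * (\<Sum>j<N. herm_entry x i j * z j))"
    by (subst sum.swap) (simp add: sum_distrib_left mult_ac)
  finally show ?thesis by (simp add: Reals_cnj_iff)
qed

text \<open>The factor T in 1 + H^2 = T T', where T' = 1 - iH is its adjoint. Unlike 1 + H^2 it is
  affine in the entries, so bordering H borders T.\<close>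

definition one_plus_iH :: "nat \<Rightarrow> (nat \<times> nat \<Rightarrow> real) \<Rightarrow> complex mat" where
  "one_plus_iH N x = Matrix.mat N N (\<lambda>(i, j). (if i = j then 1 else 0) + \<i> * herm_entry x i j)"

definition detw :: "nat \<Rightarrow> (nat \<times> nat \<Rightarrow> real) \<Rightarrow> real" where
  "detw N x = cmod (Determinant.det (one_plus_iH N x)) ^ 2"

text \<open>This is 1 + Tr H^2. The summand 1 makes its powers increase with the exponent, which
  lets bounds of different degree be compared.\<close>

definition frob :: "nat \<Rightarrow> (nat \<times> nat \<Rightarrow> real) \<Rightarrow> real" where
  "frob N x = 1 + (\<Sum>i<N. \<Sum>j<N. cmod (herm_entry x i j) ^ 2)"

lemma frob_ge_1: "frob N x \<ge> 1"
  by (simp add: frob_def sum_nonneg)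

lemma det_one_plus_H2:
  "Determinant.det (1\<^sub>m N + herm_of_coords N x * herm_of_coords N x) = complex_of_real (detw N x)"
proof -
  define T where "T = one_plus_iH N x"
  have T: "T \<in> carrier_mat N N" by (simp add: T_def one_plus_iH_def)
  have Tij: "T $$ (i, j) = (if i = j then 1 else 0) + \<i> * herm_entry x i j" if "i < N" "j < N" for i j
    using that by (simp add: T_def one_plus_iH_def)
  have "1\<^sub>m N + herm_of_coords N x * herm_of_coords N x = T * mat_adjoint T"
  proof (rule eq_matI)
    fix i j assume "i < dim_row (T * mat_adjoint T)" "j < dim_col (T * mat_adjoint T)"
    hence ij: "i < N" "j < N" using T by auto
    have "(T * mat_adjoint T) $$ (i, j) = (\<Sum>k<N. T $$ (i, k) * cnj (T $$ (j, k)))"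
      using T ij by (simp add: scalar_prod_def atLeast0LessThan mat_adjoint_entry[OF T])
    also have "\<dots> = (\<Sum>k<N. ((if i = k then 1 else 0) + \<i> * herm_entry x i k) *
        ((if j = k then 1 else 0) - \<i> * herm_entry x k j))"
      using ij by (intro sum.cong refl) (simp add: Tij herm_entry_cnj)
    also have "\<dots> = (\<Sum>k<N. (if k = i then (if i = j then 1 else 0) - \<i> * herm_entry x i j else 0)
        + (if k = j then \<i> * herm_entry x i j else 0) + herm_entry x i k * herm_entry x k j)"
      by (intro sum.cong) (auto simp: algebra_simps)
    also have "\<dots> = (if i = j then 1 else 0) + (\<Sum>k<N. herm_entry x i k * herm_entry x k j)"
      using ij by (simp add: sum.distrib)
    also have "\<dots> = (1\<^sub>m N + herm_of_coords N x * herm_of_coords N x) $$ (i, j)"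
      using ij by (simp add: herm_of_coords_eq scalar_prod_def atLeast0LessThan)
    finally show "(1\<^sub>m N + herm_of_coords N x * herm_of_coords N x) $$ (i, j) = (T * mat_adjoint T) $$ (i, j)" ..
  qed (use T in \<open>auto simp: herm_of_coords_eq\<close>)
  hence "Determinant.det (1\<^sub>m N + herm_of_coords N x * herm_of_coords N x) =
      Determinant.det T * cnj (Determinant.det T)"
    using T by (simp add: det_mult[of _ N] det_mat_adjoint[OF T])
  thus ?thesis by (simp only: detw_def T_def complex_norm_square)
qed

lemma detw_ge_1: "detw N x \<ge> 1"
proof -
  have "herm_of_coords N x \<in> carrier_mat N N" "mat_adjoint (herm_of_coords N x) = herm_of_coords N x"
    using herm_of_coords_hermitian[of N x] by (auto simp: hermitian_mats_def)
  from det_one_plus_square[OF this] show ?thesis by (auto simp: det_one_plus_H2)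
qed

text \<open>For the vector \<open>v\<close> that borders \<open>H\<close>, everything is expressed through \<open>u = (1 + iH)\<^bsup>-1\<^esup> v\<close>.\<close>

context
  fixes N :: nat and x :: "nat \<times> nat \<Rightarrow> real" and S :: "complex mat"
  assumes S: "S \<in> carrier_mat N N" and inv: "one_plus_iH N x * S = 1\<^sub>m N"
begin

definition resolvent_vec :: "(nat \<Rightarrow> complex) \<Rightarrow> nat \<Rightarrow> complex" where
  "resolvent_vec v i = (\<Sum>j<N. S $$ (i, j) * v j)"

text \<open>The Gram matrix of the columns of S; its form at v is the squared norm of u = S
  v.\<close>

definition resolvent_gram :: "nat \<Rightarrow> nat \<Rightarrow> complex" where
  "resolvent_gram i j = (\<Sum>k<N. cnj (S $$ (k, i)) * S $$ (k, j))"

lemma resolvent_vec_inverse: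
  assumes "i < N"
  shows "v i = resolvent_vec v i + \<i> * (\<Sum>j<N. herm_entry x i j * resolvent_vec v j)"
proof -
  have "v i = (\<Sum>k<N. (1\<^sub>m N) $$ (i, k) * v k)" 
    using assms by (simp add: if_distrib[of "\<lambda>a. a * _"] cong: if_cong)
  also have "\<dots> = (\<Sum>k<N. (\<Sum>j<N. one_plus_iH N x $$ (i, j) * S $$ (j, k)) * v k)"
    unfolding inv[symmetric]
    using S assms by (intro sum.cong refl) (simp add: scalar_prod_def atLeast0LessThan one_plus_iH_def)
  also have "\<dots> = (\<Sum>j<N. one_plus_iH N x $$ (i, j) * resolvent_vec v j)"
    unfolding resolvent_vec_def sum_distrib_left sum_distrib_right
    by (subst sum.swap) (simp add: mult.assoc)
  also have "\<dots> = (\<Sum>j<N. (if j = i then resolvent_vec v i else 0) + \<i> * (herm_entry x i j * resolvent_vec v j))"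
    using assms by (intro sum.cong) (auto simp: one_plus_iH_def algebra_simps)
  also have "\<dots> = resolvent_vec v i + \<i> * (\<Sum>j<N. herm_entry x i j * resolvent_vec v j)"
    using assms by (simp add: sum.distrib sum_distrib_left)
  finally show ?thesis .
qed

lemma sesq_resolvent_gram: "sesq resolvent_gram N v = complex_of_real (\<Sum>k<N. cmod (resolvent_vec v k)^2)"
proof -
  have "sesq resolvent_gram N v = (\<Sum>i<N. \<Sum>j<N. \<Sum>k<N. cnj (S $$ (k, i) * v i) * (S $$ (k, j) * v j))"
    unfolding sesq_def resolvent_gram_def
    by (intro sum.cong refl) (simp add: sum_distrib_left sum_distrib_right mult_ac)
  also have "\<dots> = (\<Sum>i<N. \<Sum>k<N. \<Sum>j<N. cnj (S $$ (k, i) * v i) * (S $$ (k, j) * v j))"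
    by (rule sum.cong[OF refl], rule sum.swap)
  also have "\<dots> = (\<Sum>k<N. \<Sum>i<N. \<Sum>j<N. cnj (S $$ (k, i) * v i) * (S $$ (k, j) * v j))"
    by (rule sum.swap)
  also have "\<dots> = (\<Sum>k<N. cnj (resolvent_vec v k) * resolvent_vec v k)"
    by (simp only: resolvent_vec_def cnj_sum sum_product)
  also have "\<dots> = complex_of_real (\<Sum>k<N. cmod (resolvent_vec v k)^2)"
    by (simp only: of_real_sum complex_norm_square mult.commute)
  finally show ?thesis .
qed

lemma posdef_resolvent_gram: "posdef resolvent_gram N"
proof -
  have "resolvent_gram i j = cnj (resolvent_gram j i)" for i j
    by (simp add: resolvent_gram_def mult.commute)
  moreover have "Re (sesq resolvent_gram N z) > 0" if "\<exists>i<N. z i \<noteq> 0" for z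
  proof -
    have "\<exists>k<N. resolvent_vec z k \<noteq> 0"
    proof (rule ccontr)
      assume *: "\<not> (\<exists>k<N. resolvent_vec z k \<noteq> 0)"
      have "z i = 0" if "i < N" for i
        by (subst resolvent_vec_inverse[OF that]) (use * that in simp)
      thus False using \<open>\<exists>i<N. z i \<noteq> 0\<close> by blast
    qed
    then obtain k where "k < N" "resolvent_vec z k \<noteq> 0" by blast
    hence "(\<Sum>k<N. cmod (resolvent_vec z k)^2) > 0" by (intro sum_pos2[of _ k]) auto
    thus ?thesis unfolding sesq_resolvent_gram by simp
  qed
  ultimately show ?thesis unfolding posdef_def by blast
qed

text \<open>Here the exponent of the weight drops by one: integrating over the border column divides
  by this determinant, that is, multiplies by \<open>detw N x\<close>.\<close>

lemma det_resolvent_gram: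
  "Determinant.det (Matrix.mat N N (\<lambda>(i, j). resolvent_gram i j)) = complex_of_real (1 / detw N x)"
proof -
  have T: "one_plus_iH N x \<in> carrier_mat N N" by (simp add: one_plus_iH_def)
  have "Matrix.mat N N (\<lambda>(i, j). resolvent_gram i j) = mat_adjoint S * S"
    using S by (intro eq_matI) (auto simp: resolvent_gram_def scalar_prod_def atLeast0LessThan mat_adjoint_entry[OF S])
  hence "Determinant.det (Matrix.mat N N (\<lambda>(i, j). resolvent_gram i j)) = Determinant.det S * cnj (Determinant.det S)"
    using S by (simp add: det_mult[of _ N] det_mat_adjoint[OF S])
  also have "\<dots> = complex_of_real (cmod (Determinant.det S) ^ 2)" by (simp only: complex_norm_square)
  also have "Determinant.det (one_plus_iH N x) * Determinant.det S = 1"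
    using arg_cong[OF inv, of Determinant.det] T S by (simp add: det_mult[of _ N])
  hence "cmod (Determinant.det (one_plus_iH N x)) * cmod (Determinant.det S) = 1"
    by (metis norm_mult norm_one)
  hence "detw N x * cmod (Determinant.det S) ^ 2 = 1"
    unfolding detw_def by (simp flip: power_mult_distrib)
  hence "cmod (Determinant.det S) ^ 2 = 1 / detw N x" using detw_ge_1[of N x] by (simp add: field_simps)
  finally show ?thesis .
qed

definition resolvent_shift :: "(nat \<Rightarrow> complex) \<Rightarrow> real" where
  "resolvent_shift v = Re (\<Sum>i<N. cnj (resolvent_vec v i) * (\<Sum>j<N. herm_entry x i j * resolvent_vec v j))"

text \<open>With T = 1 + iH, the border column i v equals i T u, so subtracting i u times the old
  columns clears it. The remaining pivot is p = 1 + i t + <v, u>. Since v = u + i H u, one has <v,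
  u> = |u|^2 - i <u, H u> with <u, H u> real, which gives the real and imaginary parts of p.\<close>

lemma detw_border:
  assumes agree: "\<And>i j. i < N \<Longrightarrow> j < N \<Longrightarrow> herm_entry y i j = herm_entry x i j"
  shows "detw (Suc N) y = detw N x *
    ((1 + Re (sesq resolvent_gram N (colvec y N)))^2 + (y (N, N) - resolvent_shift (colvec y N))^2)"
proof -
  define v where "v = colvec y N"
  define u where "u = resolvent_vec v"
  define A where "A = one_plus_iH (Suc N) y"
  define E where "E = Matrix.mat (Suc N) (Suc N) (\<lambda>(i, j). if i = j then 1 else if j = N then - \<i> * u i else 0)"
  define p where "p = 1 + \<i> * complex_of_real (y (N, N)) + (\<Sum>k<N. cnj (v k) * u k)"
  have Ac: "A \<in> carrier_mat (Suc N) (Suc N)" and Ec: "E \<in> carrier_mat (Suc N) (Suc N)"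
    by (simp_all add: A_def E_def one_plus_iH_def)
  have AE: "(A * E) $$ (i, j) = (if j < N then A $$ (i, j) else A $$ (i, N) - \<i> * (\<Sum>k<N. A $$ (i, k) * u k))"
    if "i < Suc N" "j < Suc N" for i j
  proof -
    have "(A * E) $$ (i, j) = (\<Sum>k<N. A $$ (i, k) * (if k = j then 1 else if j = N then - \<i> * u k else 0))
        + A $$ (i, N) * (if N = j then 1 else 0)"
      using that Ac by (simp add: E_def scalar_prod_def atLeast0LessThan)
    also have "\<dots> = (if j < N then A $$ (i, j) else A $$ (i, N) - \<i> * (\<Sum>k<N. A $$ (i, k) * u k))"
    proof (cases "j < N")
      case True
      hence "(\<Sum>k<N. A $$ (i, k) * (if k = j then 1 else if j = N then - \<i> * u k else 0)) =
          (\<Sum>k<N. if k = j then A $$ (i, k) else 0)" by (intro sum.cong) auto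
      thus ?thesis using True by simp
    next
      case False
      hence "j = N" using that by simp
      moreover have "(\<Sum>k<N. A $$ (i, k) * (if k = N then 1 else - \<i> * u k)) = - \<i> * (\<Sum>k<N. A $$ (i, k) * u k)"
        unfolding sum_distrib_left by (intro sum.cong) auto
      ultimately show ?thesis by simp
    qed
    finally show ?thesis .
  qed
  have "A * E = four_block_mat (one_plus_iH N x) (0\<^sub>m N 1) (Matrix.mat 1 N (\<lambda>(i, j). A $$ (N, j))) (Matrix.mat 1 1 (\<lambda>_. p))"
    (is "_ = ?B")
  proof (rule eq_matI)
    fix i j assume "i < dim_row ?B" "j < dim_col ?B"
    hence ij: "i < Suc N" "j < Suc N" by (auto simp: one_plus_iH_def)
    consider "i < N" "j < N" | "i < N" "j = N" | "i = N" "j < N" | "i = N" "j = N" using ij by linarith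
    thus "(A * E) $$ (i, j) = ?B $$ (i, j)"
    proof cases
      case 1
      thus ?thesis unfolding AE[OF ij] by (simp add: A_def one_plus_iH_def agree)
    next
      case 2
      have "(\<Sum>k<N. A $$ (i, k) * u k) = (\<Sum>k<N. (if k = i then u i else 0) + \<i> * (herm_entry x i k * u k))"
        using 2 by (intro sum.cong) (auto simp: A_def one_plus_iH_def agree algebra_simps)
      also have "\<dots> = v i"
        using 2 resolvent_vec_inverse[OF 2(1), of v] by (simp add: sum.distrib sum_distrib_left u_def)
      finally show ?thesis unfolding AE[OF ij] using 2
        by (simp add: A_def one_plus_iH_def herm_entry_colvec v_def)
    next
      case 3
      thus ?thesis unfolding AE[OF ij] by (simp add: one_plus_iH_def)
    next
      case 4
      have "\<i> * (\<Sum>k<N. A $$ (N, k) * u k) = - (\<Sum>k<N. cnj (v k) * u k)"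
        unfolding sum_distrib_left sum_negf[symmetric]
        by (intro sum.cong) (auto simp: A_def one_plus_iH_def herm_entry_colvec v_def mult.assoc[symmetric])
      thus ?thesis unfolding AE[OF ij] using 4
        by (simp add: A_def one_plus_iH_def p_def herm_entry_def)
    qed
  qed (use Ac Ec in \<open>auto simp: one_plus_iH_def\<close>)
  hence "Determinant.det (A * E) = Determinant.det ?B" by simp
  also have "\<dots> = Determinant.det (one_plus_iH N x) * p"
    by (subst det_four_block_mat_upper_right_zero[of _ N _ 1]) (auto simp: one_plus_iH_def det_single)
  finally have "Determinant.det (A * E) = Determinant.det (one_plus_iH N x) * p" .
  moreover have "Determinant.det (A * E) = Determinant.det A * Determinant.det E" by (rule det_mult[OF Ac Ec])
  moreover have "Determinant.det E = prod_list (diag_mat E)"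
    by (rule det_upper_triangular[of _ "Suc N"]) (auto simp: E_def)
  moreover have "diag_mat E = replicate (Suc N) 1"
    by (intro nth_equalityI) (auto simp: diag_mat_def E_def simp del: upt_Suc replicate_Suc)
  ultimately have "Determinant.det A = Determinant.det (one_plus_iH N x) * p" by (simp del: replicate_Suc)
  hence 1: "detw (Suc N) y = detw N x * cmod p ^ 2"
    by (simp add: detw_def A_def norm_mult power_mult_distrib)
  define w where "w = (\<Sum>i<N. cnj (u i) * (\<Sum>j<N. herm_entry x i j * u j))"
  have wR: "w \<in> \<real>" unfolding w_def by (rule sum_herm_entry_real)
  have "resolvent_shift v = Re w" unfolding resolvent_shift_def w_def u_def ..
  hence w: "w = complex_of_real (resolvent_shift v)" "cnj w = w"
    using wR by (simp_all add: Reals_cnj_iff del: Re_sum Im_sum)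
  have "(\<Sum>k<N. cnj (v k) * u k) = (\<Sum>k<N. complex_of_real (cmod (u k)^2) - \<i> * cnj (cnj (u k) * (\<Sum>j<N. herm_entry x k j * u j)))"
  proof (intro sum.cong refl)
    fix k assume "k \<in> {..<N}"
    hence "v k = u k + \<i> * (\<Sum>j<N. herm_entry x k j * u j)"
      using resolvent_vec_inverse[of k v] by (simp add: u_def)
    thus "cnj (v k) * u k = complex_of_real (cmod (u k)^2) - \<i> * cnj (cnj (u k) * (\<Sum>j<N. herm_entry x k j * u j))"
      unfolding complex_norm_square by (simp add: algebra_simps)
  qed
  also have "\<dots> = complex_of_real (\<Sum>k<N. cmod (u k)^2) - \<i> * cnj w"
    unfolding w_def cnj_sum by (simp only: sum_subtractf of_real_sum sum_distrib_left)
  finally have "p = Complex (1 + (\<Sum>k<N. cmod (u k)^2)) (y (N, N) - resolvent_shift v)"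
    unfolding w by (simp add: p_def w complex_eq_iff)
  hence "cmod p ^ 2 = (1 + Re (sesq resolvent_gram N v))^2 + (y (N, N) - resolvent_shift v)^2"
    by (simp add: cmod_power2 sesq_resolvent_gram u_def)
  thus ?thesis using 1 by (simp add: v_def)
qed

text \<open>The growth of Tr H^2 under bordering is controlled by the same factor P as the
  determinant, so a factor \<open>frob^h\<close> costs at most P^h. This rests on |v|^2 = |u|^2 + |H
  u|^2 and, for the shift r = <u, H u>, on Cauchy-Schwarz.\<close>

lemma frob_border:
  assumes agree: "\<And>i j. i < N \<Longrightarrow> j < N \<Longrightarrow> herm_entry y i j = herm_entry x i j"
  shows "frob (Suc N) y \<le> 2 * frob N x *
    ((1 + Re (sesq resolvent_gram N (colvec y N)))^2 + (y (N, N) - resolvent_shift (colvec y N))^2)"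
proof -
  define v where "v = colvec y N"
  define u where "u = resolvent_vec v"
  define w where "w i = (\<Sum>j<N. herm_entry x i j * u j)" for i
  define q where "q = (\<Sum>k<N. cmod (u k)^2)"
  define r where "r = resolvent_shift v"
  define f where "f = frob N x"
  have f1: "f \<ge> 1" by (simp add: f_def frob_ge_1)
  have q0: "q \<ge> 0" by (simp add: q_def sum_nonneg)
  have "cmod (w i)^2 \<le> (\<Sum>j<N. cmod (herm_entry x i j)^2) * q" for i
  proof -
    have "cmod (w i) \<le> (\<Sum>j<N. cmod (herm_entry x i j) * cmod (u j))"
      unfolding w_def by (rule order_trans[OF norm_sum]) (simp add: norm_mult)
    hence "cmod (w i)^2 \<le> (\<Sum>j<N. cmod (herm_entry x i j) * cmod (u j))^2"
      by (intro power_mono) auto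
    also have "\<dots> \<le> (\<Sum>j<N. cmod (herm_entry x i j)^2) * q"
      unfolding q_def by (rule Cauchy_Schwarz_ineq_sum)
    finally show ?thesis .
  qed
  hence "(\<Sum>i<N. cmod (w i)^2) \<le> (\<Sum>i<N. (\<Sum>j<N. cmod (herm_entry x i j)^2) * q)" by (rule sum_mono)
  hence wq: "(\<Sum>i<N. cmod (w i)^2) \<le> (f - 1) * q" by (simp add: f_def frob_def sum_distrib_right)
  have r2: "r^2 \<le> (f - 1) * q^2"
  proof -
    have "\<bar>r\<bar> \<le> cmod (\<Sum>i<N. cnj (u i) * w i)"
      unfolding r_def resolvent_shift_def u_def[symmetric] w_def[symmetric] by (rule abs_Re_le_cmod)
    also have "\<dots> \<le> (\<Sum>i<N. cmod (u i) * cmod (w i))"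
      by (rule order_trans[OF norm_sum]) (simp add: norm_mult)
    finally have "\<bar>r\<bar>^2 \<le> (\<Sum>i<N. cmod (u i) * cmod (w i))^2" by (intro power_mono) auto
    also have "\<dots> \<le> q * (\<Sum>i<N. cmod (w i)^2)" unfolding q_def by (rule Cauchy_Schwarz_ineq_sum)
    also have "\<dots> \<le> q * ((f - 1) * q)" using wq q0 by (intro mult_left_mono) auto
    finally show ?thesis by (simp add: power2_eq_square algebra_simps)
  qed
  \<comment> \<open>The cross term in |u + i H u|^2 is i times the real number <u, H u>, up to
    taking real parts.\<close>
  have re0: "Re (\<Sum>i<N. cnj (u i) * (\<i> * w i)) = 0"
  proof -
    have "(\<Sum>i<N. cnj (u i) * (\<i> * w i)) = \<i> * (\<Sum>i<N. cnj (u i) * w i)"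
      by (simp add: sum_distrib_left mult_ac)
    moreover have "(\<Sum>i<N. cnj (u i) * w i) \<in> \<real>" unfolding w_def by (rule sum_herm_entry_real)
    ultimately show ?thesis by (simp add: complex_is_Real_iff del: Re_sum Im_sum)
  qed
  have "(\<Sum>i<N. cmod (v i)^2) = (\<Sum>i<N. cmod (u i)^2 + cmod (w i)^2 + 2 * Re (cnj (u i) * (\<i> * w i)))"
  proof (intro sum.cong refl)
    fix i assume "i \<in> {..<N}"
    hence "v i = u i + \<i> * w i" using resolvent_vec_inverse[of i v] by (simp add: u_def w_def)
    thus "cmod (v i)^2 = cmod (u i)^2 + cmod (w i)^2 + 2 * Re (cnj (u i) * (\<i> * w i))"
      unfolding cmod_power2 by (simp add: power2_eq_square algebra_simps)
  qed
  also have "\<dots> = q + (\<Sum>i<N. cmod (w i)^2) + 2 * Re (\<Sum>i<N. cnj (u i) * (\<i> * w i))"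
    unfolding Re_sum by (simp only: sum.distrib sum_distrib_left q_def)
  also have "\<dots> \<le> f * q" unfolding re0 using wq by (simp add: algebra_simps)
  finally have vq: "(\<Sum>i<N. cmod (v i)^2) \<le> f * q" .
  define t where "t = y (N, N)"
  have "frob (Suc N) y = 1 + (\<Sum>i<N. (\<Sum>j<N. cmod (herm_entry y i j)^2) + cmod (herm_entry y i N)^2)
      + ((\<Sum>j<N. cmod (herm_entry y N j)^2) + cmod (herm_entry y N N)^2)"
    by (simp add: frob_def)
  also have "\<dots> = f + 2 * (\<Sum>i<N. cmod (v i)^2) + t^2"
    by (simp add: f_def frob_def sum.distrib agree herm_entry_colvec v_def t_def herm_entry_def[of y N N])
  also have "\<dots> \<le> f + 2 * (f * q) + (2 * (t - r)^2 + 2 * ((f - 1) * q^2))"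
  proof -
    have "t^2 \<le> 2 * (t - r)^2 + 2 * r^2"
      using sum_squares_bound[of "t - r" r] zero_le_power2[of "t - 2 * r"]
      by (simp add: power2_eq_square algebra_simps)
    thus ?thesis using vq r2 by linarith
  qed
  also have "\<dots> \<le> 2 * f * ((1 + q)^2 + (t - r)^2)"
  proof -
    have "(t - r)^2 \<le> f * (t - r)^2" using f1 by (simp add: mult_le_cancel_right1)
    moreover have "0 \<le> f * q" "0 \<le> q^2" using f1 q0 by auto
    moreover have "2 * f * ((1 + q)^2 + D) = 2 * f + 4 * (f * q) + 2 * (f * q^2) + 2 * (f * D)"
      if "D = (t - r)^2" for D
      by (simp add: power2_eq_square algebra_simps)
    moreover have "(f - 1) * q^2 = f * q^2 - q^2" by (simp add: algebra_simps)
    ultimately show ?thesis using f1 by (smt (verit))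
  qed
  also have "q = Re (sesq resolvent_gram N v)" by (simp add: sesq_resolvent_gram q_def u_def)
  finally show ?thesis by (simp add: f_def t_def r_def v_def)
qed

end

lemma one_plus_iH_inverse:
  obtains S where "S \<in> carrier_mat N N" "one_plus_iH N x * S = 1\<^sub>m N"
proof -
  have "one_plus_iH N x \<in> carrier_mat N N" by (simp add: one_plus_iH_def)
  moreover have "Determinant.det (one_plus_iH N x) \<noteq> 0" using detw_ge_1[of N x] by (auto simp: detw_def)
  ultimately have "one_plus_iH N x \<in> Units (ring_mat TYPE(complex) N ())" by (rule det_non_zero_imp_unit)
  thus ?thesis using that by (auto simp: Units_def ring_mat_simps)
qed


subsection \<open>Finiteness of the moments\<close>

lemma measurable_herm_entry:
  assumes "i < N" "j < N"
  shows "(\<lambda>x. herm_entry x i j) \<in> borel_measurable (coord_measure N)"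
proof -
  have *: "(\<lambda>x. x c) \<in> borel_measurable (coord_measure N)"
    if "c \<in> {..<N} \<times> {..<N}" for c using that by (rule measurable_coord)
  have [measurable]: "(\<lambda>x. x (i, j)) \<in> borel_measurable (coord_measure N)"
    "(\<lambda>x. x (j, i)) \<in> borel_measurable (coord_measure N)"
    "(\<lambda>x. x (i, i)) \<in> borel_measurable (coord_measure N)"
    using assms by (auto intro!: *)
  have "(\<lambda>x. complex_of_real (x (i, i))) \<in> borel_measurable (coord_measure N)"
    by (rule measurable_compose[OF *])
       (use assms in \<open>auto intro!: borel_measurable_continuous_onI continuous_intros\<close>)
  thus ?thesis unfolding herm_entry_def by (cases "i = j"; cases "i < j"; simp)
qed

lemma measurable_frob [measurable]: "frob N \<in> borel_measurable (coord_measure N)"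
  unfolding frob_def[abs_def]
  by (intro borel_measurable_add borel_measurable_const borel_measurable_sum borel_measurable_power
      measurable_compose[OF measurable_herm_entry borel_measurable_norm]) auto

lemma measurable_detw [measurable]: "detw N \<in> borel_measurable (coord_measure N)"
proof -
  have "(\<lambda>x. Determinant.det (one_plus_iH N x)) \<in> borel_measurable (coord_measure N)"
  proof (subst det_def'[of _ N])
    show "(\<lambda>x. \<Sum>p | p permutes {0..<N}. signof p * (\<Prod>i = 0..<N. one_plus_iH N x $$ (i, p i)))
      \<in> borel_measurable (coord_measure N)"
    proof (intro borel_measurable_sum borel_measurable_times borel_measurable_const borel_measurable_prod)
      fix p i assume "p \<in> {p. p permutes {0..<N}}" "i \<in> {0..<N}"
      hence ip: "i < N" "p i < N" using permutes_in_image[of p "{0..<N}" i] by auto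
      show "(\<lambda>x. one_plus_iH N x $$ (i, p i)) \<in> borel_measurable (coord_measure N)"
        using ip measurable_herm_entry[OF ip] by (simp add: one_plus_iH_def)
    qed
  qed (simp add: one_plus_iH_def)
  thus ?thesis unfolding detw_def[abs_def] by measurable
qed

text \<open>The coordinates split into the old block \<open>I\<close> and the border
  \<open>J\<close>. With P the factor from \<open>detw_border\<close>, the integrand is at most 2^h
  \<open>frob^h\<close> \<open>detw^(-b)\<close> of the old block times P^(-(b - h)). Integrating P
  over the border leaves one factor \<open>detw\<close>, so (N + 1, b) is replaced by (N, b - 1) and
  the hypothesis on b is reproduced exactly.\<close>

theorem nn_integral_frob_detw_finite:
  assumes "2 * b > 2 * real h + 2 * real N - 1"
  shows "(\<integral>\<^sup>+x. ennreal (frob N x ^ h * detw N x powr (- b)) \<partial>coord_measure N) < \<infinity>"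
  using assms
proof (induction N arbitrary: b)
  case 0
  show ?case by (simp add: coords.nn_integral_empty del: nn_integral_const)
next
  case (Suc N)
  define I where "I = {..<N} \<times> {..<N}"
  define J where "J = insert (N, N) (cross N N)"
  have IJ: "{..<Suc N} \<times> {..<Suc N} = I \<union> J" "I \<inter> J = {}" "finite I" "finite J"
    by (auto simp: I_def J_def cross_def less_Suc_eq)
  define F where "F y = ennreal (frob (Suc N) y ^ h * detw (Suc N) y powr (- b))" for y
  have F [measurable]: "F \<in> borel_measurable (lebesgue_on_coords (I \<union> J))"
    unfolding F_def IJ(1)[symmetric] by measurable
  \<comment> \<open>Integrating over the diagonal entry turns ((1 + q)^2)^(-(b - h)) into ((1 +
    q)^2)^(1/2 - (b - h)) = (1 + q)^(-g), the form integrated by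
    \<open>nn_integral_posdef_form\<close>.\<close>
  define g where "g = 2 * b - 2 * real h - 1"
  define K where "K = 2 ^ h * (cauchy_const (b - real h) * cauchy_form_const g N)"
  have g: "g > real N" "b - real h > 1 / 2" using Suc.prems by (auto simp: g_def)
  have inner: "(\<integral>\<^sup>+y. F (merge I J (x, y)) \<partial>lebesgue_on_coords J) \<le>
      ennreal K * ennreal (frob N x ^ h * detw N x powr (- (b - 1)))" for x
  proof -
    obtain S where S: "S \<in> carrier_mat N N" "one_plus_iH N x * S = 1\<^sub>m N" by (rule one_plus_iH_inverse)
    define M where "M = resolvent_gram N S"
    define q where "q y = Re (sesq M N (colvec y N))" for y
    define r where "r y = resolvent_shift N x S (colvec y N)" for y
    have pd: "posdef M N" unfolding M_def by (rule posdef_resolvent_gram[OF S])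
    have q0: "q y \<ge> 0" for y unfolding q_def by (rule posdef_nonneg[OF pd])
    define G where "G y = ennreal (((1 + q y)\<^sup>2 + 1 * (y (N, N) - r y)\<^sup>2) powr (- (b - real h)))" for y
    define c where "c = (2 * frob N x) ^ h * detw N x powr (- b)"
    have c0: "c \<ge> 0" using frob_ge_1[of N x] by (simp add: c_def)
    have bound: "F (merge I J (x, y)) \<le> ennreal c * G y" for y
    proof -
      define y' where "y' = merge I J (x, y)"
      have mI: "y' c = x c" if "c \<in> I" for c unfolding y'_def by (rule merge_apply(1)[OF IJ(2) that])
      have mJ: "y' c = y c" if "c \<in> J" for c unfolding y'_def by (rule merge_apply(2)[OF IJ(2) that])
      have agree: "herm_entry y' i j = herm_entry x i j" if "i < N" "j < N" for i j
      proof -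
        have "y' (i, j) = x (i, j)" "y' (j, i) = x (j, i)" "y' (i, i) = x (i, i)"
          using that by (auto intro!: mI simp: I_def)
        thus ?thesis by (auto simp: herm_entry_def)
      qed
      have yN: "y' (N, N) = y (N, N)"
        by (rule mJ) (simp add: J_def)
      have "y' (i, N) = y (i, N)" "y' (N, i) = y (N, i)" if "i < N" for i
        using that by (auto intro!: mJ simp: J_def cross_def)
      hence cv: "colvec y' N = colvec y N" by (auto simp: colvec_def)
      define P where "P = (1 + q y)\<^sup>2 + (y (N, N) - r y)\<^sup>2"
      have P: "P > 0" using q0[of y] by (simp add: P_def add_pos_nonneg)
      have d: "detw (Suc N) y' = detw N x * P"
        using detw_border[OF S agree] by (simp add: P_def q_def r_def M_def yN cv)
      have f: "frob (Suc N) y' \<le> 2 * frob N x * P"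
        using frob_border[OF S agree] by (simp add: P_def q_def r_def M_def yN cv)
      have "frob (Suc N) y' ^ h * detw (Suc N) y' powr (- b) \<le>
          (2 * frob N x * P) ^ h * (detw N x * P) powr (- b)"
        unfolding d using f frob_ge_1[of "Suc N" y'] by (intro mult_right_mono power_mono) auto
      also have "\<dots> = c * (P ^ h * P powr (- b))"
        using P detw_ge_1[of N x] by (simp add: c_def power_mult_distrib powr_mult mult_ac)
      also have "P ^ h * P powr (- b) = P powr (- (b - real h))"
        using P by (simp add: powr_add[symmetric] flip: powr_realpow)
      finally show ?thesis
        unfolding F_def y'_def[symmetric] using c0 by (simp add: G_def P_def flip: ennreal_mult')
    qed
    have sub: "cross N N \<subseteq> J" by (auto simp: J_def)
    have [measurable]: "q \<in> borel_measurable (lebesgue_on_coords J)"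
      unfolding q_def using measurable_sesq[OF sub] by measurable
    have [measurable]: "(\<lambda>y. y (N, N)) \<in> borel_measurable (lebesgue_on_coords J)"
      by (rule measurable_coord) (simp add: J_def)
    have [measurable]: "r \<in> borel_measurable (lebesgue_on_coords J)"
      unfolding r_def resolvent_shift_def[OF S] resolvent_vec_def[OF S]
      by (intro measurable_compose[OF _ borel_measurable_Re] borel_measurable_sum borel_measurable_times
        borel_measurable_const borel_measurable_continuous_on[OF continuous_on_cnj[OF continuous_on_id]]
        measurable_colvec[OF _ sub]) auto
    have inv: "q (y((N, N) := t)) = q y" "r (y((N, N) := t)) = r y" for y t
    proof -
      have "colvec (y((N, N) := t)) N = colvec y N" by (auto simp: colvec_def)
      thus "q (y((N, N) := t)) = q y" "r (y((N, N) := t)) = r y" by (simp_all add: q_def r_def)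
    qed
    have "(\<integral>\<^sup>+y. G y \<partial>lebesgue_on_coords J)
      = (\<integral>\<^sup>+y. (\<integral>\<^sup>+t. G (y((N, N) := t)) \<partial>lborel)
          \<partial>lebesgue_on_coords (cross N N))"
    proof -
      have notin: "(N, N) \<notin> cross N N" by (simp add: cross_def)
      have "(\<lambda>y. G y)
          \<in> borel_measurable (lebesgue_on_coords J)" unfolding G_def by measurable
      from coords.product_nn_integral_insert[OF finite_cross notin this[unfolded J_def]]
      show ?thesis unfolding J_def .
    qed
    also have "\<dots> = (\<integral>\<^sup>+y. ennreal (cauchy_const (b - real h)) * ennreal ((1 + q y) powr (- g)) \<partial>lebesgue_on_coords (cross N N))"
    proof (intro nn_integral_cong)
      fix y
      have "(\<integral>\<^sup>+t. G (y((N, N) := t)) \<partial>lborel)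
        = ennreal (cauchy_const (b - real h) * ((1 + q y)\<^sup>2) powr (1 / 2 - (b - real h)) / sqrt 1)"
        unfolding G_def inv fun_upd_same
        by (rule nn_integral_cauchy_quadratic) (use g q0[of y] in auto)
      also have "((1 + q y)\<^sup>2) powr (1 / 2 - (b - real h)) = (1 + q y) powr (- g)"
      proof -
        have "1 + q y > 0" using q0[of y] by simp
        hence "(1 + q y) powr 2 = (1 + q y)\<^sup>2" by (intro powr_numeral) auto
        moreover have "((1 + q y) powr 2) powr (1 / 2 - (b - real h)) = (1 + q y) powr (- g)"
          unfolding powr_powr by (simp add: g_def algebra_simps)
        ultimately show ?thesis by (simp only:)
      qed
      also have "ennreal (cauchy_const (b - real h) * (1 + q y) powr (- g) / sqrt 1) =
          ennreal (cauchy_const (b - real h)) * ennreal ((1 + q y) powr (- g))"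
        by (simp add: ennreal_mult')
      finally show "(\<integral>\<^sup>+t. G (y((N, N) := t)) \<partial>lborel)
        = ennreal (cauchy_const (b - real h)) * ennreal ((1 + q y) powr (- g))" .
    qed
    also have "\<dots> = ennreal (cauchy_const (b - real h)) * (\<integral>\<^sup>+y. ennreal ((1 + q y) powr (- g)) \<partial>lebesgue_on_coords (cross N N))"
    proof (intro nn_integral_cmult)
      have [measurable]: "q \<in> borel_measurable (lebesgue_on_coords (cross N N))"
        unfolding q_def using measurable_sesq[OF subset_refl] by measurable
      show "(\<lambda>y. ennreal ((1 + q y) powr - g)) \<in> borel_measurable (lebesgue_on_coords (cross N N))" by measurable
    qed
    also have "(\<integral>\<^sup>+y. ennreal ((1 + q y) powr (- g)) \<partial>lebesgue_on_coords (cross N N)) =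
        ennreal (cauchy_form_const g N * detw N x)"
    proof -
      obtain d where d: "Determinant.det (Matrix.mat N N (\<lambda>(i, j). M i j)) = complex_of_real d"
        "(\<integral>\<^sup>+y. ennreal ((1 + q y) powr (- g)) \<partial>lebesgue_on_coords (cross N N)) =
          ennreal (cauchy_form_const g N * 1 powr (real N - g) / d)"
        using nn_integral_posdef_form[OF order_refl pd g(1), of 1] unfolding q_def by auto
      have "d = 1 / detw N x"
        using d(1) unfolding M_def det_resolvent_gram[OF S] by (simp only: of_real_eq_iff)
      thus ?thesis using d(2) by simp
    qed
    finally have J: "(\<integral>\<^sup>+y. G y \<partial>lebesgue_on_coords J) =
        ennreal (cauchy_const (b - real h) * (cauchy_form_const g N * detw N x))"
      by (simp add: ennreal_mult')
    have "(\<integral>\<^sup>+y. F (merge I J (x, y)) \<partial>lebesgue_on_coords J) \<le>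
       (\<integral>\<^sup>+y. ennreal c * G y \<partial>lebesgue_on_coords J)"
      by (intro nn_integral_mono bound)
    also have "\<dots> = ennreal c * ennreal (cauchy_const (b - real h) * (cauchy_form_const g N * detw N x))"
      unfolding J[symmetric] by (intro nn_integral_cmult) (unfold G_def, measurable)
    also have "\<dots> = ennreal (c * (cauchy_const (b - real h) * (cauchy_form_const g N * detw N x)))"
      using c0 by (simp only: ennreal_mult')
    also have "c * (cauchy_const (b - real h) * (cauchy_form_const g N * detw N x)) =
        (frob N x ^ h * (detw N x powr (- b) * detw N x powr 1)) * K"
      using detw_ge_1[of N x] by (simp add: c_def K_def power_mult_distrib)
    also have "detw N x powr (- b) * detw N x powr 1 = detw N x powr (- (b - 1))"
      unfolding powr_add[symmetric] by simp
    also have "ennreal ((frob N x ^ h * detw N x powr (- (b - 1))) * K) =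
        ennreal K * ennreal (frob N x ^ h * detw N x powr (- (b - 1)))"
      using frob_ge_1[of N x] by (subst ennreal_mult') (auto simp: mult.commute)
    finally show ?thesis .
  qed
  have "(\<integral>\<^sup>+y. F y \<partial>lebesgue_on_coords (I \<union> J)) =
      (\<integral>\<^sup>+x. (\<integral>\<^sup>+y. F (merge I J (x, y)) \<partial>lebesgue_on_coords J) \<partial>lebesgue_on_coords I)"
    by (rule coords.product_nn_integral_fold) (use IJ in auto)
  also have "\<dots> \<le> (\<integral>\<^sup>+x. ennreal K * ennreal (frob N x ^ h * detw N x powr (- (b - 1))) \<partial>lebesgue_on_coords I)"
    by (intro nn_integral_mono inner)
  also have "\<dots> = ennreal K * (\<integral>\<^sup>+x. ennreal (frob N x ^ h * detw N x powr (- (b - 1))) \<partial>lebesgue_on_coords I)"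
    unfolding I_def by (intro nn_integral_cmult) measurable
  also have "\<dots> < \<infinity>"
    using Suc.IH[of "b - 1"] Suc.prems unfolding I_def
    by (auto simp: ennreal_mult_less_top)
  finally show ?case unfolding F_def IJ(1) .
qed

section \<open>Integration by parts\<close>

text \<open>No decay of f is assumed. By dominated convergence f(y) - f(-y) tends to the integral of
  f', but this difference is itself integrable on the line and hence cannot have a nonzero
  limit.\<close>

lemma integral_derivative_eq_0:
  fixes f f' :: "real \<Rightarrow> complex"
  assumes deriv: "\<And>t. (f has_vector_derivative f' t) (at t)"
    and f: "integrable lborel f" and f': "integrable lborel f'"
  shows "(\<integral>t. f' t \<partial>lborel) = 0"
proof (rule ccontr)
  define I where "I = (\<integral>t. f' t \<partial>lborel)"
  define h where "h y = f y - f (- y)" for y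
  assume "(\<integral>t. f' t \<partial>lborel) \<noteq> 0"
  hence I: "cmod I > 0" by (simp add: I_def)
  have h_eq: "(\<integral>t. indicator {-y..y} t *\<^sub>R f' t \<partial>lborel) = h y" if "y \<ge> 0" for y
  proof -
    have "set_integrable lborel {-y..y} f'"
      using f' unfolding set_integrable_def by (intro integrable_mult_indicator) auto
    from set_borel_integral_eq_integral(2)[OF this]
    have "(\<integral>t. indicator {-y..y} t *\<^sub>R f' t \<partial>lborel) = integral {-y..y} f'"
      by (simp add: set_lebesgue_integral_def)
    also have "(f' has_integral (f y - f (- y))) {-y..y}"
      by (rule fundamental_theorem_of_calculus)
         (use that deriv in \<open>auto intro: has_vector_derivative_at_within\<close>)
    hence "integral {-y..y} f' = h y" by (simp add: integral_unique h_def)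
    finally show ?thesis .
  qed
  have "((\<lambda>y. \<integral>t. indicator {-y..y} t *\<^sub>R f' t \<partial>lborel) \<longlongrightarrow> I) at_top"
    unfolding I_def
  proof (rule integral_dominated_convergence_at_top[where
        s = "\<lambda>y t. indicator {-y..y} t *\<^sub>R f' t" and f = f' and w = "\<lambda>t. norm (f' t)"])
    show "AE t in lborel. ((\<lambda>y. indicator {-y..y} t *\<^sub>R f' t) \<longlongrightarrow> f' t) at_top"
    proof (rule AE_I2, rule tendsto_eventually)
      fix t :: real
      show "\<forall>\<^sub>F y in at_top. indicator {-y..y} t *\<^sub>R f' t = f' t"
        using eventually_ge_at_top[of "\<bar>t\<bar>"] by eventually_elim (auto simp: indicator_def)
    qed
  qed (use f' in \<open>auto intro!: always_eventually simp: indicator_def\<close>)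
  moreover have "\<forall>\<^sub>F y in at_top. (\<integral>t. indicator {-y..y} t *\<^sub>R f' t \<partial>lborel) = h y"
    using eventually_ge_at_top[of 0] by eventually_elim (rule h_eq)
  ultimately have "(h \<longlongrightarrow> I) at_top" by (rule Lim_transform_eventually)
  hence "((\<lambda>y. cmod (h y)) \<longlongrightarrow> cmod I) at_top" by (rule tendsto_norm)
  hence "\<forall>\<^sub>F y in at_top. cmod I / 2 < cmod (h y)" by (rule order_tendstoD) (use I in simp)
  then obtain X where X: "\<And>y. y \<ge> X \<Longrightarrow> cmod I / 2 < cmod (h y)" by (auto simp: eventually_at_top_linorder)
  have "integrable lborel (\<lambda>y. f (0 + (-1) * y))"
    using f by (subst lborel_integrable_real_affine_iff) auto
  hence "integrable lborel h" unfolding h_def using f by (intro Bochner_Integration.integrable_diff) auto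
  hence fin: "(\<integral>\<^sup>+y. ennreal (cmod (h y)) \<partial>lborel) < \<infinity>" by (simp add: integrable_iff_bounded)
  have *: "(\<integral>\<^sup>+y. ennreal (cmod I / 2) * indicator {X..X + real n} y \<partial>lborel) \<le> (\<integral>\<^sup>+y. ennreal (cmod (h y)) \<partial>lborel)" for n
    by (intro nn_integral_mono) (auto simp: indicator_def intro!: ennreal_leI dest!: X)
  have le: "ennreal (cmod I / 2 * real n) \<le> (\<integral>\<^sup>+y. ennreal (cmod (h y)) \<partial>lborel)" for n
  proof -
    have e: "ennreal (cmod I / 2 * real n) = ennreal (cmod I / 2) * ennreal (real n)"
      by (rule ennreal_mult) auto
    show ?thesis unfolding e using *[of n] by (simp add: nn_integral_cmult_indicator)
  qed
  define B where "B = enn2real (\<integral>\<^sup>+y. ennreal (cmod (h y)) \<partial>lborel)"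
  have "(\<integral>\<^sup>+y. ennreal (cmod (h y)) \<partial>lborel) = ennreal B" using fin by (simp add: B_def)
  hence B: "cmod I / 2 * real n \<le> B" for n
    using le[of n] ennreal_le_iff[of B "cmod I / 2 * real n"] by (simp only: B_def enn2real_nonneg)
  obtain n :: nat where "real n > B / (cmod I / 2)" using reals_Archimedean2 by blast
  hence "cmod I / 2 * real n > B" using I by (simp add: field_simps)
  with B[of n] show False by simp
qed

lemma measurable_slice:
  "f \<in> borel_measurable (lebesgue_on_coords (insert c I)) \<Longrightarrow>
    (\<lambda>(x, t). f (x(c := t))) \<in> borel_measurable (lebesgue_on_coords I \<Otimes>\<^sub>M lborel)"
  using measurable_compose[OF measurable_add_dim[where i = c and I = I and M = "\<lambda>_. lborel"], of f borel]
  by (simp add: case_prod_unfold)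

lemma AE_integrable_slice:
  fixes f :: "(nat \<times> nat \<Rightarrow> real) \<Rightarrow> complex"
  assumes I: "finite I" "c \<notin> I" and f: "integrable (lebesgue_on_coords (insert c I)) f"
  shows "AE x in lebesgue_on_coords I. integrable lborel (\<lambda>t. f (x(c := t)))"
proof -
  have m: "(\<lambda>(x, t). f (x(c := t))) \<in> borel_measurable (lebesgue_on_coords I \<Otimes>\<^sub>M lborel)"
    by (rule measurable_slice[OF borel_measurable_integrable[OF f]])
  hence m': "(\<lambda>(x, t). ennreal (norm (f (x(c := t))))) \<in> borel_measurable (lebesgue_on_coords I \<Otimes>\<^sub>M lborel)"
    by (simp add: case_prod_unfold)
  have "(\<integral>\<^sup>+x. \<integral>\<^sup>+t. ennreal (norm (f (x(c := t)))) \<partial>lborel \<partial>lebesgue_on_coords I)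
    = (\<integral>\<^sup>+x. ennreal (norm (f x)) \<partial>lebesgue_on_coords (insert c I))"
    using f by (subst coords.product_nn_integral_insert[OF I]) auto
  also have "\<dots> < \<infinity>" using f by (simp add: integrable_iff_bounded)
  finally have "AE x in lebesgue_on_coords I. (\<integral>\<^sup>+t. ennreal (norm (f (x(c := t)))) \<partial>lborel) \<noteq> \<infinity>"
    by (intro nn_integral_PInf_AE lborel.borel_measurable_nn_integral m') auto
  with AE_space show ?thesis
  proof eventually_elim
    case (elim x)
    have "(\<lambda>t. f (x(c := t))) \<in> borel_measurable lborel"
      using measurable_compose[OF measurable_Pair1' m] elim(1) by simp
    thus ?case using elim(2) by (simp add: integrable_iff_bounded less_top)
  qed
qed

text \<open>Fubini in the coordinate \<open>c\<close>. Only almost every slice of f and g is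
  integrable, which suffices because the inner integral vanishes on each such slice.\<close>

lemma integral_coord_derivative_eq_0:
  fixes f g :: "(nat \<times> nat \<Rightarrow> real) \<Rightarrow> complex"
  assumes I: "finite I" "c \<in> I"
    and f: "integrable (lebesgue_on_coords I) f" and g: "integrable (lebesgue_on_coords I) g"
    and deriv: "\<And>x. ((\<lambda>t. f (x(c := t))) has_vector_derivative g x) (at (x c))"
  shows "(\<integral>x. g x \<partial>lebesgue_on_coords I) = 0"
proof -
  define I' where "I' = I - {c}"
  have I': "I = insert c I'" "finite I'" "c \<notin> I'" using I by (auto simp: I'_def)
  have "AE x in lebesgue_on_coords I'. (\<integral>t. g (x(c := t)) \<partial>lborel) = 0"
    using AE_integrable_slice[OF I'(2,3) f[unfolded I'(1)]] AE_integrable_slice[OF I'(2,3) g[unfolded I'(1)]]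
  proof eventually_elim
    case (elim x)
    show ?case
    proof (rule integral_derivative_eq_0[OF _ elim])
      fix t
      show "((\<lambda>t. f (x(c := t))) has_vector_derivative g (x(c := t))) (at t)"
        using deriv[of "x(c := t)"] by simp
    qed
  qed
  hence "(\<integral>x. \<integral>t. g (x(c := t)) \<partial>lborel \<partial>lebesgue_on_coords I') = (\<integral>x. 0 \<partial>lebesgue_on_coords I')"
    by (intro integral_cong_AE lborel.borel_measurable_lebesgue_integral)
       (use measurable_slice[OF borel_measurable_integrable[OF g[unfolded I'(1)]]] in auto)
  thus ?thesis unfolding I'(1)
    by (subst coords.product_integral_insert[OF I'(2,3)]) (use g I'(1) in auto)
qed

subsection \<open>Gradients with respect to the matrix entries\<close>

text \<open>\<open>herm_entry_deriv c i j\<close> is the derivative of the \<open>(i, j)\<close> entry in the real coordinate \<open>c\<close>.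
  A function has gradient \<open>L\<close> if its coordinate derivatives are those of the complex-linear form
  \<open>\<Sum> L i j dH\<^sub>i\<^sub>j\<close>; since the \<open>dH\<^sub>i\<^sub>j\<close> are linearly independent over the complex numbers, the entries of
  the matrix can be treated as independent variables.\<close>

definition herm_entry_deriv :: "nat \<times> nat \<Rightarrow> nat \<Rightarrow> nat \<Rightarrow> complex" where
  "herm_entry_deriv c i j = (case c of (a, b) \<Rightarrow>
     if a \<le> b then (if i = a \<and> j = b \<or> i = b \<and> j = a then 1 else 0)
     else (if i = b \<and> j = a then \<i> else if i = a \<and> j = b then - \<i> else 0))"

definition hasgrad :: "nat \<Rightarrow> ((nat \<times> nat \<Rightarrow> real) \<Rightarrow> complex) \<Rightarrow> (nat \<times> nat \<Rightarrow> real) \<Rightarrow> (nat \<Rightarrow> nat \<Rightarrow> complex) \<Rightarrow> bool" where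
  "hasgrad N f x L \<longleftrightarrow> (\<forall>c \<in> {..<N} \<times> {..<N}. ((\<lambda>t. f (x(c := t))) has_vector_derivative
     (\<Sum>i<N. \<Sum>j<N. L i j * herm_entry_deriv c i j)) (at (x c)))"

lemma hasgrad_cong:
  "hasgrad N f x L \<Longrightarrow> (\<And>i j. i < N \<Longrightarrow> j < N \<Longrightarrow> L i j = L' i j) \<Longrightarrow> hasgrad N f x L'"
  unfolding hasgrad_def by (metis (no_types, lifting) lessThan_iff sum.cong)

lemma hasgrad_const: "hasgrad N (\<lambda>x. a) x (\<lambda>i j. 0)"
  by (simp add: hasgrad_def)

lemma herm_entry_has_vector_derivative:
  "((\<lambda>t. herm_entry (x(c := t)) k l) has_vector_derivative herm_entry_deriv c k l) (at (x c))"
proof -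
  obtain a b where c: "c = (a, b)" by force
  consider "k = l" | "k < l" | "k > l" by linarith
  thus ?thesis
  proof cases
    case 1
    thus ?thesis
      by (cases "c = (k, k)") (auto simp: herm_entry_def herm_entry_deriv_def c intro!: derivative_eq_intros)
  next
    case 2
    consider "c = (k, l)" | "c = (l, k)" | "c \<noteq> (k, l)" "c \<noteq> (l, k)" by blast
    thus ?thesis using 2
      by cases (auto simp: herm_entry_def herm_entry_deriv_def c Complex_eq intro!: derivative_eq_intros)
  next
    case 3
    consider "c = (k, l)" | "c = (l, k)" | "c \<noteq> (k, l)" "c \<noteq> (l, k)" by blast
    thus ?thesis using 3
      by cases (auto simp: herm_entry_def herm_entry_deriv_def c Complex_eq intro!: derivative_eq_intros)
  qed
qed

lemma hasgrad_entry:
  assumes "k < N" "l < N"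
  shows "hasgrad N (\<lambda>x. herm_entry x k l) x (\<lambda>i j. if i = k \<and> j = l then 1 else 0)"
proof -
  have "(\<Sum>i<N. \<Sum>j<N. (if i = k \<and> j = l then 1 else 0) * herm_entry_deriv c i j) = herm_entry_deriv c k l" for c
  proof -
    have "(\<Sum>i<N. \<Sum>j<N. (if i = k \<and> j = l then 1 else 0) * herm_entry_deriv c i j) =
      (\<Sum>i<N. if i = k then (\<Sum>j<N. if j = l then herm_entry_deriv c i j else 0) else 0)"
    proof (intro sum.cong refl)
      fix i
      have e: "(if P then 1 else 0) * z = (if P then z else 0)" for P and z :: complex by simp
      show "(\<Sum>j<N. (if i = k \<and> j = l then 1 else 0) * herm_entry_deriv c i j) =
          (if i = k then (\<Sum>j<N. if j = l then herm_entry_deriv c i j else 0) else 0)"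
        unfolding e by simp
    qed
    thus ?thesis using assms by simp
  qed
  thus ?thesis unfolding hasgrad_def using herm_entry_has_vector_derivative by simp
qed

lemma hasgrad_add:
  "hasgrad N f x L \<Longrightarrow> hasgrad N g x L' \<Longrightarrow> hasgrad N (\<lambda>x. f x + g x) x (\<lambda>i j. L i j + L' i j)"
  unfolding hasgrad_def by (auto simp: distrib_right sum.distrib intro: has_vector_derivative_add)

lemma hasgrad_sum:
  "finite A \<Longrightarrow> (\<And>a. a \<in> A \<Longrightarrow> hasgrad N (f a) x (L a)) \<Longrightarrow>
    hasgrad N (\<lambda>x. \<Sum>a\<in>A. f a x) x (\<lambda>i j. \<Sum>a\<in>A. L a i j)"
  by (induction rule: finite_induct) (auto intro: hasgrad_const hasgrad_add)

lemma hasgrad_mult: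
  assumes "hasgrad N f x L" "hasgrad N g x L'"
  shows "hasgrad N (\<lambda>x. f x * g x) x (\<lambda>i j. f x * L' i j + L i j * g x)"
  unfolding hasgrad_def
proof
  fix c assume "c \<in> {..<N} \<times> {..<N}"
  hence "((\<lambda>t. f (x(c := t)) * g (x(c := t))) has_vector_derivative
    f (x(c := x c)) * (\<Sum>i<N. \<Sum>j<N. L' i j * herm_entry_deriv c i j) +
    (\<Sum>i<N. \<Sum>j<N. L i j * herm_entry_deriv c i j) * g (x(c := x c))) (at (x c))"
    using assms unfolding hasgrad_def by (intro has_vector_derivative_mult) auto
  thus "((\<lambda>t. f (x(c := t)) * g (x(c := t))) has_vector_derivative
     (\<Sum>i<N. \<Sum>j<N. (f x * L' i j + L i j * g x) * herm_entry_deriv c i j)) (at (x c))"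
    by (simp add: algebra_simps sum.distrib sum_distrib_left sum_distrib_right)
qed

lemma hasgrad_chain:
  assumes "hasgrad N f x L" "(G has_field_derivative G') (at (f x))"
  shows "hasgrad N (\<lambda>x. G (f x)) x (\<lambda>i j. G' * L i j)"
  unfolding hasgrad_def
proof
  fix c assume "c \<in> {..<N} \<times> {..<N}"
  hence "((\<lambda>t. f (x(c := t))) has_vector_derivative (\<Sum>i<N. \<Sum>j<N. L i j * herm_entry_deriv c i j)) (at (x c))"
    using assms(1) unfolding hasgrad_def by blast
  hence "((G \<circ> (\<lambda>t. f (x(c := t)))) has_vector_derivative (\<Sum>i<N. \<Sum>j<N. L i j * herm_entry_deriv c i j) * G') (at (x c))"
    by (rule field_vector_diff_chain_at) (use assms(2) in simp)
  thus "((\<lambda>t. G (f (x(c := t)))) has_vector_derivative (\<Sum>i<N. \<Sum>j<N. G' * L i j * herm_entry_deriv c i j)) (at (x c))"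
    by (simp add: o_def sum_distrib_left sum_distrib_right mult_ac)
qed

lemma hasgrad_prod:
  "finite A \<Longrightarrow> (\<And>a. a \<in> A \<Longrightarrow> hasgrad N (f a) x (L a)) \<Longrightarrow>
    hasgrad N (\<lambda>x. \<Prod>a\<in>A. f a x) x (\<lambda>i j. \<Sum>a\<in>A. L a i j * (\<Prod>b\<in>A - {a}. f b x))"
proof (induction rule: finite_induct)
  case empty
  show ?case using hasgrad_const[of N 1 x] by simp
next
  case (insert a A)
  have "hasgrad N (\<lambda>x. f a x * (\<Prod>a\<in>A. f a x)) x
     (\<lambda>i j. f a x * (\<Sum>a\<in>A. L a i j * (\<Prod>b\<in>A - {a}. f b x)) + L a i j * (\<Prod>a\<in>A. f a x))"
    by (intro hasgrad_mult insert) (use insert in auto)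
  moreover have "f a x * (\<Sum>a\<in>A. L a i j * (\<Prod>b\<in>A - {a}. f b x)) + L a i j * (\<Prod>a\<in>A. f a x) =
      (\<Sum>c\<in>insert a A. L c i j * (\<Prod>b\<in>insert a A - {c}. f b x))" for i j
  proof -
    have e: "(\<Prod>b\<in>insert a A - {c}. f b x) = f a x * (\<Prod>b\<in>A - {c}. f b x)" if "c \<in> A" for c
    proof -
      have "insert a A - {c} = insert a (A - {c})" using that insert by auto
      thus ?thesis using insert by simp
    qed
    have e1: "(\<Sum>c\<in>A. L c i j * (\<Prod>b\<in>insert a A - {c}. f b x)) =
        f a x * (\<Sum>c\<in>A. L c i j * (\<Prod>b\<in>A - {c}. f b x))"
      unfolding sum_distrib_left by (intro sum.cong refl) (simp only: e mult_ac)
    have e2: "insert a A - {a} = A" using insert by auto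
    show ?thesis unfolding sum.insert[OF insert(1,2)] e1 e2 by (rule add.commute)
  qed
  ultimately show ?case using insert by simp
qed

text \<open>For a < b the two real coordinates of the entry give that the integrals of L_ab + L_ba
  and of i (L_ba - L_ab) vanish; solving for the two unknowns gives each entry of the gradient
  separately. A diagonal entry has one real coordinate and needs no solving.\<close>

lemma integral_grad_eq_0:
  assumes "\<And>x. hasgrad N f x (L x)"
    and f: "integrable (coord_measure N) f"
    and L: "\<And>i j. i < N \<Longrightarrow> j < N \<Longrightarrow> integrable (coord_measure N) (\<lambda>x. L x i j)"
    and ij: "i < N" "j < N"
  shows "(\<integral>x. L x i j \<partial>coord_measure N) = 0"
proof -
  define D where "D = coord_measure N"
  have 0: "(\<integral>x. (\<Sum>k<N. \<Sum>l<N. L x k l * herm_entry_deriv c k l) \<partial>D) = 0" if "c \<in> {..<N} \<times> {..<N}" for c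
    unfolding D_def
  proof (rule integral_coord_derivative_eq_0[OF _ that f])
    show "integrable (coord_measure N) (\<lambda>x. \<Sum>k<N. \<Sum>l<N. L x k l * herm_entry_deriv c k l)"
      by (intro Bochner_Integration.integrable_sum integrable_mult_left L) auto
    show "((\<lambda>t. f (x(c := t))) has_vector_derivative (\<Sum>k<N. \<Sum>l<N. L x k l * herm_entry_deriv c k l)) (at (x c))" for x
      using assms(1)[of x] that unfolding hasgrad_def by blast
  qed auto
  have coord_sum: "(\<Sum>k<N. \<Sum>l<N. M k l * herm_entry_deriv (a, b) k l) =
      (if a = b then M a a else if a < b then M a b + M b a else \<i> * (M b a - M a b))"
    if "a < N" "b < N" for M :: "nat \<Rightarrow> nat \<Rightarrow> complex" and a b
  proof -
    have del: "(\<Sum>k<N. \<Sum>l<N. if k = p \<and> l = q then M k l * e else 0) = M p q * e" if "p < N" "q < N" for p q and e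
    proof -
      have "(\<Sum>k<N. \<Sum>l<N. if k = p \<and> l = q then M k l * e else 0) =
        (\<Sum>k<N. if k = p then (\<Sum>l<N. if l = q then M k l * e else 0) else 0)"
        by (intro sum.cong refl) auto
      thus ?thesis using that by simp
    qed
    consider "a = b" | "a < b" | "b < a" by linarith
    thus ?thesis
    proof cases
      case 1
      have "(\<Sum>k<N. \<Sum>l<N. M k l * herm_entry_deriv (a, b) k l) = (\<Sum>k<N. \<Sum>l<N. if k = a \<and> l = a then M k l * 1 else 0)"
        using 1 by (intro sum.cong refl) (auto simp: herm_entry_deriv_def)
      thus ?thesis unfolding del[OF that(1,1)] using 1 by simp
    next
      case 2
      have "(\<Sum>k<N. \<Sum>l<N. M k l * herm_entry_deriv (a, b) k l) =
        (\<Sum>k<N. \<Sum>l<N. (if k = a \<and> l = b then M k l * 1 else 0) + (if k = b \<and> l = a then M k l * 1 else 0))"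
        using 2 by (intro sum.cong refl) (auto simp: herm_entry_deriv_def)
      thus ?thesis unfolding sum.distrib del[OF that] del[OF that(2,1)] using 2 by simp
    next
      case 3
      have "(\<Sum>k<N. \<Sum>l<N. M k l * herm_entry_deriv (a, b) k l) =
        (\<Sum>k<N. \<Sum>l<N. (if k = b \<and> l = a then M k l * \<i> else 0) + (if k = a \<and> l = b then M k l * (- \<i>) else 0))"
        using 3 by (intro sum.cong refl) (auto simp: herm_entry_deriv_def)
      thus ?thesis unfolding sum.distrib del[OF that] del[OF that(2,1)] using 3 by (simp add: algebra_simps)
    qed
  qed
  have L': "integrable D (\<lambda>x. L x k l)" if "k < N" "l < N" for k l using L[OF that] by (simp add: D_def)
  have zero: "(\<integral>x. L x a b \<partial>D) = 0 \<and> (\<integral>x. L x b a \<partial>D) = 0" if ab: "a < N" "b < N" "a < b" for a b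
  proof -
    have "(\<integral>x. L x a b + L x b a \<partial>D) = 0" using 0[of "(a, b)"] ab by (simp add: coord_sum)
    hence p: "(\<integral>x. L x a b \<partial>D) + (\<integral>x. L x b a \<partial>D) = 0" using L' ab by simp
    have "(\<integral>x. \<i> * (L x a b - L x b a) \<partial>D) = 0" using 0[of "(b, a)"] ab by (simp add: coord_sum)
    hence "(\<integral>x. L x a b \<partial>D) - (\<integral>x. L x b a \<partial>D) = 0" using L' ab by simp
    with p show ?thesis by (simp add: add_eq_0_iff)
  qed
  consider "i = j" | "i < j" | "j < i" by linarith
  hence "(\<integral>x. L x i j \<partial>D) = 0"
  proof cases
    case 1
    thus ?thesis using 0[of "(i, i)"] ij by (simp add: coord_sum)
  qed (use zero ij in auto)
  thus ?thesis by (simp add: D_def)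
qed

section \<open>Traces of powers and their gradients\<close>

fun hpow :: "nat \<Rightarrow> (nat \<times> nat \<Rightarrow> real) \<Rightarrow> nat \<Rightarrow> nat \<Rightarrow> nat \<Rightarrow> complex" where
  "hpow N x 0 i j = (if i = j then 1 else 0)"
| "hpow N x (Suc m) i j = (\<Sum>k<N. hpow N x m i k * herm_entry x k j)"

definition htr :: "nat \<Rightarrow> (nat \<times> nat \<Rightarrow> real) \<Rightarrow> nat \<Rightarrow> complex" where
  "htr N x m = (\<Sum>i<N. hpow N x m i i)"

definition htrs :: "nat \<Rightarrow> (nat \<times> nat \<Rightarrow> real) \<Rightarrow> nat list \<Rightarrow> complex" where
  "htrs N x ms = (\<Prod>m\<leftarrow>ms. htr N x m)"

lemma htrs_simps [simp]: "htrs N x [] = 1" "htrs N x (m # ms) = htr N x m * htrs N x ms"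
  by (simp_all add: htrs_def)

lemma htr_0 [simp]: "htr N x 0 = of_nat N"
  by (simp add: htr_def)

lemma hpow_eq_pow_mat: "i < N \<Longrightarrow> j < N \<Longrightarrow> (herm_of_coords N x ^\<^sub>m m) $$ (i, j) = hpow N x m i j"
proof (induction m arbitrary: j)
  case 0
  thus ?case by (simp add: herm_of_coords_eq)
next
  case (Suc m)
  define H where "H = herm_of_coords N x"
  have H: "H \<in> carrier_mat N N" by (simp add: H_def herm_of_coords_eq)
  have "(H ^\<^sub>m m * H) $$ (i, j) = (\<Sum>k<N. (H ^\<^sub>m m) $$ (i, k) * H $$ (k, j))"
    using Suc.prems H by (simp add: scalar_prod_def atLeast0LessThan)
  also have "\<dots> = (\<Sum>k<N. hpow N x m i k * herm_entry x k j)"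
    using Suc by (intro sum.cong refl) (auto simp: H_def herm_of_coords_eq[of N x] simp del: pow_mat.simps)
  finally show ?case by (simp add: H_def)
qed

lemma htr_eq_mtrace: "htr N x m = mtrace (herm_of_coords N x ^\<^sub>m m)"
proof -
  have "dim_row (herm_of_coords N x) = N" by (simp add: herm_of_coords_eq)
  thus ?thesis by (simp add: htr_def mtrace_def hpow_eq_pow_mat)
qed

lemma hpow_mult:
  "i < N \<Longrightarrow> j < N \<Longrightarrow> (\<Sum>k<N. hpow N x a i k * hpow N x b k j) = hpow N x (a + b) i j"
proof (induction b arbitrary: j)
  case 0
  have "(\<Sum>k<N. hpow N x a i k * hpow N x 0 k j) = (\<Sum>k<N. if k = j then hpow N x a i k else 0)"
    by (intro sum.cong) auto
  thus ?case using 0 by simp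
next
  case (Suc b)
  have "(\<Sum>k<N. hpow N x a i k * hpow N x (Suc b) k j) =
      (\<Sum>l<N. \<Sum>k<N. hpow N x a i k * hpow N x b k l * herm_entry x l j)"
    by (subst sum.swap) (simp add: sum_distrib_left mult.assoc)
  also have "\<dots> = (\<Sum>l<N. hpow N x (a + b) i l * herm_entry x l j)"
    using Suc by (intro sum.cong refl) (simp flip: sum_distrib_right)
  finally show ?case by simp
qed

lemma hpow_1: "i < N \<Longrightarrow> hpow N x (Suc 0) i j = herm_entry x i j"
proof -
  assume "i < N"
  have "hpow N x (Suc 0) i j = (\<Sum>k<N. if k = i then herm_entry x k j else 0)"
    unfolding hpow.simps by (intro sum.cong) auto
  thus ?thesis using \<open>i < N\<close> by simp
qed

lemma sum_hpow_trace: "(\<Sum>i<N. \<Sum>j<N. hpow N x a i j * hpow N x b j i) = htr N x (a + b)"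
  unfolding htr_def by (intro sum.cong refl) (simp add: hpow_mult)

text \<open>Noncommutative Leibniz rule: d(H^m) is the sum of H^a dH H^(m-1-a), and the (i, j)
  coefficient of dH is read off.\<close>

lemma hasgrad_hpow:
  "k < N \<Longrightarrow> l < N \<Longrightarrow> hasgrad N (\<lambda>x. hpow N x m k l) x
    (\<lambda>i j. \<Sum>a<m. hpow N x a k i * hpow N x (m - 1 - a) j l)"
proof (induction m arbitrary: l)
  case 0
  show ?case using hasgrad_const by simp
next
  case (Suc m)
  have "hasgrad N (\<lambda>x. \<Sum>p<N. hpow N x m k p * herm_entry x p l) x
    (\<lambda>i j. \<Sum>p<N. hpow N x m k p * (if i = p \<and> j = l then 1 else 0) +
       (\<Sum>a<m. hpow N x a k i * hpow N x (m - 1 - a) j p) * herm_entry x p l)"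
    using Suc by (intro hasgrad_sum hasgrad_mult hasgrad_entry) auto
  moreover have "(\<Sum>p<N. hpow N x m k p * (if i = p \<and> j = l then 1 else 0) +
       (\<Sum>a<m. hpow N x a k i * hpow N x (m - 1 - a) j p) * herm_entry x p l) =
     (\<Sum>a<Suc m. hpow N x a k i * hpow N x (Suc m - 1 - a) j l)" if "i < N" "j < N" for i j
  proof -
    have "(\<Sum>p<N. hpow N x m k p * (if i = p \<and> j = l then 1 else 0)) =
        (\<Sum>p<N. if p = i then hpow N x m k p * (if j = l then 1 else 0) else 0)"
      by (intro sum.cong) auto
    also have "\<dots> = hpow N x m k i * hpow N x 0 j l" using that by simp
    finally have 1: "(\<Sum>p<N. hpow N x m k p * (if i = p \<and> j = l then 1 else 0)) = hpow N x m k i * hpow N x 0 j l" .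
    have "(\<Sum>p<N. (\<Sum>a<m. hpow N x a k i * hpow N x (m - 1 - a) j p) * herm_entry x p l) =
        (\<Sum>a<m. hpow N x a k i * hpow N x (Suc (m - 1 - a)) j l)"
      by (simp add: sum_distrib_right sum_distrib_left mult.assoc) (rule sum.swap)
    also have "\<dots> = (\<Sum>a<m. hpow N x a k i * hpow N x (Suc m - 1 - a) j l)"
    proof (intro sum.cong refl)
      fix a assume "a \<in> {..<m}"
      hence "Suc (m - 1 - a) = Suc m - 1 - a" by auto
      thus "hpow N x a k i * hpow N x (Suc (m - 1 - a)) j l = hpow N x a k i * hpow N x (Suc m - 1 - a) j l"
        by (simp only:)
    qed
    finally show ?thesis unfolding sum.distrib 1 by (simp add: add.commute)
  qed
  ultimately show ?case by (simp only: hpow.simps) (rule hasgrad_cong)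
qed

text \<open>By cyclicity all m Leibniz terms coincide. For m = 0 the truncated exponent
  \<open>m - 1\<close> is harmless, because the coefficient is 0.\<close>

lemma hasgrad_htr: "hasgrad N (\<lambda>x. htr N x m) x (\<lambda>i j. of_nat m * hpow N x (m - 1) j i)"
proof -
  have "hasgrad N (\<lambda>x. htr N x m) x (\<lambda>i j. \<Sum>k<N. \<Sum>a<m. hpow N x a k i * hpow N x (m - 1 - a) j k)"
    unfolding htr_def by (intro hasgrad_sum hasgrad_hpow) auto
  moreover have "(\<Sum>k<N. \<Sum>a<m. hpow N x a k i * hpow N x (m - 1 - a) j k) = of_nat m * hpow N x (m - 1) j i"
    if "i < N" "j < N" for i j
  proof -
    have "(\<Sum>k<N. \<Sum>a<m. hpow N x a k i * hpow N x (m - 1 - a) j k) =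
        (\<Sum>a<m. \<Sum>k<N. hpow N x (m - 1 - a) j k * hpow N x a k i)"
      by (subst sum.swap) (simp add: mult.commute)
    also have "\<dots> = (\<Sum>a<m. hpow N x (m - 1) j i)"
      using that by (intro sum.cong refl) (simp add: hpow_mult)
    finally show ?thesis by simp
  qed
  ultimately show ?thesis by (rule hasgrad_cong)
qed

fun htrs_grad :: "nat \<Rightarrow> (nat \<times> nat \<Rightarrow> real) \<Rightarrow> nat list \<Rightarrow> nat \<Rightarrow> nat \<Rightarrow> complex" where
  "htrs_grad N x [] i j = 0"
| "htrs_grad N x (m # ms) i j = htr N x m * htrs_grad N x ms i j + of_nat m * hpow N x (m - 1) j i * htrs N x ms"

lemma hasgrad_htrs: "hasgrad N (\<lambda>x. htrs N x ms) x (htrs_grad N x ms)"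
proof (induction ms)
  case Nil
  show ?case using hasgrad_const by (simp add: fun_eq_iff[of "htrs_grad _ _ _"] hasgrad_def)
next
  case (Cons m ms)
  have "hasgrad N (\<lambda>x. htr N x m * htrs N x ms) x
    (\<lambda>i j. htr N x m * htrs_grad N x ms i j + of_nat m * hpow N x (m - 1) j i * htrs N x ms)"
    by (intro hasgrad_mult hasgrad_htr Cons)
  thus ?case by (simp add: hasgrad_def)
qed

text \<open>A list \<open>[m\<^sub>1, m\<^sub>2, \<dots>]\<close> stands for \<open>Tr H\<^bsup>m\<^sub>1\<^esup> Tr H\<^bsup>m\<^sub>2\<^esup> \<cdots>\<close>. Each pair carries the factor \<open>m\<close> that
  arises when \<open>Tr H\<^sup>m\<close> is differentiated.\<close>

fun joins :: "(nat \<Rightarrow> nat) \<Rightarrow> nat list \<Rightarrow> (nat \<times> nat list) list" where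
  "joins f [] = []"
| "joins f (m # ms) = (m, f m # ms) # map (apsnd ((#) m)) (joins f ms)"

text \<open>Differentiating the factor Tr H^m in direction H^p merges the two into m Tr H^(p+m-1)
  and leaves the other traces alone; this is the operation that \<open>joins\<close>
  records.\<close>

lemma sum_hpow_htrs_grad:
  "(\<Sum>i<N. \<Sum>j<N. hpow N x p i j * htrs_grad N x ms i j) =
    (\<Sum>(c, ns)\<leftarrow>joins (\<lambda>m. p + (m - 1)) ms. of_nat c * htrs N x ns)"
proof (induction ms)
  case (Cons m ms)
  have "(\<Sum>i<N. \<Sum>j<N. hpow N x p i j * htrs_grad N x (m # ms) i j) =
    htr N x m * (\<Sum>i<N. \<Sum>j<N. hpow N x p i j * htrs_grad N x ms i j) +
    of_nat m * htrs N x ms * (\<Sum>i<N. \<Sum>j<N. hpow N x p i j * hpow N x (m - 1) j i)"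
    by (simp add: sum_distrib_left sum.distrib algebra_simps)
  also have "\<dots> = (\<Sum>(c, ns)\<leftarrow>joins (\<lambda>m. p + (m - 1)) (m # ms). of_nat c * htrs N x ns)"
    unfolding Cons sum_hpow_trace
    by (simp add: sum_list_const_mult[symmetric] o_def case_prod_unfold mult_ac)
  finally show ?case .
qed simp

subsection \<open>The gradient of the determinant\<close>

lemma permutes_less: "p permutes {0..<n :: nat} \<Longrightarrow> k < n \<Longrightarrow> p k < n"
  using permutes_in_image[of p "{0..<n}" k] by auto

lemma det_mat_leibniz:
  "Determinant.det (Matrix.mat n n (\<lambda>(k, l). A k l)) =
    (\<Sum>p | p permutes {0..<n}. signof p * (\<Prod>k = 0..<n. A k (p k)))"
  by (subst det_def'[of _ n]) (auto intro!: sum.cong prod.cong simp: permutes_less)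

text \<open>The left side is the Leibniz formula for the matrix with row \<open>k\<close> replaced
  by \<open>l\<close>. Expanding along that row gives cofactors, which do not see row
  \<open>k\<close> and so are those of the original matrix.\<close>

lemma det_replace_row:
  assumes "k < N"
  shows "(\<Sum>p | p permutes {0..<N}. signof p * (l (p k) * (\<Prod>i\<in>{0..<N} - {k}. A i (p i)))) =
    (\<Sum>j<N. cofactor (Matrix.mat N N (\<lambda>(i, j). A i j)) k j * (l j :: complex))"
proof -
  define B where "B = Matrix.mat N N (\<lambda>(i, j). if i = k then l j else A i j)"
  have B: "B \<in> carrier_mat N N" by (simp add: B_def)
  have "Determinant.det B = (\<Sum>p | p permutes {0..<N}. signof p * (\<Prod>i = 0..<N. B $$ (i, p i)))"
    by (rule det_def'[OF B])
  also have "\<dots> = (\<Sum>p | p permutes {0..<N}. signof p * (l (p k) * (\<Prod>i\<in>{0..<N} - {k}. A i (p i))))"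
  proof (intro sum.cong refl arg_cong2[of _ _ _ _ "(*)"])
    fix p assume "p \<in> {p. p permutes {0..<N}}"
    hence p: "p i < N" if "i < N" for i using that permutes_in_image[of p "{0..<N}" i] by auto
    have "(\<Prod>i = 0..<N. B $$ (i, p i)) = B $$ (k, p k) * (\<Prod>i\<in>{0..<N} - {k}. B $$ (i, p i))"
      using assms by (subst prod.remove[of _ k]) auto
    also have "\<dots> = l (p k) * (\<Prod>i\<in>{0..<N} - {k}. A i (p i))"
      using assms p by (intro arg_cong2[of _ _ _ _ "(*)"] prod.cong) (auto simp: B_def)
    finally show "(\<Prod>i = 0..<N. B $$ (i, p i)) = l (p k) * (\<Prod>i\<in>{0..<N} - {k}. A i (p i))" .
  qed
  finally have "(\<Sum>p | p permutes {0..<N}. signof p * (l (p k) * (\<Prod>i\<in>{0..<N} - {k}. A i (p i)))) = Determinant.det B" ..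
  also have "\<dots> = (\<Sum>j<N. B $$ (k, j) * cofactor B k j)" by (rule laplace_expansion_row[OF B assms])
  also have "\<dots> = (\<Sum>j<N. cofactor (Matrix.mat N N (\<lambda>(i, j). A i j)) k j * l j)"
  proof (intro sum.cong refl)
    fix j assume j: "j \<in> {..<N}"
    have "mat_delete B k j = mat_delete (Matrix.mat N N (\<lambda>(i, j). A i j)) k j"
      using assms j by (intro eq_matI) (auto simp: mat_delete_def B_def)
    thus "B $$ (k, j) * cofactor B k j = cofactor (Matrix.mat N N (\<lambda>(i, j). A i j)) k j * l j"
      using assms j by (simp add: cofactor_def B_def)
  qed
  finally show ?thesis .
qed

text \<open>Jacobi's formula. The product rule replaces one row at a time by its derivative, and
  \<open>det_replace_row\<close> collects the result into cofactors.\<close>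

lemma hasgrad_det:
  assumes "\<And>k l. k < N \<Longrightarrow> l < N \<Longrightarrow> hasgrad N (\<lambda>x. A x k l) x (L k l)"
  shows "hasgrad N (\<lambda>x. Determinant.det (Matrix.mat N N (\<lambda>(k, l). A x k l))) x
    (\<lambda>i j. \<Sum>k<N. \<Sum>l<N. cofactor (Matrix.mat N N (\<lambda>(k, l). A x k l)) k l * L k l i j)"
proof -
  have "hasgrad N (\<lambda>x. \<Sum>p | p permutes {0..<N}. signof p * (\<Prod>k = 0..<N. A x k (p k))) x
     (\<lambda>i j. \<Sum>p | p permutes {0..<N}. signof p * (\<Sum>k = 0..<N. L k (p k) i j * (\<Prod>b\<in>{0..<N} - {k}. A x b (p b)))
        + 0 * (\<Prod>k = 0..<N. A x k (p k)))"
    by (intro hasgrad_sum hasgrad_mult hasgrad_const hasgrad_prod assms) (auto simp: permutes_less finite_permutations)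
  moreover have "(\<Sum>p | p permutes {0..<N}. signof p * (\<Sum>k = 0..<N. L k (p k) i j * (\<Prod>b\<in>{0..<N} - {k}. A x b (p b)))
        + 0 * (\<Prod>k = 0..<N. A x k (p k))) =
      (\<Sum>k<N. \<Sum>l<N. cofactor (Matrix.mat N N (\<lambda>(k, l). A x k l)) k l * L k l i j)" for i j
  proof -
    have "(\<Sum>p | p permutes {0..<N}. signof p * (\<Sum>k = 0..<N. L k (p k) i j * (\<Prod>b\<in>{0..<N} - {k}. A x b (p b)))
        + 0 * (\<Prod>k = 0..<N. A x k (p k))) =
      (\<Sum>k<N. \<Sum>p | p permutes {0..<N}. signof p * (L k (p k) i j * (\<Prod>b\<in>{0..<N} - {k}. A x b (p b))))"
      unfolding sum_distrib_left atLeast0LessThan by (subst sum.swap) simp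
    also have "\<dots> = (\<Sum>k<N. \<Sum>l<N. cofactor (Matrix.mat N N (\<lambda>(k, l). A x k l)) k l * L k l i j)"
      by (intro sum.cong refl det_replace_row) auto
    finally show ?thesis .
  qed
  ultimately show ?thesis unfolding det_mat_leibniz by (simp only:)
qed

definition one_plus_H2 :: "nat \<Rightarrow> (nat \<times> nat \<Rightarrow> real) \<Rightarrow> complex mat" where
  "one_plus_H2 N x = Matrix.mat N N (\<lambda>(k, l). (if k = l then 1 else 0) + hpow N x 2 k l)"

definition detw_grad :: "nat \<Rightarrow> (nat \<times> nat \<Rightarrow> real) \<Rightarrow> nat \<Rightarrow> nat \<Rightarrow> complex" where
  "detw_grad N x i j = (\<Sum>k<N. \<Sum>l<N. cofactor (one_plus_H2 N x) k l *
     (\<Sum>a<2. hpow N x a k i * hpow N x (2 - 1 - a) j l))"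

lemma det_one_plus_H2': "Determinant.det (one_plus_H2 N x) = complex_of_real (detw N x)"
proof -
  have "one_plus_H2 N x = 1\<^sub>m N + herm_of_coords N x * herm_of_coords N x"
  proof (rule eq_matI)
    fix i j assume "i < dim_row (1\<^sub>m N + herm_of_coords N x * herm_of_coords N x)"
      "j < dim_col (1\<^sub>m N + herm_of_coords N x * herm_of_coords N x)"
    hence ij: "i < N" "j < N" by (auto simp: herm_of_coords_eq)
    have "hpow N x 2 i j = (\<Sum>k<N. herm_entry x i k * herm_entry x k j)"
      using hpow_mult[OF ij, of x 1 1] ij by (simp add: hpow_1 numeral_2_eq_2 del: hpow.simps)
    thus "one_plus_H2 N x $$ (i, j) = (1\<^sub>m N + herm_of_coords N x * herm_of_coords N x) $$ (i, j)"
      using ij by (simp add: one_plus_H2_def herm_of_coords_eq scalar_prod_def atLeast0LessThan)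
  qed (auto simp: one_plus_H2_def herm_of_coords_eq)
  thus ?thesis by (simp add: det_one_plus_H2)
qed

lemma hasgrad_detw: "hasgrad N (\<lambda>x. complex_of_real (detw N x)) x (detw_grad N x)"
proof -
  have "hasgrad N (\<lambda>x. (if k = l then 1 else 0) + hpow N x 2 k l) x
      (\<lambda>i j. 0 + (\<Sum>a<2. hpow N x a k i * hpow N x (2 - 1 - a) j l))" if "k < N" "l < N" for k l
    using that by (intro hasgrad_add hasgrad_const hasgrad_hpow)
  from hasgrad_det[of N "\<lambda>x k l. (if k = l then 1 else 0) + hpow N x 2 k l", OF this]
  show ?thesis unfolding one_plus_H2_def[symmetric] det_one_plus_H2' detw_grad_def[abs_def] by simp
qed

lemma sum4_swap:
  fixes c :: "nat \<Rightarrow> nat \<Rightarrow> 'a :: comm_semiring_0"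
  shows "(\<Sum>i<n. \<Sum>j<n. g i j * (\<Sum>k<n. \<Sum>l<n. c k l * e k l i j)) =
    (\<Sum>k<n. \<Sum>l<n. c k l * (\<Sum>i<n. \<Sum>j<n. g i j * e k l i j))"
proof -
  have r: "(\<Sum>i<n. \<Sum>j<n. F i j) = (\<Sum>p\<in>{..<n} \<times> {..<n}. F (fst p) (snd p))" for F :: "nat \<Rightarrow> nat \<Rightarrow> 'a"
    by (simp add: sum.cartesian_product case_prod_unfold)
  show ?thesis unfolding r sum_distrib_left by (subst sum.swap) (simp add: mult_ac)
qed

text \<open>For Y = 1 + H^2 one has d det Y = Tr (adj Y dY) with dY = dH H + H dH. In direction dH =
  H^p Y everything commutes, so dY = 2 H^(p+1) Y and adj Y meets Y to give det Y. This is why the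
  field carries the factor 1 + H^2.\<close>

lemma sum_hpow_detw_grad:
  "(\<Sum>i<N. \<Sum>j<N. (hpow N x p i j + hpow N x (p + 2) i j) * detw_grad N x i j) =
    2 * complex_of_real (detw N x) * htr N x (p + 1)"
proof -
  define Y where "Y = one_plus_H2 N x"
  define g where "g i j = hpow N x p i j + hpow N x (p + 2) i j" for i j
  define e where "e k l i j = (\<Sum>a<2. hpow N x a k i * hpow N x (2 - 1 - a) j l)" for k l i j
  have Y: "Y \<in> carrier_mat N N" by (simp add: Y_def one_plus_H2_def)
  have contr: "(\<Sum>i<N. \<Sum>j<N. hpow N x q i j * e k l i j) = 2 * hpow N x (q + 1) k l"
    if "k < N" "l < N" for q k l
  proof -
    have "(\<Sum>i<N. \<Sum>j<N. hpow N x q i j * e k l i j) =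
        (\<Sum>a<2. \<Sum>i<N. hpow N x a k i * (\<Sum>j<N. hpow N x q i j * hpow N x (2 - 1 - a) j l))"
      unfolding e_def sum_distrib_left by (subst sum.swap[of _ "{..<2}"], subst sum.swap[of _ "{..<2}"]) (simp add: mult_ac)
    also have "\<dots> = (\<Sum>a<2. hpow N x (a + (q + (2 - 1 - a))) k l)"
      using that by (simp add: hpow_mult del: hpow.simps)
    also have "\<dots> = (\<Sum>a<2::nat. hpow N x (q + 1) k l)"
      by (intro sum.cong refl) (simp add: less_Suc_eq numeral_2_eq_2 del: hpow.simps, auto)
    finally show ?thesis by (simp del: hpow.simps)
  qed
  have "(\<Sum>i<N. \<Sum>j<N. g i j * detw_grad N x i j) =
     (\<Sum>k<N. \<Sum>l<N. cofactor Y k l * (\<Sum>i<N. \<Sum>j<N. g i j *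
        e k l i j))"
    unfolding detw_grad_def Y_def[symmetric] e_def[symmetric] by (rule sum4_swap)
  also have "\<dots> = (\<Sum>k<N. \<Sum>l<N. cofactor Y k l * (2 * (\<Sum>m<N. Y $$ (k, m) * hpow N x (p + 1) m l)))"
  proof (intro sum.cong refl arg_cong2[of _ _ _ _ "(*)"])
    fix k l assume "k \<in> {..<N}" "l \<in> {..<N}"
    hence kl: "k < N" "l < N" by auto
    have "(\<Sum>i<N. \<Sum>j<N. g i j * e k l i j)
       = 2 * hpow N x (p + 1) k l + 2 * hpow N x (p + 2 + 1) k l"
      unfolding g_def distrib_right sum.distrib contr[OF kl] ..
    also have "hpow N x (p + 2 + 1) k l = (\<Sum>m<N. hpow N x 2 k m * hpow N x (p + 1) m l)"
      using kl by (simp only: hpow_mult) (simp only: add.commute add.left_commute add.assoc)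
    also have "2 * hpow N x (p + 1) k l + 2 * (\<Sum>m<N. hpow N x 2 k m * hpow N x (p + 1) m l) =
        2 * (\<Sum>m<N. (if m = k then hpow N x (p + 1) m l else 0) + hpow N x 2 k m * hpow N x (p + 1) m l)"
      using kl by (simp add: sum.distrib del: hpow.simps)
    also have "(\<Sum>m<N. (if m = k then hpow N x (p + 1) m l else 0) + hpow N x 2 k m * hpow N x (p + 1) m l) =
        (\<Sum>m<N. Y $$ (k, m) * hpow N x (p + 1) m l)"
      using kl by (intro sum.cong) (auto simp: Y_def one_plus_H2_def algebra_simps simp del: hpow.simps)
    finally show "(\<Sum>i<N. \<Sum>j<N. g i j * e k l i j)
       = 2 * (\<Sum>m<N. Y $$ (k, m) * hpow N x (p + 1) m l)" .
  qed
  also have "\<dots> = (\<Sum>l<N. \<Sum>k<N. \<Sum>m<N. 2 * (cofactor Y k l * Y $$ (k, m)) * hpow N x (p + 1) m l)"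
    by (subst sum.swap) (simp add: sum_distrib_left mult_ac del: hpow.simps)
  also have "\<dots> = (\<Sum>l<N. \<Sum>m<N. \<Sum>k<N. 2 * (cofactor Y k l * Y $$ (k, m)) * hpow N x (p + 1) m l)"
    by (rule sum.cong[OF refl], rule sum.swap)
  also have "\<dots> = (\<Sum>l<N. \<Sum>m<N. 2 * (\<Sum>k<N. cofactor Y k l * Y $$ (k, m)) * hpow N x (p + 1) m l)"
    by (simp add: sum_distrib_left sum_distrib_right del: hpow.simps)
  also have "\<dots> = (\<Sum>l<N. \<Sum>m<N. if m = l then 2 * complex_of_real (detw N x) * hpow N x (p + 1) m l else 0)"
  proof (intro sum.cong refl)
    fix l m assume "l \<in> {..<N}" "m \<in> {..<N}"
    hence lm: "l < N" "m < N" by auto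
    have "(\<Sum>k<N. cofactor Y k l * Y $$ (k, m)) = (adj_mat Y * Y) $$ (l, m)"
      using Y lm adj_mat(1)[OF Y] by (simp add: scalar_prod_def atLeast0LessThan adj_mat_def)
    also have "\<dots> = (if m = l then complex_of_real (detw N x) else 0)"
      unfolding adj_mat(3)[OF Y] using lm by (simp add: Y_def det_one_plus_H2')
    finally show "2 * (\<Sum>k<N. cofactor Y k l * Y $$ (k, m)) * hpow N x (p + 1) m l =
        (if m = l then 2 * complex_of_real (detw N x) * hpow N x (p + 1) m l else 0)"
      by (simp del: hpow.simps)
  qed
  also have "\<dots> = 2 * complex_of_real (detw N x) * htr N x (p + 1)"
    by (simp add: htr_def sum_distrib_left del: hpow.simps)
  finally show ?thesis unfolding g_def .
qed

section \<open>The loop equations\<close>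

subsection \<open>Polynomially bounded functions\<close>

text \<open>A crude growth class in which the degree is not tracked. It serves for integrands that
  also carry a high power of the cutoff.\<close>

definition polybounded :: "nat \<Rightarrow> ((nat \<times> nat \<Rightarrow> real) \<Rightarrow> complex) \<Rightarrow> bool" where
  "polybounded N f \<longleftrightarrow> f \<in> borel_measurable (coord_measure N) \<and>
    (\<exists>C n. \<forall>x. cmod (f x) \<le> C * frob N x ^ n)"

lemma polyboundedI:
  "f \<in> borel_measurable (coord_measure N) \<Longrightarrow> (\<And>x. cmod (f x) \<le> C * frob N x ^ n) \<Longrightarrow> polybounded N f"
  unfolding polybounded_def by blast

lemma polyboundedE:
  assumes "polybounded N f"
  obtains C n where "C \<ge> 0" "\<And>x. cmod (f x) \<le> C * frob N x ^ n"
proof -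
  obtain C n where C: "\<And>x. cmod (f x) \<le> C * frob N x ^ n" using assms by (auto simp: polybounded_def)
  have "0 \<le> C * frob N (\<lambda>_. 0) ^ n" using C[of "\<lambda>_. 0"] norm_ge_zero order_trans by blast
  moreover have "frob N (\<lambda>_. 0) ^ n > 0" using frob_ge_1[of N "\<lambda>_. 0"] by simp
  ultimately have "C \<ge> 0" by (simp add: zero_le_mult_iff)
  thus ?thesis using C that by blast
qed

lemma polybounded_measurable: "polybounded N f \<Longrightarrow> f \<in> borel_measurable (coord_measure N)"
  by (simp add: polybounded_def)

lemma polybounded_const: "polybounded N (\<lambda>x. a)"
  by (rule polyboundedI[where C = "cmod a" and n = 0]) auto

lemma cmod_herm_entry_le: "i < N \<Longrightarrow> j < N \<Longrightarrow> cmod (herm_entry x i j) \<le> frob N x"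
proof -
  assume ij: "i < N" "j < N"
  have "cmod (herm_entry x i j)^2 \<le> (\<Sum>j<N. cmod (herm_entry x i j)^2)"
    using ij by (intro member_le_sum) auto
  also have "\<dots> \<le> (\<Sum>i<N. \<Sum>j<N. cmod (herm_entry x i j)^2)"
    using ij by (intro member_le_sum[of i _ "\<lambda>i. \<Sum>j<N. cmod (herm_entry x i j)^2"]) (auto intro: sum_nonneg)
  also have "\<dots> \<le> frob N x" by (simp add: frob_def)
  also have "\<dots> \<le> frob N x ^ 2" using frob_ge_1[of N x] by (simp add: power2_eq_square)
  finally show ?thesis by (rule power2_le_imp_le) (use frob_ge_1[of N x] in simp)
qed

lemma polybounded_herm_entry: "i < N \<Longrightarrow> j < N \<Longrightarrow> polybounded N (\<lambda>x. herm_entry x i j)"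
  by (rule polyboundedI[where C = 1 and n = 1]) (auto intro: measurable_herm_entry cmod_herm_entry_le)

lemma polybounded_mult:
  assumes f: "polybounded N f" and g: "polybounded N g"
  shows "polybounded N (\<lambda>x. f x * g x)"
proof -
  obtain C n where C: "C \<ge> 0" "\<And>x. cmod (f x) \<le> C * frob N x ^ n" by (rule polyboundedE[OF f]) blast
  obtain D m where D: "D \<ge> 0" "\<And>x. cmod (g x) \<le> D * frob N x ^ m" by (rule polyboundedE[OF g]) blast
  show ?thesis
  proof (rule polyboundedI[where C = "C * D" and n = "n + m"])
    fix x
    have "cmod (f x * g x) \<le> (C * frob N x ^ n) * (D * frob N x ^ m)"
      unfolding norm_mult using C D frob_ge_1[of N x] by (intro mult_mono) auto
    thus "cmod (f x * g x) \<le> C * D * frob N x ^ (n + m)" by (simp add: power_add mult_ac)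
  qed (use polybounded_measurable[OF f] polybounded_measurable[OF g] in measurable)
qed

lemma polybounded_add:
  assumes f: "polybounded N f" and g: "polybounded N g"
  shows "polybounded N (\<lambda>x. f x + g x)"
proof -
  obtain C n where C: "C \<ge> 0" "\<And>x. cmod (f x) \<le> C * frob N x ^ n" by (rule polyboundedE[OF f]) blast
  obtain D m where D: "D \<ge> 0" "\<And>x. cmod (g x) \<le> D * frob N x ^ m" by (rule polyboundedE[OF g]) blast
  show ?thesis
  proof (rule polyboundedI[where C = "C + D" and n = "n + m"])
    fix x
    have "C * frob N x ^ n \<le> C * frob N x ^ (n + m)" "D * frob N x ^ m \<le> D * frob N x ^ (n + m)"
      using C(1) D(1) frob_ge_1[of N x] by (auto intro!: mult_left_mono power_increasing)
    thus "cmod (f x + g x) \<le> (C + D) * frob N x ^ (n + m)"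
      using C(2)[of x] D(2)[of x] norm_triangle_ineq[of "f x" "g x"] by (simp add: algebra_simps)
  qed (use polybounded_measurable[OF f] polybounded_measurable[OF g] in measurable)
qed

lemma polybounded_sum:
  "finite A \<Longrightarrow> (\<And>a. a \<in> A \<Longrightarrow> polybounded N (f a)) \<Longrightarrow> polybounded N (\<lambda>x. \<Sum>a\<in>A. f a x)"
  by (induction rule: finite_induct) (auto intro: polybounded_const polybounded_add)

lemma polybounded_prod:
  "finite A \<Longrightarrow> (\<And>a. a \<in> A \<Longrightarrow> polybounded N (f a)) \<Longrightarrow> polybounded N (\<lambda>x. \<Prod>a\<in>A. f a x)"
  by (induction rule: finite_induct) (auto intro: polybounded_const polybounded_mult)

lemma polybounded_hpow: "i < N \<Longrightarrow> j < N \<Longrightarrow> polybounded N (\<lambda>x. hpow N x m i j)"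
  by (induction m arbitrary: j)
     (auto intro!: polybounded_const polybounded_sum polybounded_mult polybounded_herm_entry)

lemma polybounded_htr: "polybounded N (\<lambda>x. htr N x m)"
  unfolding htr_def by (intro polybounded_sum polybounded_hpow) auto

lemma polybounded_htrs: "polybounded N (\<lambda>x. htrs N x ms)"
  by (induction ms) (auto intro!: polybounded_const polybounded_mult polybounded_htr)

lemma polybounded_htrs_grad: "i < N \<Longrightarrow> j < N \<Longrightarrow> polybounded N (\<lambda>x. htrs_grad N x ms i j)"
  by (induction ms)
     (auto intro!: polybounded_const polybounded_add polybounded_mult polybounded_htr polybounded_htrs polybounded_hpow)

lemma polybounded_det:
  assumes "\<And>k l. k < n \<Longrightarrow> l < n \<Longrightarrow> polybounded N (\<lambda>x. A x k l)"
  shows "polybounded N (\<lambda>x. Determinant.det (Matrix.mat n n (\<lambda>(k, l). A x k l)))"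
  unfolding det_mat_leibniz
    by (intro polybounded_sum polybounded_mult polybounded_const polybounded_prod assms)
       (auto simp: permutes_less finite_permutations)

lemma polybounded_detw_grad:
  assumes "i < N" "j < N"
  shows "polybounded N (\<lambda>x. detw_grad N x i j)"
proof -
  have "polybounded N (\<lambda>x. cofactor (one_plus_H2 N x) k l)" if "k < N" "l < N" for k l
  proof -
    have e: "mat_delete (one_plus_H2 N x) k l = Matrix.mat (N - 1) (N - 1) (\<lambda>(i, j).
        (if (if i < k then i else Suc i) = (if j < l then j else Suc j) then 1 else 0) +
        hpow N x 2 (if i < k then i else Suc i) (if j < l then j else Suc j))" for x
      using that by (intro eq_matI) (auto simp: mat_delete_def one_plus_H2_def simp del: hpow.simps)
    show ?thesis unfolding cofactor_def e
      by (intro polybounded_mult polybounded_const polybounded_det polybounded_add polybounded_hpow)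
         (use that in auto)
  qed
  thus ?thesis unfolding detw_grad_def using assms
    by (intro polybounded_sum polybounded_mult polybounded_hpow) auto
qed

subsection \<open>Sharp bounds on products of traces\<close>

text \<open>Submultiplicativity of the Frobenius norm. Here the exponent must be exact: a product of
  traces of degree 2h is then bounded by \<open>frob^h\<close>, which is what the sharp
  integrability range allows.\<close>

lemma sum_hpow_row_le:
  assumes "i < N"
  shows "(\<Sum>j<N. cmod (hpow N x m i j)^2) \<le> frob N x ^ m"
proof (induction m)
  case 0
  have "(\<Sum>j<N. cmod (hpow N x 0 i j)^2) = (\<Sum>j<N. if j = i then 1 else 0)"
    by (intro sum.cong) auto
  thus ?case using assms by simp
next
  case (Suc m)
  define R where "R = (\<Sum>k<N. cmod (hpow N x m i k)^2)"
  have R: "R \<ge> 0" by (simp add: R_def sum_nonneg)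
  have "cmod (hpow N x (Suc m) i j)^2 \<le> R * (\<Sum>k<N. cmod (herm_entry x k j)^2)" for j
  proof -
    have "cmod (hpow N x (Suc m) i j) \<le> (\<Sum>k<N. cmod (hpow N x m i k) * cmod (herm_entry x k j))"
      by (simp, rule order_trans[OF norm_sum]) (simp add: norm_mult)
    hence "cmod (hpow N x (Suc m) i j)^2 \<le> (\<Sum>k<N. cmod (hpow N x m i k) * cmod (herm_entry x k j))^2"
      by (intro power_mono) auto
    also have "\<dots> \<le> R * (\<Sum>k<N. cmod (herm_entry x k j)^2)"
      unfolding R_def by (rule Cauchy_Schwarz_ineq_sum)
    finally show ?thesis .
  qed
  hence "(\<Sum>j<N. cmod (hpow N x (Suc m) i j)^2) \<le> (\<Sum>j<N. R * (\<Sum>k<N. cmod (herm_entry x k j)^2))"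
    by (rule sum_mono)
  also have "\<dots> = R * (\<Sum>j<N. \<Sum>k<N. cmod (herm_entry x k j)^2)" by (simp add: sum_distrib_left)
  also have "(\<Sum>j<N. \<Sum>k<N. cmod (herm_entry x k j)^2) = frob N x - 1"
    unfolding frob_def by (subst sum.swap) simp
  also have "R * (frob N x - 1) \<le> frob N x ^ m * frob N x"
    using Suc R frob_ge_1[of N x] unfolding R_def[symmetric] by (intro mult_mono) auto
  finally show ?case by (simp add: mult.commute)
qed

lemma cmod_htr_le: "cmod (htr N x m) \<le> real N * sqrt (frob N x) ^ m"
proof -
  have "cmod (hpow N x m i i) \<le> sqrt (frob N x) ^ m" if "i < N" for i
  proof -
    have "cmod (hpow N x m i i)^2 \<le> (\<Sum>j<N. cmod (hpow N x m i j)^2)"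
      using that by (intro member_le_sum[of i _ "\<lambda>j. cmod (hpow N x m i j)^2"]) auto
    also have "\<dots> \<le> frob N x ^ m" by (rule sum_hpow_row_le[OF that])
    also have "\<dots> = (sqrt (frob N x) ^ m)^2"
    proof -
      have "(sqrt (frob N x) ^ m)^2 = (sqrt (frob N x) ^ 2) ^ m"
        by (simp only: power_mult[symmetric] mult.commute)
      thus ?thesis using frob_ge_1[of N x] by simp
    qed
    finally show ?thesis by (rule power2_le_imp_le) (use frob_ge_1[of N x] in simp)
  qed
  hence "cmod (htr N x m) \<le> (\<Sum>i<N. sqrt (frob N x) ^ m)"
    unfolding htr_def by (intro order_trans[OF norm_sum] sum_mono) auto
  thus ?thesis by simp
qed

lemma cmod_htrs_le: "cmod (htrs N x ms) \<le> real N ^ length ms * sqrt (frob N x) ^ sum_list ms"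
proof (induction ms)
  case (Cons m ms)
  have "cmod (htrs N x (m # ms)) \<le> (real N * sqrt (frob N x) ^ m) * (real N ^ length ms * sqrt (frob N x) ^ sum_list ms)"
    using Cons cmod_htr_le[of N x m] frob_ge_1[of N x] by (simp add: norm_mult mult_mono)
  thus ?case by (simp add: power_add mult_ac)
qed simp

lemma cmod_htrs_le':
  assumes "sum_list ms \<le> 2 * h"
  shows "cmod (htrs N x ms) \<le> real N ^ length ms * frob N x ^ h"
proof -
  have "sqrt (frob N x) ^ sum_list ms \<le> sqrt (frob N x) ^ (2 * h)"
    using assms frob_ge_1[of N x] by (intro power_increasing) auto
  also have "\<dots> = frob N x ^ h" using frob_ge_1[of N x] by (simp add: power_mult)
  finally show ?thesis using cmod_htrs_le[of N x ms] by (meson mult_left_mono order_trans zero_le_power of_nat_0_le_iff)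
qed

subsection \<open>Integration by parts with a cutoff\<close>

definition weight :: "nat \<Rightarrow> real \<Rightarrow> (nat \<times> nat \<Rightarrow> real) \<Rightarrow> complex" where
  "weight N b x = complex_of_real (detw N x powr (- b))"

text \<open>A rational cutoff: it tends to 1 pointwise as e tends to 0, decays like a prescribed
  power of \<open>frob\<close>, and has a gradient of the same type.\<close>

definition cutoff :: "nat \<Rightarrow> real \<Rightarrow> nat \<Rightarrow> (nat \<times> nat \<Rightarrow> real) \<Rightarrow> complex" where
  "cutoff N e p x = inverse (1 + complex_of_real e * complex_of_real (frob N x)) ^ p"

lemma measurable_complex_of_real:
  assumes "f \<in> borel_measurable M"
  shows "(\<lambda>x. complex_of_real (f x)) \<in> borel_measurable M"
  by (rule measurable_compose[OF assms]) (intro borel_measurable_continuous_onI continuous_intros)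

lemma measurable_weight [measurable]: "weight N b \<in> borel_measurable (coord_measure N)"
  unfolding weight_def[abs_def] by (intro measurable_complex_of_real) measurable

lemma measurable_cutoff [measurable]: "cutoff N e p \<in> borel_measurable (coord_measure N)"
proof -
  have "(\<lambda>x. complex_of_real (frob N x)) \<in> borel_measurable (coord_measure N)"
    by (intro measurable_complex_of_real measurable_frob)
  thus ?thesis unfolding cutoff_def[abs_def] by measurable
qed

lemma cmod_weight: "cmod (weight N b x) = detw N x powr (- b)"
  by (simp add: weight_def)

lemma cmod_cutoff:
  assumes "e > 0" shows "cmod (cutoff N e p x) = 1 / (1 + e * frob N x) ^ p"
proof -
  have "1 + e * frob N x > 0" using assms frob_ge_1[of N x] by (simp add: add_pos_nonneg)
  hence "cmod (1 + complex_of_real e * complex_of_real (frob N x)) = 1 + e * frob N x"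
    by (metis abs_of_pos norm_of_real of_real_1 of_real_add of_real_mult)
  thus ?thesis by (simp add: cutoff_def norm_power norm_inverse divide_inverse power_inverse)
qed

lemma integrable_weight:
  assumes b: "2 * b > 2 * real h + 2 * real N - 1"
    and f: "f \<in> borel_measurable (coord_measure N)" "\<And>x. cmod (f x) \<le> C * frob N x ^ h"
  shows "integrable (coord_measure N) (\<lambda>x. f x * weight N b x)"
proof -
  have "integrable (coord_measure N) (\<lambda>x. frob N x ^ h * detw N x powr (- b))"
    unfolding integrable_iff_bounded
  proof
    have "(\<integral>\<^sup>+x. ennreal (norm (frob N x ^ h * detw N x powr (- b))) \<partial>coord_measure N) =
        (\<integral>\<^sup>+x. ennreal (frob N x ^ h * detw N x powr (- b)) \<partial>coord_measure N)"
    proof (intro nn_integral_cong arg_cong[of _ _ ennreal])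
      fix x
      have "frob N x ^ h * detw N x powr (- b) \<ge> 0" using frob_ge_1[of N x] by simp
      thus "norm (frob N x ^ h * detw N x powr (- b)) = frob N x ^ h * detw N x powr (- b)"
        by (simp only: real_norm_def abs_of_nonneg)
    qed
    thus "(\<integral>\<^sup>+x. ennreal (norm (frob N x ^ h * detw N x powr (- b))) \<partial>coord_measure N) < \<infinity>"
      using nn_integral_frob_detw_finite[OF b] by simp
  qed measurable
  hence "integrable (coord_measure N) (\<lambda>x. C * (frob N x ^ h * detw N x powr (- b)))" by simp
  thus ?thesis
  proof (rule Bochner_Integration.integrable_bound)
    show "(\<lambda>x. f x * weight N b x) \<in> borel_measurable (coord_measure N)" using f(1) by measurable
    show "AE x in coord_measure N. norm (f x * weight N b x) \<le> norm (C * (frob N x ^ h * detw N x powr (- b)))"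
    proof (rule AE_I2)
      fix x
      have "norm (f x * weight N b x) \<le> (C * frob N x ^ h) * detw N x powr (- b)"
        unfolding norm_mult cmod_weight using f(2) by (intro mult_right_mono) auto
      thus "norm (f x * weight N b x) \<le> norm (C * (frob N x ^ h * detw N x powr (- b)))"
        by (simp add: mult.assoc)
    qed
  qed
qed

text \<open>Since e \<open>frob\<close> / (1 + e \<open>frob\<close>) is at most 1, the power p = n
  already reduces growth \<open>frob^n\<close> to the constant e^(-n). The admissible p depend only
  on f, not on e. The bounded multiplier \<open>g\<close> leaves room for the extra cutoff factor
  that differentiation produces.\<close>

lemma integrable_cutoff:
  assumes b: "2 * b > 2 * real N - 1" and f: "polybounded N f"
  shows "\<forall>\<^sub>F p in sequentially. \<forall>e>0. \<forall>g \<in> borel_measurable (coord_measure N). (\<forall>x. cmod (g x) \<le> 1) \<longrightarrow>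
     integrable (coord_measure N) (\<lambda>x. f x * g x * (weight N b x * cutoff N e p x))"
proof -
  obtain C n where C: "C \<ge> 0" "\<And>x. cmod (f x) \<le> C * frob N x ^ n" by (rule polyboundedE[OF f]) blast
  show ?thesis using eventually_ge_at_top[of n]
  proof eventually_elim
    case (elim p)
    show ?case
    proof (intro allI ballI impI)
      fix e :: real and g assume e: "e > 0" and g: "g \<in> borel_measurable (coord_measure N)" "\<forall>x. cmod (g x) \<le> 1"
      have fm: "f \<in> borel_measurable (coord_measure N)" by (rule polybounded_measurable[OF f])
      have "integrable (coord_measure N) (\<lambda>x. (f x * g x * cutoff N e p x) * weight N b x)"
      proof (rule integrable_weight[where h = 0 and C = "C / e ^ n"])
        fix x
        have pos: "1 + e * frob N x \<ge> 1" using e frob_ge_1[of N x] by simp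
        have "cmod (f x * g x * cutoff N e p x) \<le> (C * frob N x ^ n) * 1 * (1 / (1 + e * frob N x) ^ n)"
          unfolding norm_mult cmod_cutoff[OF e]
          using C g(2) frob_ge_1[of N x] pos elim
          by (intro mult_mono divide_left_mono power_increasing mult_nonneg_nonneg) auto
        also have "\<dots> = C / e ^ n * (e * frob N x / (1 + e * frob N x)) ^ n"
          using e by (simp add: power_divide power_mult_distrib)
        also have "\<dots> \<le> C / e ^ n * 1"
        proof (intro mult_left_mono power_le_one)
          show "e * frob N x / (1 + e * frob N x) \<le> 1" using pos by (subst divide_le_eq_1_pos) auto
          show "0 \<le> e * frob N x / (1 + e * frob N x)"
            using e frob_ge_1[of N x] by (intro divide_nonneg_nonneg) auto
        qed (use e C(1) in auto)
        finally show "cmod (f x * g x * cutoff N e p x) \<le> C / e ^ n * frob N x ^ 0" by simp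
      qed (use b g fm in \<open>auto intro!: borel_measurable_times\<close>)
      thus "integrable (coord_measure N) (\<lambda>x. f x * g x * (weight N b x * cutoff N e p x))"
        by (simp add: mult_ac)
    qed
  qed
qed

lemma hasgrad_weight:
  "hasgrad N (weight N b) x (\<lambda>i j. weight N b x * (- complex_of_real b / complex_of_real (detw N x) * detw_grad N x i j))"
proof -
  have d: "detw N x > 0" using detw_ge_1[of N x] by simp
  \<comment> \<open>\<open>hasgrad_chain\<close> expects a complex derivative, so the real power is
    rewritten as a complex one; the branch cut is avoided because \<open>detw\<close> is
    positive.\<close>
  have w: "weight N b x = complex_of_real (detw N x) powr (- complex_of_real b)" for x
    using detw_ge_1[of N x] powr_of_real[of "detw N x" "- b"] by (simp add: weight_def)
  have "((\<lambda>z. z powr (- complex_of_real b)) has_field_derivative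
      - complex_of_real b * complex_of_real (detw N x) powr (- complex_of_real b - 1)) (at (complex_of_real (detw N x)))"
    using d by (intro has_field_derivative_powr) (auto simp: complex_nonpos_Reals_iff)
  from hasgrad_chain[OF hasgrad_detw this]
  have "hasgrad N (\<lambda>x. complex_of_real (detw N x) powr (- complex_of_real b)) x
     (\<lambda>i j. - complex_of_real b * complex_of_real (detw N x) powr (- complex_of_real b - 1) * detw_grad N x i j)" .
  moreover have "complex_of_real (detw N x) powr (- complex_of_real b - 1) = weight N b x / complex_of_real (detw N x)"
    using d by (simp add: w powr_diff)
  ultimately show ?thesis unfolding w[abs_def, symmetric] w[symmetric] by (simp add: mult_ac)
qed

lemma hasgrad_frob: "hasgrad N (\<lambda>x. complex_of_real (frob N x)) x (\<lambda>i j. 2 * hpow N x 1 j i)"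
proof -
  have e: "complex_of_real (frob N x) = 1 + htr N x 2" for x
  proof -
    have "htr N x 2 = (\<Sum>i<N. \<Sum>j<N. hpow N x (Suc 0) i j * hpow N x (Suc 0) j i)"
      unfolding sum_hpow_trace by (simp add: numeral_2_eq_2)
    also have "\<dots> = (\<Sum>i<N. \<Sum>j<N. herm_entry x i j * cnj (herm_entry x i j))"
      by (intro sum.cong refl) (simp only: hpow_1 lessThan_iff herm_entry_cnj)
    also have "\<dots> = (\<Sum>i<N. \<Sum>j<N. complex_of_real (cmod (herm_entry x i j) ^ 2))"
      by (simp only: complex_norm_square)
    finally show ?thesis by (simp add: frob_def)
  qed
  show ?thesis unfolding e using hasgrad_add[OF hasgrad_const[where N = N and a = 1 and x = x] hasgrad_htr[where N = N and x = x and m = 2]] by simp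
qed

text \<open>In logarithmic form: the cutoff is kept as a factor, so that weight times cutoff can be
  pulled out of the whole divergence. The remainder has the factor e and one additional
  cutoff.\<close>

lemma hasgrad_cutoff:
  assumes "e > 0"
  shows "hasgrad N (cutoff N e (Suc p)) x
    (\<lambda>i j. cutoff N e (Suc p) x * (- 2 * of_nat (Suc p) * complex_of_real e * hpow N x 1 j i * cutoff N e 1 x))"
proof -
  define z where "z = 1 + complex_of_real e * complex_of_real (frob N x)"
  have "1 + e * frob N x > 0" using assms frob_ge_1[of N x] by (simp add: add_pos_nonneg)
  hence "complex_of_real (1 + e * frob N x) \<noteq> 0" by (simp only: of_real_eq_0_iff)
  hence z: "z \<noteq> 0" by (simp add: z_def)
  have "((\<lambda>f. inverse (1 + complex_of_real e * f) ^ Suc p) has_field_derivative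
     (- (of_nat (Suc p) * complex_of_real e * inverse z ^ Suc (Suc p)))) (at (complex_of_real (frob N x)))"
  proof -
    have "((\<lambda>f. 1 + complex_of_real e * f) has_field_derivative complex_of_real e) (at (complex_of_real (frob N x)))"
      by (auto intro!: derivative_eq_intros)
    from DERIV_power_Suc[OF DERIV_inverse'[OF this], of p] z
    show ?thesis by (simp add: z_def mult_ac)
  qed
  from hasgrad_chain[OF hasgrad_frob this]
  have "hasgrad N (cutoff N e (Suc p)) x
    (\<lambda>i j. - (of_nat (Suc p) * complex_of_real e * inverse z ^ Suc (Suc p)) * (2 * hpow N x 1 j i))"
    unfolding cutoff_def[abs_def] .
  thus ?thesis
    by (rule hasgrad_cong) (simp add: cutoff_def z_def[symmetric] mult_ac del: hpow.simps of_nat_Suc)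
qed


section \<open>The divergence of the matrix field and its integral with a cutoff\<close>

definition moment :: "nat \<Rightarrow> real \<Rightarrow> nat list \<Rightarrow> complex" where
  "moment N b ms = (\<integral>x. htrs N x ms * weight N b x \<partial>coord_measure N)"

lemma integrable_htrs_weight:
  assumes "2 * b > 2 * real h + 2 * real N - 1" "sum_list ms \<le> 2 * h"
  shows "integrable (coord_measure N) (\<lambda>x. htrs N x ms * weight N b x)"
  by (rule integrable_weight[OF assms(1) polybounded_measurable[OF polybounded_htrs] cmod_htrs_le'[OF assms(2)]])

text \<open>\<open>loop_integrand\<close> is the divergence, with respect to the Cauchy weight, of the matrix field
  \<open>H\<^sup>j (1 + H\<^sup>2) Tr H\<^bsup>m\<^sub>1\<^esup> Tr H\<^bsup>m\<^sub>2\<^esup> \<cdots>\<close>. The factor \<open>1 + H\<^sup>2\<close> cancels the inverse that arises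
  from differentiating the weight.\<close>

definition loop_integrand :: "nat \<Rightarrow> real \<Rightarrow> nat \<Rightarrow> nat list \<Rightarrow> (nat \<times> nat \<Rightarrow> real) \<Rightarrow> complex" where
  "loop_integrand N b j ms x =
     (\<Sum>a<j. htrs N x (a # (j - 1 - a) # ms)) + (\<Sum>a<j + 2. htrs N x (a # (j + 1 - a) # ms))
     + (\<Sum>(c, ns)\<leftarrow>joins (\<lambda>m. j + (m - 1)) ms. of_nat c * htrs N x ns)
     + (\<Sum>(c, ns)\<leftarrow>joins (\<lambda>m. j + 2 + (m - 1)) ms. of_nat c * htrs N x ns)
     - 2 * complex_of_real b * htrs N x ((j + 1) # ms)"

context
  fixes N j :: nat and b :: real and ms :: "nat list"
begin

definition loop_field :: "nat \<Rightarrow> nat \<Rightarrow> (nat \<times> nat \<Rightarrow> real) \<Rightarrow> complex" where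
  "loop_field i k x = (hpow N x j i k + hpow N x (j + 2) i k) * htrs N x ms"

definition loop_field_grad :: "nat \<Rightarrow> nat \<Rightarrow> (nat \<times> nat \<Rightarrow> real) \<Rightarrow> nat \<Rightarrow> nat \<Rightarrow> complex" where
  "loop_field_grad i k x i' k' =
     (hpow N x j i k + hpow N x (j + 2) i k) * htrs_grad N x ms i' k' +
     ((\<Sum>a<j. hpow N x a i i' * hpow N x (j - 1 - a) k' k) +
      (\<Sum>a<j + 2. hpow N x a i i' * hpow N x (j + 2 - 1 - a) k' k)) * htrs N x ms"

definition log_weight_grad :: "(nat \<times> nat \<Rightarrow> real) \<Rightarrow> nat \<Rightarrow> nat \<Rightarrow> complex" where
  "log_weight_grad x i k = - complex_of_real b / complex_of_real (detw N x) * detw_grad N x i k"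

lemma hasgrad_loop_field:
  "i < N \<Longrightarrow> k < N \<Longrightarrow> hasgrad N (loop_field i k) x (loop_field_grad i k x)"
  unfolding loop_field_def[abs_def] loop_field_grad_def[abs_def]
  by (intro hasgrad_mult hasgrad_add hasgrad_hpow hasgrad_htrs)

text \<open>Entry (i, k) of the field is differentiated in the same entry of H, so each Leibniz term
  H^a dH H^c decouples into Tr H^a Tr H^c. The trace factors contribute the joins, and in the weight
  term the determinant from \<open>sum_hpow_detw_grad\<close> cancels the denominator.\<close>

lemma sum_loop_divergence:
  "(\<Sum>i<N. \<Sum>k<N. loop_field_grad i k x i k + loop_field i k x * log_weight_grad x i k) = loop_integrand N b j ms x"
proof -
  have tr: "(\<Sum>i<N. \<Sum>k<N. \<Sum>a<m. hpow N x a i i * hpow N x (m - 1 - a) k k) = (\<Sum>a<m. htr N x a * htr N x (m - 1 - a))" for m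
  proof -
    have "(\<Sum>i<N. \<Sum>k<N. \<Sum>a<m. hpow N x a i i * hpow N x (m - 1 - a) k k) =
        (\<Sum>i<N. \<Sum>a<m. \<Sum>k<N. hpow N x a i i * hpow N x (m - 1 - a) k k)"
      by (rule sum.cong[OF refl], rule sum.swap)
    also have "\<dots> = (\<Sum>a<m. \<Sum>i<N. \<Sum>k<N. hpow N x a i i * hpow N x (m - 1 - a) k k)" by (rule sum.swap)
    also have "\<dots> = (\<Sum>a<m. htr N x a * htr N x (m - 1 - a))" unfolding htr_def sum_product ..
    finally show ?thesis .
  qed
  have d: "complex_of_real (detw N x) \<noteq> 0" using detw_ge_1[of N x] by auto
  have "(\<Sum>i<N. \<Sum>k<N. loop_field_grad i k x i k + loop_field i k x * log_weight_grad x i k) =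
    (\<Sum>i<N. \<Sum>k<N. hpow N x j i k * htrs_grad N x ms i k) + (\<Sum>i<N. \<Sum>k<N. hpow N x (j + 2) i k * htrs_grad N x ms i k)
    + ((\<Sum>i<N. \<Sum>k<N. \<Sum>a<j. hpow N x a i i * hpow N x (j - 1 - a) k k) +
       (\<Sum>i<N. \<Sum>k<N. \<Sum>a<j + 2. hpow N x a i i * hpow N x (j + 2 - 1 - a) k k)) * htrs N x ms
    + - complex_of_real b / complex_of_real (detw N x) * htrs N x ms *
       (\<Sum>i<N. \<Sum>k<N. (hpow N x j i k + hpow N x (j + 2) i k) * detw_grad N x i k)"
    unfolding sum_distrib_left sum_distrib_right distrib_right sum.distrib[symmetric]
    by (intro sum.cong refl)
       (simp add: loop_field_grad_def loop_field_def log_weight_grad_def sum_distrib_right sum_distrib_left algebra_simps del: hpow.simps)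
  also have "\<dots> = loop_integrand N b j ms x"
    unfolding sum_hpow_htrs_grad tr sum_hpow_detw_grad loop_integrand_def using d
    by (simp add: sum_distrib_right sum_distrib_left algebra_simps del: hpow.simps)
  finally show ?thesis .
qed

text \<open>The pairing of the field with the gradient of \<open>frob\<close>, up to a factor 2:
  this is the error caused by differentiating the cutoff. Its second term exceeds the degree of the
  divergence by two.\<close>

lemma sum_loop_field_herm:
  "(\<Sum>i<N. \<Sum>k<N. loop_field i k x * hpow N x 1 k i) = htrs N x ((j + 1) # ms) + htrs N x ((j + 3) # ms)"
proof -
  have "(\<Sum>i<N. \<Sum>k<N. loop_field i k x * hpow N x 1 k i) =
    ((\<Sum>i<N. \<Sum>k<N. hpow N x j i k * hpow N x 1 k i) + (\<Sum>i<N. \<Sum>k<N. hpow N x (j + 2) i k * hpow N x 1 k i)) * htrs N x ms"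
    unfolding loop_field_def sum_distrib_right sum.distrib[symmetric]
    by (intro sum.cong refl) (simp add: algebra_simps del: hpow.simps)
  also have "\<dots> = (htr N x (j + 1) + htr N x (j + 2 + 1)) * htrs N x ms" unfolding sum_hpow_trace ..
  finally show ?thesis by (simp add: algebra_simps eval_nat_numeral)
qed

text \<open>The power of the cutoff is fixed before e: only finitely many entries of the field and
  its gradient occur, so one power makes all of them integrable for every e > 0. This allows e to
  tend to 0 afterwards.\<close>

lemma integral_loop_cutoff:
  assumes b: "2 * b > 2 * real N - 1"
  shows "\<exists>p. \<forall>e>0. (\<integral>x. weight N b x * cutoff N e (Suc p) x * (loop_integrand N b j ms x
     - 2 * of_nat (Suc p) * complex_of_real e * (htrs N x ((j + 1) # ms) + htrs N x ((j + 3) # ms)) * cutoff N e 1 x)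
      \<partial>coord_measure N) = 0"
proof -
  define ok where "ok f p \<longleftrightarrow> (\<forall>e>0. \<forall>g \<in> borel_measurable (coord_measure N). (\<forall>x. cmod (g x) \<le> 1) \<longrightarrow>
     integrable (coord_measure N) (\<lambda>x. f x * g x * (weight N b x * cutoff N e p x)))" for f p
  define P where "P p i k i' k' \<longleftrightarrow> ok (loop_field i k) p \<and> ok (\<lambda>x. loop_field_grad i k x i' k') p \<and>
     ok (\<lambda>x. loop_field i k x * log_weight_grad x i' k') p \<and> ok (\<lambda>x. loop_field i k x * hpow N x 1 k' i') p" for p i k i' k'
  have okI: "\<forall>\<^sub>F p in sequentially. ok f p" if "polybounded N f" for f
    unfolding ok_def by (rule integrable_cutoff[OF b that])
  have pf: "polybounded N (loop_field i k)" if "i < N" "k < N" for i k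
    unfolding loop_field_def[abs_def]
    by (intro polybounded_mult polybounded_add polybounded_hpow polybounded_htrs that)
  have pg: "polybounded N (\<lambda>x. loop_field_grad i k x i' k')" if "i < N" "k < N" "i' < N" "k' < N" for i k i' k'
    unfolding loop_field_grad_def
    by (intro polybounded_mult polybounded_add polybounded_sum polybounded_hpow polybounded_htrs polybounded_htrs_grad that) auto
  have pinv: "polybounded N (\<lambda>x. inverse (complex_of_real (detw N x)))"
  proof (rule polyboundedI[where C = 1 and n = 0])
    show "(\<lambda>x. inverse (complex_of_real (detw N x))) \<in> borel_measurable (coord_measure N)"
      by (intro borel_measurable_inverse measurable_complex_of_real measurable_detw)
    show "cmod (inverse (complex_of_real (detw N x))) \<le> 1 * frob N x ^ 0" for x
      using detw_ge_1[of N x] by (simp add: norm_inverse inverse_le_1_iff)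
  qed
  have pw: "polybounded N (\<lambda>x. log_weight_grad x i k)" if "i < N" "k < N" for i k
    unfolding log_weight_grad_def divide_inverse
    by (intro polybounded_mult polybounded_const pinv polybounded_detw_grad that)
  have "\<forall>\<^sub>F p in sequentially. \<forall>i\<in>{..<N}. \<forall>k\<in>{..<N}. \<forall>i'\<in>{..<N}. \<forall>k'\<in>{..<N}. P p i k i' k'"
    unfolding P_def
    by (intro eventually_ball_finite ballI finite_lessThan eventually_conj okI pf pg polybounded_mult pw polybounded_hpow) auto
  then obtain p0 where p0: "\<And>p. p \<ge> p0 \<Longrightarrow> \<forall>i\<in>{..<N}. \<forall>k\<in>{..<N}. \<forall>i'\<in>{..<N}. \<forall>k'\<in>{..<N}. P p i k i' k'"
    by (auto simp: eventually_sequentially)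
  define p where "p = Suc p0"
  have P: "P p i k i' k'" if "i < N" "k < N" "i' < N" "k' < N" for i k i' k'
    using p0[of p] that by (simp add: p_def)
  show ?thesis
  proof (intro exI[of _ p0] allI impI)
    fix e :: real assume e: "e > 0"
    define W where "W x = weight N b x * cutoff N e p x" for x
    define q where "q = 2 * complex_of_nat p * complex_of_real e"
    have int: "integrable (coord_measure N) (\<lambda>x. f x * g x * W x)"
      if "ok f p" "g \<in> borel_measurable (coord_measure N)" "\<And>x. cmod (g x) \<le> 1" for f g
      using that e unfolding ok_def W_def by blast
    have int1: "integrable (coord_measure N) (\<lambda>x. f x * W x)" if "ok f p" for f
      using int[OF that, of "\<lambda>_. 1"] by simp
    have cut1: "cmod (cutoff N e 1 x) \<le> 1" for x
      unfolding cmod_cutoff[OF e] using e frob_ge_1[of N x] by (simp add: divide_le_eq_1_pos add_pos_nonneg)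
    define L where "L i k x i' k' = loop_field_grad i k x i' k' * W x + loop_field i k x * log_weight_grad x i' k' * W x
        - q * (loop_field i k x * hpow N x 1 k' i' * cutoff N e 1 x * W x)" for i k x i' k'
    have L_int: "integrable (coord_measure N) (\<lambda>x. L i k x i' k')" if "i < N" "k < N" "i' < N" "k' < N" for i k i' k'
    proof -
      have o: "ok (\<lambda>x. loop_field_grad i k x i' k') p" "ok (\<lambda>x. loop_field i k x * log_weight_grad x i' k') p"
        "ok (\<lambda>x. loop_field i k x * hpow N x 1 k' i') p"
        using P[OF that] unfolding P_def by blast+
      show ?thesis unfolding L_def
        by (intro Bochner_Integration.integrable_diff Bochner_Integration.integrable_add integrable_mult_right
            int1[OF o(1)] int1[OF o(2)] int[OF o(3) measurable_cutoff cut1])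
    qed
    have L_grad: "hasgrad N (\<lambda>x. loop_field i k x * (weight N b x * cutoff N e p x)) x (L i k x)" if "i < N" "k < N" for i k x
    proof -
      have "hasgrad N (\<lambda>x. loop_field i k x * (weight N b x * cutoff N e p x)) x
        (\<lambda>i' k'. loop_field i k x * (weight N b x * (cutoff N e p x * (- 2 * of_nat p * complex_of_real e * hpow N x 1 k' i' * cutoff N e 1 x))
           + weight N b x * (- complex_of_real b / complex_of_real (detw N x) * detw_grad N x i' k') * cutoff N e p x)
          + loop_field_grad i k x i' k' * (weight N b x * cutoff N e p x))"
        unfolding p_def by (intro hasgrad_mult hasgrad_loop_field hasgrad_weight hasgrad_cutoff e that)
      thus ?thesis
        by (rule hasgrad_cong) (simp add: L_def W_def q_def log_weight_grad_def algebra_simps del: hpow.simps)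
    qed
    have "(\<integral>x. L i k x i k \<partial>coord_measure N) = 0" if "i < N" "k < N" for i k
    proof (rule integral_grad_eq_0[OF L_grad[OF that] _ L_int[OF that] that])
      show "integrable (coord_measure N) (\<lambda>x. loop_field i k x * (weight N b x * cutoff N e p x))"
        using int1[of "loop_field i k"] P[OF that that] unfolding P_def W_def by blast
    qed
    hence "0 = (\<Sum>i<N. \<Sum>k<N. \<integral>x. L i k x i k \<partial>coord_measure N)" by simp
    also have "\<dots> = (\<integral>x. (\<Sum>i<N. \<Sum>k<N. L i k x i k) \<partial>coord_measure N)"
      using L_int by (subst Bochner_Integration.integral_sum; (intro sum.cong refl Bochner_Integration.integrable_sum)?)
        (auto simp: Bochner_Integration.integral_sum)
    also have "(\<lambda>x. \<Sum>i<N. \<Sum>k<N. L i k x i k) = (\<lambda>x. W x * (loop_integrand N b j ms x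
       - q * (htrs N x ((j + 1) # ms) + htrs N x ((j + 3) # ms)) * cutoff N e 1 x))"
    proof
      fix x
      have "(\<Sum>i<N. \<Sum>k<N. L i k x i k) =
         W x * (\<Sum>i<N. \<Sum>k<N. loop_field_grad i k x i k + loop_field i k x * log_weight_grad x i k)
         - W x * q * cutoff N e 1 x * (\<Sum>i<N. \<Sum>k<N. loop_field i k x * hpow N x 1 k i)"
        unfolding L_def sum_distrib_left sum_subtractf[symmetric]
        by (intro sum.cong refl) (simp add: algebra_simps del: hpow.simps)
      thus "(\<Sum>i<N. \<Sum>k<N. L i k x i k) = W x * (loop_integrand N b j ms x
       - q * (htrs N x ((j + 1) # ms) + htrs N x ((j + 3) # ms)) * cutoff N e 1 x)"
        unfolding sum_loop_divergence sum_loop_field_herm by (simp only: right_diff_distrib mult_ac)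
    qed
    finally show "(\<integral>x. weight N b x * cutoff N e (Suc p0) x * (loop_integrand N b j ms x
     - 2 * of_nat (Suc p0) * complex_of_real e * (htrs N x ((j + 1) # ms) + htrs N x ((j + 3) # ms)) * cutoff N e 1 x)
      \<partial>coord_measure N) = 0"
      by (simp only: W_def q_def p_def)
  qed
qed

end

text \<open>The change of degree is stated with a summand on both sides (\<open>u\<close> and
  \<open>t\<close>) so that it also covers a decrease without subtraction. Positivity of the entries
  rules out truncation in \<open>m - 1\<close>.\<close>

lemma sum_list_joins:
  assumes "(c, ns) \<in> set (joins f ms)" "0 \<notin> set ms" "\<And>m. m > 0 \<Longrightarrow> f m + u = m + t"
  shows "sum_list ns + u = sum_list ms + t"
  using assms(1,2)
proof (induction ms arbitrary: c ns)
  case (Cons m ms)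
  show ?case
  proof (cases "(c, ns) = (m, f m # ms)")
    case True
    thus ?thesis using assms(3)[of m] Cons.prems by auto
  next
    case False
    then obtain ns' where "(c, ns') \<in> set (joins f ms)" "ns = m # ns'" using Cons.prems by auto
    thus ?thesis using Cons.IH[of c ns'] Cons.prems by auto
  qed
qed simp

section \<open>Removal of the cutoff\<close>

context
  fixes N h :: nat
begin

text \<open>The sharp counterpart of \<open>polybounded\<close>: the exponent is the fixed
  \<open>h\<close> for which integrability against the weight is known.\<close>

definition frob_bounded :: "((nat \<times> nat \<Rightarrow> real) \<Rightarrow> complex) \<Rightarrow> bool" where
  "frob_bounded f \<longleftrightarrow> (\<exists>C. \<forall>x. cmod (f x) \<le> C * frob N x ^ h)"

lemma frob_bounded_add: "frob_bounded f \<Longrightarrow> frob_bounded g \<Longrightarrow> frob_bounded (\<lambda>x. f x + g x)"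
proof -
  assume "frob_bounded f" "frob_bounded g"
  then obtain C D where C: "\<And>x. cmod (f x) \<le> C * frob N x ^ h" and D: "\<And>x. cmod (g x) \<le> D * frob N x ^ h"
    unfolding frob_bounded_def by blast
  have "cmod (f x + g x) \<le> (C + D) * frob N x ^ h" for x
    using C[of x] D[of x] norm_triangle_ineq[of "f x" "g x"] by (simp add: distrib_right)
  thus ?thesis unfolding frob_bounded_def by blast
qed

lemma frob_bounded_cmult: "frob_bounded f \<Longrightarrow> frob_bounded (\<lambda>x. a * f x)"
proof -
  assume "frob_bounded f"
  then obtain C where C: "\<And>x. cmod (f x) \<le> C * frob N x ^ h" unfolding frob_bounded_def by blast
  have "cmod (a * f x) \<le> (cmod a * C) * frob N x ^ h" for x
    using mult_left_mono[OF C[of x], of "cmod a"] by (simp add: norm_mult mult.assoc)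
  thus ?thesis unfolding frob_bounded_def by blast
qed

lemma frob_bounded_zero: "frob_bounded (\<lambda>x. 0)"
  unfolding frob_bounded_def by (intro exI[of _ 0]) simp

lemma frob_bounded_sum:
  "finite A \<Longrightarrow> (\<And>a. a \<in> A \<Longrightarrow> frob_bounded (f a)) \<Longrightarrow> frob_bounded (\<lambda>x. \<Sum>a\<in>A. f a x)"
  by (induction rule: finite_induct) (auto intro: frob_bounded_zero frob_bounded_add)

lemma frob_bounded_htrs: "sum_list ms \<le> 2 * h \<Longrightarrow> frob_bounded (\<lambda>x. htrs N x ms)"
  unfolding frob_bounded_def using cmod_htrs_le' by blast

lemma frob_bounded_sum_list:
  "(\<And>c ns. (c, ns) \<in> set xs \<Longrightarrow> sum_list ns \<le> 2 * h) \<Longrightarrow>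
    frob_bounded (\<lambda>x. \<Sum>(c, ns)\<leftarrow>xs. of_nat c * htrs N x ns)"
proof (induction xs)
  case (Cons p xs)
  obtain c ns where p: "p = (c, ns)" by force
  have "frob_bounded (\<lambda>x. of_nat c * htrs N x ns + (\<Sum>(c, ns)\<leftarrow>xs. of_nat c * htrs N x ns))"
    using Cons p by (intro frob_bounded_add frob_bounded_cmult frob_bounded_htrs Cons.IH) auto
  thus ?case by (simp add: p)
qed (simp add: frob_bounded_zero)

context
  fixes j :: nat and ms :: "nat list"
  assumes deg: "j + 1 + sum_list ms = 2 * h" and pos: "0 \<notin> set ms"
begin

lemma sum_list_joins_lower: "(c, ns) \<in> set (joins (\<lambda>m. j + (m - 1)) ms) \<Longrightarrow> sum_list ns + 2 = 2 * h"
  using sum_list_joins[of c ns "\<lambda>m. j + (m - 1)" ms 1 j] pos deg by fastforce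

lemma sum_list_joins_top: "(c, ns) \<in> set (joins (\<lambda>m. j + 2 + (m - 1)) ms) \<Longrightarrow> sum_list ns = 2 * h"
  using sum_list_joins[of c ns "\<lambda>m. j + 2 + (m - 1)" ms 0 "j + 1"] pos deg by fastforce

lemma sum_list_joins_le:
  "(c, ns) \<in> set (joins (\<lambda>m. j + (m - 1)) ms) \<Longrightarrow> sum_list ns \<le> 2 * h"
  "(c, ns) \<in> set (joins (\<lambda>m. j + 2 + (m - 1)) ms) \<Longrightarrow> sum_list ns \<le> 2 * h"
  using sum_list_joins_lower[of c ns] sum_list_joins_top[of c ns] by linarith+

lemma frob_bounded_loop_integrand: "frob_bounded (loop_integrand N b j ms)"
proof -
  have "frob_bounded (\<lambda>x. loop_integrand N b j ms x)"
    unfolding loop_integrand_def diff_conv_add_uminus minus_mult_left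
    by (intro frob_bounded_add frob_bounded_sum
        frob_bounded_sum_list[OF sum_list_joins_le(1)] frob_bounded_sum_list[OF sum_list_joins_le(2)]
        frob_bounded_cmult frob_bounded_htrs) (use deg in auto)
  thus ?thesis .
qed

text \<open>Dominated convergence with e = 1 / (n + 1). The divergence has degree 2h and is bounded
  by \<open>frob^h\<close>. The error term has degree 2h + 2 but comes with e and a cutoff factor,
  so it obeys the same bound and tends to 0 pointwise.\<close>

lemma integral_loop_integrand:
  assumes b: "2 * b > 2 * real h + 2 * real N - 1"
  shows "(\<integral>x. weight N b x * loop_integrand N b j ms x \<partial>coord_measure N) = 0"
proof -
  obtain p where p: "\<And>e. e > 0 \<Longrightarrow> (\<integral>x. weight N b x * cutoff N e (Suc p) x * (loop_integrand N b j ms x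
     - 2 * of_nat (Suc p) * complex_of_real e * (htrs N x ((j + 1) # ms) + htrs N x ((j + 3) # ms)) * cutoff N e 1 x)
      \<partial>coord_measure N) = 0"
    using integral_loop_cutoff[of N b j ms] b by (auto simp del: of_nat_Suc)
  define R where "R x = htrs N x ((j + 1) # ms) + htrs N x ((j + 3) # ms)" for x
  define e where "e n = inverse (real (Suc n))" for n
  have e: "e n > 0" "e n \<le> 1" for n by (auto simp: e_def inverse_le_1_iff)
  define F where "F n x = weight N b x * cutoff N (e n) (Suc p) x * (loop_integrand N b j ms x
     - 2 * of_nat (Suc p) * complex_of_real (e n) * R x * cutoff N (e n) 1 x)" for n x
  have F0: "(\<integral>x. F n x \<partial>coord_measure N) = 0" for n unfolding F_def R_def by (rule p[OF e(1)])
  obtain C where C: "\<And>x. cmod (loop_integrand N b j ms x) \<le> C * frob N x ^ h"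
    using frob_bounded_loop_integrand unfolding frob_bounded_def by blast
  define C1 where "C1 = real N ^ length ((j + 1) # ms)"
  have C1: "cmod (htrs N x ((j + 1) # ms)) \<le> C1 * frob N x ^ h" for x
    unfolding C1_def by (rule cmod_htrs_le') (use deg in simp)
  have C2: "cmod (htrs N x ((j + 3) # ms)) \<le> C1 * frob N x ^ (Suc h)" for x
  proof -
    have "cmod (htrs N x ((j + 3) # ms)) \<le> real N ^ length ((j + 3) # ms) * frob N x ^ (Suc h)"
      by (rule cmod_htrs_le') (use deg in simp)
    thus ?thesis by (simp add: C1_def)
  qed
  have C10: "C1 \<ge> 0" by (simp add: C1_def)
  have bound: "cmod (F n x) \<le> cmod ((of_real ((C + 2 * real (Suc p) * (2 * C1)) * frob N x ^ h)) * weight N b x)" for n x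
  proof -
    have pos: "1 + e n * frob N x > 0" using e(1)[of n] frob_ge_1[of N x] by (simp add: add_pos_nonneg)
    have cut: "cmod (cutoff N (e n) q x) \<le> 1" for q
    proof -
      have "1 \<le> (1 + e n * frob N x) ^ q" using e(1)[of n] frob_ge_1[of N x] by (intro one_le_power) simp
      thus ?thesis unfolding cmod_cutoff[OF e(1)] by (simp add: divide_le_eq_1)
    qed
    have "cmod (complex_of_real (e n) * R x * cutoff N (e n) 1 x) \<le>
        e n * (C1 * frob N x ^ h + C1 * frob N x ^ (Suc h)) / (1 + e n * frob N x)"
    proof -
      have "cmod (R x) \<le> C1 * frob N x ^ h + C1 * frob N x ^ (Suc h)"
        unfolding R_def by (rule order_trans[OF norm_triangle_ineq add_mono[OF C1 C2]])
      thus ?thesis unfolding norm_mult cmod_cutoff[OF e(1)] using e(1)[of n] pos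
        by (simp add: divide_right_mono mult_left_mono)
    qed
    \<comment> \<open>The key cancellation: e (1 + \<open>frob\<close>) / (1 + e
      \<open>frob\<close>) is at most 2 when e is at most 1, which removes the excess power of
      \<open>frob\<close>.\<close>
    also have "\<dots> \<le> 2 * C1 * frob N x ^ h"
    proof -
      have "e n * (C1 * frob N x ^ h + C1 * frob N x ^ (Suc h)) =
          C1 * frob N x ^ h * e n + C1 * frob N x ^ h * (e n * frob N x)" by (simp add: algebra_simps)
      also have "\<dots> \<le> C1 * frob N x ^ h * 1 + C1 * frob N x ^ h * (1 + e n * frob N x)"
        using C10 e[of n] frob_ge_1[of N x] by (intro add_mono mult_left_mono) auto
      also have "\<dots> \<le> C1 * frob N x ^ h * (1 + e n * frob N x) + C1 * frob N x ^ h * (1 + e n * frob N x)"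
        using C10 e(1)[of n] frob_ge_1[of N x] by (intro add_mono mult_left_mono) auto
      also have "\<dots> = 2 * C1 * frob N x ^ h * (1 + e n * frob N x)" by (simp add: algebra_simps)
      finally show ?thesis using pos by (simp add: divide_le_eq)
    qed
    finally have 1: "cmod (complex_of_real (e n) * R x * cutoff N (e n) 1 x) \<le> 2 * C1 * frob N x ^ h" .
    have "cmod (loop_integrand N b j ms x - 2 * of_nat (Suc p) * complex_of_real (e n) * R x * cutoff N (e n) 1 x)
        \<le> cmod (loop_integrand N b j ms x) + cmod (2 * of_nat (Suc p) * (complex_of_real (e n) * R x * cutoff N (e n) 1 x))"
      by (rule order_trans[OF norm_triangle_ineq4]) (simp add: mult.assoc)
    also have "cmod (2 * of_nat (Suc p) * (complex_of_real (e n) * R x * cutoff N (e n) 1 x)) =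
        2 * real (Suc p) * cmod (complex_of_real (e n) * R x * cutoff N (e n) 1 x)"
      by (simp only: norm_mult norm_of_nat norm_numeral)
    also have "cmod (loop_integrand N b j ms x) + \<dots> \<le> C * frob N x ^ h + 2 * real (Suc p) * (2 * C1 * frob N x ^ h)"
      using C[of x] 1 by (intro add_mono mult_left_mono) auto
    also have "\<dots> = (C + 2 * real (Suc p) * (2 * C1)) * frob N x ^ h" by (simp add: algebra_simps)
    finally have 2: "cmod (loop_integrand N b j ms x - 2 * of_nat (Suc p) * complex_of_real (e n) * R x * cutoff N (e n) 1 x)
        \<le> (C + 2 * real (Suc p) * (2 * C1)) * frob N x ^ h" .
    have "cmod (F n x) \<le> cmod (weight N b x) * 1 * ((C + 2 * real (Suc p) * (2 * C1)) * frob N x ^ h)"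
      unfolding F_def norm_mult using cut 2 unfolding norm_mult by (intro mult_mono) auto
    also have "\<dots> \<le> cmod (weight N b x) * 1 * \<bar>(C + 2 * real (Suc p) * (2 * C1)) * frob N x ^ h\<bar>"
      by (intro mult_left_mono) auto
    finally show ?thesis by (simp only: norm_mult norm_of_real mult_1_right mult.commute)
  qed
  have m: "loop_integrand N b j ms \<in> borel_measurable (coord_measure N)"
  proof -
    have [measurable]: "(\<lambda>x. htrs N x ns) \<in> borel_measurable (coord_measure N)" for ns
      by (rule polybounded_measurable[OF polybounded_htrs])
    have "(\<lambda>x. \<Sum>(c, ns)\<leftarrow>xs. of_nat c * htrs N x ns) \<in> borel_measurable (coord_measure N)" for xs
      by (induction xs) (auto simp: case_prod_unfold)
    note [measurable] = this
    show ?thesis unfolding loop_integrand_def[abs_def] by measurable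
  qed
  have [measurable]: "R \<in> borel_measurable (coord_measure N)"
    unfolding R_def[abs_def] by (intro borel_measurable_add polybounded_measurable[OF polybounded_htrs])
  have frob_nonneg: "0 \<le> frob N x" for x using frob_ge_1[of N x] by simp
  have "(\<lambda>n. \<integral>x. F n x \<partial>coord_measure N) \<longlonglongrightarrow> (\<integral>x. weight N b x * loop_integrand N b j ms x \<partial>coord_measure N)"
  proof (rule integral_dominated_convergence)
    show "(\<lambda>x. weight N b x * loop_integrand N b j ms x) \<in> borel_measurable (coord_measure N)" using m by measurable
    show "F n \<in> borel_measurable (coord_measure N)" for n unfolding F_def using m by measurable
    show "integrable (coord_measure N) (\<lambda>x. cmod ((of_real ((C + 2 * real (Suc p) * (2 * C1)) * frob N x ^ h)) * weight N b x))"
      by (intro integrable_norm integrable_weight[OF b, where C = "\<bar>C + 2 * real (Suc p) * (2 * C1)\<bar>"] measurable_complex_of_real)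
         (use frob_nonneg in \<open>auto simp: abs_mult simp del: of_real_mult intro!: mult_left_mono\<close>)
    show "AE x in coord_measure N. norm (F n x) \<le> cmod ((of_real ((C + 2 * real (Suc p) * (2 * C1)) * frob N x ^ h)) * weight N b x)" for n
      by (intro AE_I2 bound)
    show "AE x in coord_measure N. (\<lambda>n. F n x) \<longlonglongrightarrow> weight N b x * loop_integrand N b j ms x"
    proof (rule AE_I2)
      fix x
      have "(\<lambda>n. complex_of_real (e n)) \<longlonglongrightarrow> complex_of_real 0"
        unfolding e_def by (intro tendsto_of_real LIMSEQ_inverse_real_of_nat)
      hence e0: "(\<lambda>n. complex_of_real (e n)) \<longlonglongrightarrow> 0" by simp
      have c: "(\<lambda>n. cutoff N (e n) q x) \<longlonglongrightarrow> 1" for q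
      proof -
        have "(\<lambda>n. inverse (1 + complex_of_real (e n) * complex_of_real (frob N x)) ^ q) \<longlonglongrightarrow>
            inverse (1 + 0 * complex_of_real (frob N x)) ^ q"
          by (intro tendsto_power tendsto_inverse tendsto_add tendsto_mult tendsto_const e0) auto
        thus ?thesis by (simp add: cutoff_def)
      qed
      have "(\<lambda>n. F n x) \<longlonglongrightarrow> weight N b x * 1 * (loop_integrand N b j ms x - 2 * of_nat (Suc p) * 0 * R x * 1)"
        unfolding F_def by (intro tendsto_mult tendsto_diff tendsto_const c e0)
      thus "(\<lambda>n. F n x) \<longlonglongrightarrow> weight N b x * loop_integrand N b j ms x" by simp
    qed
  qed
  thus ?thesis unfolding F0 using LIMSEQ_const_iff by metis
qed

theorem loop_equation:
  assumes b: "2 * b > 2 * real h + 2 * real N - 1"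
  shows "(\<Sum>a<j. moment N b (a # (j - 1 - a) # ms)) + (\<Sum>a<j + 2. moment N b (a # (j + 1 - a) # ms))
    + (\<Sum>(c, ns)\<leftarrow>joins (\<lambda>m. j + (m - 1)) ms. of_nat c * moment N b ns)
    + (\<Sum>(c, ns)\<leftarrow>joins (\<lambda>m. j + 2 + (m - 1)) ms. of_nat c * moment N b ns)
    = 2 * complex_of_real b * moment N b ((j + 1) # ms)"
proof -
  define D where "D = coord_measure N"
  \<comment> \<open>Integrability and value are carried together, so that one structural pass over
    the integrand yields both. All terms have degree at most 2h and are separately
    integrable.\<close>
  define J where "J f I \<longleftrightarrow> integrable D (\<lambda>x. f x * weight N b x) \<and> (\<integral>x. f x * weight N b x \<partial>D) = I" for f I
  have J_htrs: "J (\<lambda>x. htrs N x ns) (moment N b ns)" if "sum_list ns \<le> 2 * h" for ns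
    unfolding J_def D_def moment_def using integrable_htrs_weight[OF b that] by simp
  have J_add: "J (\<lambda>x. f x + g x) (I + I')" if "J f I" "J g I'" for f g I I'
    using that unfolding J_def by (auto simp: distrib_right)
  have J_diff: "J (\<lambda>x. f x - g x) (I - I')" if "J f I" "J g I'" for f g I I'
    using that unfolding J_def by (auto simp: left_diff_distrib)
  have J_mult: "J (\<lambda>x. a * f x) (a * I)" if "J f I" for f a I
    using that unfolding J_def by (auto simp: mult.assoc)
  have J_zero: "J (\<lambda>x. 0) 0" by (simp add: J_def)
  have J_sum: "J (\<lambda>x. \<Sum>a<k. f a x) (\<Sum>a<k. I a)" if "\<And>a. a < k \<Longrightarrow> J (f a) (I a)" for f I and k :: nat
    using that by (induction k) (auto intro: J_zero J_add)
  have J_list: "J (\<lambda>x. \<Sum>(c, ns)\<leftarrow>xs. of_nat c * htrs N x ns) (\<Sum>(c, ns)\<leftarrow>xs. of_nat c * moment N b ns)"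
    if "\<And>c ns. (c, ns) \<in> set xs \<Longrightarrow> sum_list ns \<le> 2 * h" for xs
    using that
  proof (induction xs)
    case (Cons p xs)
    obtain c ns where p: "p = (c, ns)" by force
    have "J (\<lambda>x. of_nat c * htrs N x ns + (\<Sum>(c, ns)\<leftarrow>xs. of_nat c * htrs N x ns))
      (of_nat c * moment N b ns + (\<Sum>(c, ns)\<leftarrow>xs. of_nat c * moment N b ns))"
      using Cons p by (intro J_add J_mult J_htrs Cons.IH) auto
    thus ?case by (simp add: p)
  qed (simp add: J_zero)
  have "J (\<lambda>x. loop_integrand N b j ms x)
    ((\<Sum>a<j. moment N b (a # (j - 1 - a) # ms)) + (\<Sum>a<j + 2. moment N b (a # (j + 1 - a) # ms))
    + (\<Sum>(c, ns)\<leftarrow>joins (\<lambda>m. j + (m - 1)) ms. of_nat c * moment N b ns)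
    + (\<Sum>(c, ns)\<leftarrow>joins (\<lambda>m. j + 2 + (m - 1)) ms. of_nat c * moment N b ns)
    - 2 * complex_of_real b * moment N b ((j + 1) # ms))"
    unfolding loop_integrand_def
    by (intro J_diff J_add J_sum J_list[OF sum_list_joins_le(1)] J_list[OF sum_list_joins_le(2)] J_mult J_htrs)
       (use deg in auto)
  moreover have "(\<integral>x. loop_integrand N b j ms x * weight N b x \<partial>D) = 0"
    using integral_loop_integrand[OF b] by (simp add: D_def mult.commute)
  ultimately show ?thesis unfolding J_def by simp
qed

end

end

section \<open>Linear systems over rational functions\<close>

definition ratfun :: "real \<Rightarrow> (real \<Rightarrow> real) \<Rightarrow> bool" where
  "ratfun c f \<longleftrightarrow> (\<exists>a b. \<forall>s>c. poly b s \<noteq> 0 \<and> f s = poly a s / poly b s)"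

lemma ratfun_poly: "ratfun c (poly a)"
  unfolding ratfun_def by (intro exI[of _ a] exI[of _ 1]) simp

lemma ratfun_const: "ratfun c (\<lambda>s. a)"
  unfolding ratfun_def by (intro exI[of _ "[:a:]"] exI[of _ 1]) simp

lemma ratfun_add: "ratfun c f \<Longrightarrow> ratfun c g \<Longrightarrow> ratfun c (\<lambda>s. f s + g s)"
proof -
  assume "ratfun c f" "ratfun c g"
  then obtain a b a' b' where "\<forall>s>c. poly b s \<noteq> 0 \<and> f s = poly a s / poly b s"
    "\<forall>s>c. poly b' s \<noteq> 0 \<and> g s = poly a' s / poly b' s" unfolding ratfun_def by blast
  thus ?thesis unfolding ratfun_def
    by (intro exI[of _ "a * b' + a' * b"] exI[of _ "b * b'"]) (simp add: field_simps)
qed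

lemma ratfun_mult: "ratfun c f \<Longrightarrow> ratfun c g \<Longrightarrow> ratfun c (\<lambda>s. f s * g s)"
proof -
  assume "ratfun c f" "ratfun c g"
  then obtain a b a' b' where "\<forall>s>c. poly b s \<noteq> 0 \<and> f s = poly a s / poly b s"
    "\<forall>s>c. poly b' s \<noteq> 0 \<and> g s = poly a' s / poly b' s" unfolding ratfun_def by blast
  thus ?thesis unfolding ratfun_def
    by (intro exI[of _ "a * a'"] exI[of _ "b * b'"]) simp
qed

lemma ratfun_inverse: "ratfun c f \<Longrightarrow> (\<And>s. s > c \<Longrightarrow> f s \<noteq> 0) \<Longrightarrow> ratfun c (\<lambda>s. 1 / f s)"
proof -
  assume "ratfun c f" and nz: "\<And>s. s > c \<Longrightarrow> f s \<noteq> 0"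
  then obtain a b where ab: "\<forall>s>c. poly b s \<noteq> 0 \<and> f s = poly a s / poly b s" unfolding ratfun_def by blast
  have "poly a s \<noteq> 0 \<and> 1 / f s = poly b s / poly a s" if "s > c" for s
    using ab nz[OF that] that by auto
  thus ?thesis unfolding ratfun_def by blast
qed

lemma ratfun_sum: "finite A \<Longrightarrow> (\<And>a. a \<in> A \<Longrightarrow> ratfun c (f a)) \<Longrightarrow> ratfun c (\<lambda>s. \<Sum>a\<in>A. f a s)"
  by (induction rule: finite_induct) (auto intro: ratfun_const ratfun_add)

lemma ratfun_prod: "finite A \<Longrightarrow> (\<And>a. a \<in> A \<Longrightarrow> ratfun c (f a)) \<Longrightarrow> ratfun c (\<lambda>s. \<Prod>a\<in>A. f a s)"
  by (induction rule: finite_induct) (auto intro: ratfun_const ratfun_mult)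

lemma ratfun_mono: "ratfun c f \<Longrightarrow> c \<le> c' \<Longrightarrow> ratfun c' f"
  unfolding ratfun_def by (meson le_less_trans)

definition ratpoly :: "real \<Rightarrow> (real \<Rightarrow> nat \<Rightarrow> real) \<Rightarrow> bool" where
  "ratpoly c F \<longleftrightarrow> (\<exists>d r. (\<forall>i\<le>d. ratfun c (r i)) \<and>
     (\<forall>s>c. \<forall>N\<ge>1. F s N = (\<Sum>i\<le>d. r i s * real N ^ i)))"

lemma ratpoly_cong:
  "ratpoly c F \<Longrightarrow> (\<And>s N. s > c \<Longrightarrow> N \<ge> 1 \<Longrightarrow> F s N = G s N) \<Longrightarrow> ratpoly c G"
  unfolding ratpoly_def by metis

lemma ratpoly_mono: "ratpoly c F \<Longrightarrow> c \<le> c' \<Longrightarrow> ratpoly c' F"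
  unfolding ratpoly_def by (meson le_less_trans ratfun_mono)

lemma ratpoly_ratfun: "ratfun c f \<Longrightarrow> ratpoly c (\<lambda>s N. f s)"
  unfolding ratpoly_def by (intro exI[of _ 0] exI[of _ "\<lambda>_. f"]) simp

lemma ratpoly_add:
  assumes "ratpoly c F" "ratpoly c G"
  shows "ratpoly c (\<lambda>s N. F s N + G s N)"
proof -
  obtain d r where r: "\<And>i. i \<le> d \<Longrightarrow> ratfun c (r i)" "\<And>s N. s > c \<Longrightarrow> N \<ge> 1 \<Longrightarrow> F s N = (\<Sum>i\<le>d. r i s * real N ^ i)"
    using assms(1) unfolding ratpoly_def by blast
  obtain d' r' where r': "\<And>i. i \<le> d' \<Longrightarrow> ratfun c (r' i)" "\<And>s N. s > c \<Longrightarrow> N \<ge> 1 \<Longrightarrow> G s N = (\<Sum>i\<le>d'. r' i s * real N ^ i)"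
    using assms(2) unfolding ratpoly_def by blast
  define t where "t i s = (if i \<le> d then r i s else 0) + (if i \<le> d' then r' i s else 0)" for i s
  have "ratfun c (t i)" for i
    unfolding t_def[abs_def] by (cases "i \<le> d"; cases "i \<le> d'") (auto intro!: ratfun_add ratfun_const r r')
  moreover have "F s N + G s N = (\<Sum>i\<le>max d d'. t i s * real N ^ i)" if "s > c" "N \<ge> 1" for s N
  proof -
    have "(\<Sum>i\<le>max d d'. (if i \<le> d then r i s else 0) * real N ^ i) = (\<Sum>i\<le>d. r i s * real N ^ i)"
      by (rule sum.mono_neutral_cong_right) auto
    moreover have "(\<Sum>i\<le>max d d'. (if i \<le> d' then r' i s else 0) * real N ^ i) = (\<Sum>i\<le>d'. r' i s * real N ^ i)"
      by (rule sum.mono_neutral_cong_right) auto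
    ultimately show ?thesis using that by (simp add: t_def distrib_right sum.distrib r r')
  qed
  ultimately show ?thesis unfolding ratpoly_def by blast
qed

lemma ratpoly_scale:
  assumes "ratfun c f" "ratpoly c F"
  shows "ratpoly c (\<lambda>s N. f s * F s N)"
proof -
  obtain d r where r: "\<And>i. i \<le> d \<Longrightarrow> ratfun c (r i)" "\<And>s N. s > c \<Longrightarrow> N \<ge> 1 \<Longrightarrow> F s N = (\<Sum>i\<le>d. r i s * real N ^ i)"
    using assms(2) unfolding ratpoly_def by blast
  show ?thesis unfolding ratpoly_def
    by (intro exI[of _ d] exI[of _ "\<lambda>i s. f s * r i s"])
       (auto intro!: ratfun_mult assms r simp: r sum_distrib_left mult.assoc)
qed

lemma ratpoly_mult_N:
  assumes "ratpoly c F"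
  shows "ratpoly c (\<lambda>s N. real N * F s N)"
proof -
  obtain d r where r: "\<And>i. i \<le> d \<Longrightarrow> ratfun c (r i)" "\<And>s N. s > c \<Longrightarrow> N \<ge> 1 \<Longrightarrow> F s N = (\<Sum>i\<le>d. r i s * real N ^ i)"
    using assms unfolding ratpoly_def by blast
  define t where "t i s = (case i of 0 \<Rightarrow> 0 | Suc i \<Rightarrow> r i s)" for i s
  have "ratfun c (t i)" if "i \<le> Suc d" for i
    using that by (cases i) (auto simp: t_def[abs_def] intro: ratfun_const r)
  moreover have "real N * F s N = (\<Sum>i\<le>Suc d. t i s * real N ^ i)" if "s > c" "N \<ge> 1" for s N
    unfolding sum.atMost_Suc_shift using that by (simp add: t_def r sum_distrib_left mult_ac)
  ultimately show ?thesis unfolding ratpoly_def by blast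
qed

lemma ratpoly_mult_N_power: "ratpoly c F \<Longrightarrow> ratpoly c (\<lambda>s N. real N ^ n * F s N)"
proof (induction n)
  case (Suc n)
  from ratpoly_mult_N[OF Suc.IH[OF Suc.prems]] show ?case by (simp add: mult.assoc)
qed simp

lemma ratpoly_zero: "ratpoly c (\<lambda>s N. 0)"
  by (rule ratpoly_ratfun[OF ratfun_const])

lemma ratpoly_sum: "finite A \<Longrightarrow> (\<And>a. a \<in> A \<Longrightarrow> ratpoly c (F a)) \<Longrightarrow> ratpoly c (\<lambda>s N. \<Sum>a\<in>A. F a s N)"
  by (induction rule: finite_induct) (auto intro: ratpoly_zero ratpoly_add)

text \<open>The Levy-Desplanques argument: for a kernel vector, the row of a coordinate of largest
  modulus contradicts dominance.\<close>

lemma diagonally_dominant_det_nonzero: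
  fixes A :: "real mat"
  assumes A: "A \<in> carrier_mat n n"
    and dd: "\<And>i. i < n \<Longrightarrow> (\<Sum>j\<in>{..<n} - {i}. \<bar>A $$ (i, j)\<bar>) < \<bar>A $$ (i, i)\<bar>"
  shows "Determinant.det A \<noteq> 0"
proof
  assume "Determinant.det A = 0"
  then obtain v where v: "v \<in> carrier_vec n" "v \<noteq> 0\<^sub>v n" "A *\<^sub>v v = 0\<^sub>v n"
    using det_0_iff_vec_prod_zero[OF A] by blast
  obtain k where k: "k < n" "v $ k \<noteq> 0" using v(1,2) by (metis carrier_vecD eq_vecI index_zero_vec)
  define m where "m = Max ((\<lambda>i. \<bar>v $ i\<bar>) ` {..<n})"
  have "m \<in> (\<lambda>i. \<bar>v $ i\<bar>) ` {..<n}" unfolding m_def using k by (intro Max_in) auto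
  then obtain i where i: "i < n" "m = \<bar>v $ i\<bar>" by auto
  have le: "\<bar>v $ j\<bar> \<le> m" if "j < n" for j unfolding m_def using that by (intro Max_ge) auto
  have m: "m > 0" using le[OF k(1)] k(2) by linarith
  have "(A *\<^sub>v v) $ i = 0" using v(3) i(1) by simp
  hence "(\<Sum>j<n. A $$ (i, j) * v $ j) = 0"
    using A v(1) i(1) by (simp add: scalar_prod_def atLeast0LessThan)
  hence "A $$ (i, i) * v $ i = - (\<Sum>j\<in>{..<n} - {i}. A $$ (i, j) * v $ j)"
    using i(1) by (subst (asm) sum.remove[of _ i]) auto
  hence "\<bar>A $$ (i, i)\<bar> * m = \<bar>\<Sum>j\<in>{..<n} - {i}. A $$ (i, j) * v $ j\<bar>"
    by (metis abs_minus_cancel abs_mult i(2))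
  also have "\<dots> \<le> (\<Sum>j\<in>{..<n} - {i}. \<bar>A $$ (i, j)\<bar> * m)"
    by (rule order_trans[OF sum_abs]) (auto intro!: sum_mono mult_left_mono le simp: abs_mult)
  also have "\<dots> = (\<Sum>j\<in>{..<n} - {i}. \<bar>A $$ (i, j)\<bar>) * m" by (simp add: sum_distrib_right)
  also have "\<dots> < \<bar>A $$ (i, i)\<bar> * m" using dd[OF i(1)] m by (intro mult_strict_right_mono)
  finally show False by simp
qed

lemma ratfun_det:
  assumes "\<And>i j. i < n \<Longrightarrow> j < n \<Longrightarrow> ratfun c (A i j)"
  shows "ratfun c (\<lambda>s. Determinant.det (Matrix.mat n n (\<lambda>(i, j). A i j s)))"
  unfolding det_mat_leibniz
    by (intro ratfun_sum ratfun_mult ratfun_const ratfun_prod assms) (auto simp: permutes_less finite_permutations)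

text \<open>Cramer's rule through the adjugate. The coefficients \<open>M\<close> depend on s only,
  so the determinant to be inverted is free of N, and the solution is a combination of the
  right-hand sides with coefficients rational in s. Dominance on the whole half-line excludes poles
  there.\<close>

lemma ratpoly_solve:
  fixes n :: nat
  assumes M: "\<And>i j. i < n \<Longrightarrow> j < n \<Longrightarrow> ratfun c (M i j)"
    and dd: "\<And>i s. i < n \<Longrightarrow> s > c \<Longrightarrow> (\<Sum>j\<in>{..<n} - {i}. \<bar>M i j s\<bar>) < \<bar>M i i s\<bar>"
    and y: "\<And>i. i < n \<Longrightarrow> ratpoly c (y i)"
    and eq: "\<And>i s N. i < n \<Longrightarrow> s > c \<Longrightarrow> N \<ge> 1 \<Longrightarrow> (\<Sum>j<n. M i j s * x j s N) = y i s N"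
    and i: "i < n"
  shows "ratpoly c (x i)"
proof -
  define A where "A s = Matrix.mat n n (\<lambda>(i, j). M i j s)" for s
  have A: "A s \<in> carrier_mat n n" for s by (simp add: A_def)
  have det: "Determinant.det (A s) \<noteq> 0" if "s > c" for s
    by (rule diagonally_dominant_det_nonzero[OF A]) (use dd that in \<open>auto simp: A_def\<close>)
  have rdet: "ratfun c (\<lambda>s. Determinant.det (A s))" unfolding A_def by (rule ratfun_det[OF M])
  have cof: "ratfun c (\<lambda>s. cofactor (A s) k l)" if "k < n" "l < n" for k l
  proof -
    have e: "mat_delete (A s) k l = Matrix.mat (n - 1) (n - 1) (\<lambda>(i, j).
        M (if i < k then i else Suc i) (if j < l then j else Suc j) s)" for s
      using that by (intro eq_matI) (auto simp: mat_delete_def A_def)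
    show ?thesis unfolding cofactor_def e
      by (intro ratfun_mult ratfun_const ratfun_det M) (use that in auto)
  qed
  have sol: "x i s N = 1 / Determinant.det (A s) * (\<Sum>k<n. cofactor (A s) k i * y k s N)" if s: "s > c" "N \<ge> 1" for s N
  proof -
    have "(\<Sum>k<n. cofactor (A s) k i * y k s N) = (\<Sum>k<n. \<Sum>j<n. cofactor (A s) k i * M k j s * x j s N)"
      using s by (intro sum.cong refl) (simp add: eq[symmetric] sum_distrib_left mult.assoc)
    also have "\<dots> = (\<Sum>j<n. (\<Sum>k<n. cofactor (A s) k i * M k j s) * x j s N)"
      by (subst sum.swap) (simp add: sum_distrib_right)
    also have "\<dots> = (\<Sum>j<n. if j = i then Determinant.det (A s) * x j s N else 0)"
    proof (intro sum.cong refl)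
      fix j assume "j \<in> {..<n}"
      hence j: "j < n" by simp
      have "(\<Sum>k<n. cofactor (A s) k i * M k j s) = (adj_mat (A s) * A s) $$ (i, j)"
        using i j by (simp add: A_def scalar_prod_def atLeast0LessThan adj_mat_def)
      also have "\<dots> = (if j = i then Determinant.det (A s) else 0)"
        unfolding adj_mat(3)[OF A] using i j by simp
      finally show "(\<Sum>k<n. cofactor (A s) k i * M k j s) * x j s N = (if j = i then Determinant.det (A s) * x j s N else 0)"
        by simp
    qed
    also have "\<dots> = Determinant.det (A s) * x i s N" using i by simp
    finally show ?thesis using det[OF s(1)] by simp
  qed
  have "ratpoly c (\<lambda>s N. 1 / Determinant.det (A s) * (\<Sum>k<n. cofactor (A s) k i * y k s N))"
    by (intro ratpoly_scale ratpoly_sum ratfun_inverse rdet cof y) (use det i in auto)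
  thus ?thesis by (rule ratpoly_cong) (simp add: sol)
qed

lemma ratpoly_solve_set:
  assumes fin: "finite I"
    and M: "\<And>i j. i \<in> I \<Longrightarrow> j \<in> I \<Longrightarrow> ratfun c (M i j)"
    and dd: "\<And>i s. i \<in> I \<Longrightarrow> s > c \<Longrightarrow> (\<Sum>j\<in>I - {i}. \<bar>M i j s\<bar>) < \<bar>M i i s\<bar>"
    and y: "\<And>i. i \<in> I \<Longrightarrow> ratpoly c (y i)"
    and eq: "\<And>i s N. i \<in> I \<Longrightarrow> s > c \<Longrightarrow> N \<ge> 1 \<Longrightarrow> (\<Sum>j\<in>I. M i j s * x j s N) = y i s N"
    and i: "i \<in> I"
  shows "ratpoly c (x i)"
proof -
  obtain e where "bij_betw e {0..<card I} I" using ex_bij_betw_nat_finite[OF fin] by blast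
  hence e: "bij_betw e {..<card I} I" by (simp add: atLeast0LessThan)
  have eI: "e k \<in> I" if "k < card I" for k using bij_betwE[OF e] that by auto
  obtain k where k: "k < card I" "i = e k" using i e unfolding bij_betw_def by auto
  have "ratpoly c (x (e k))"
  proof (rule ratpoly_solve[where n = "card I" and M = "\<lambda>i j. M (e i) (e j)" and y = "\<lambda>i. y (e i)" and x = "\<lambda>i. x (e i)"])
    fix i s assume i: "i < card I" "s > c"
    have "bij_betw e ({..<card I} - {i}) (I - {e i})"
      using bij_betw_DiffI[OF e, of "{i}" "{e i}"] i(1) eI by (simp add: bij_betw_def)
    hence "(\<Sum>j\<in>{..<card I} - {i}. \<bar>M (e i) (e j) s\<bar>) = (\<Sum>j\<in>I - {e i}. \<bar>M (e i) j s\<bar>)"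
      by (rule sum.reindex_bij_betw)
    thus "(\<Sum>j\<in>{..<card I} - {i}. \<bar>M (e i) (e j) s\<bar>) < \<bar>M (e i) (e i) s\<bar>" using dd[OF eI[OF i(1)] i(2)] by simp
  next
    fix i s and N :: nat assume "i < card I" "s > c" "N \<ge> 1"
    thus "(\<Sum>j<card I. M (e i) (e j) s * x (e j) s N) = y (e i) s N"
      using sum.reindex_bij_betw[OF e, of "\<lambda>j. M (e i) j s * x j s N"] eq[OF eI] by simp
  qed (use M y eI k in auto)
  thus ?thesis using k by simp
qed

section \<open>Solving the loop equations\<close>

text \<open>The average of the product of traces under the Hua-Pickrell measure, whose exponent is s
  + N. Traces of powers of Hermitian matrices are real, so taking real parts loses nothing.\<close>

definition normalized_moment :: "nat list \<Rightarrow> real \<Rightarrow> nat \<Rightarrow> real" where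
  "normalized_moment ms s N = Re (moment N (s + real N) ms) / Re (moment N (s + real N) [])"

lemma partition_function:
  assumes "2 * b > 2 * real N - 1"
  shows "integrable (coord_measure N) (\<lambda>x. detw N x powr (- b))"
    "(\<integral>x. detw N x powr (- b) \<partial>coord_measure N) > 0"
    "moment N b [] = complex_of_real (\<integral>x. detw N x powr (- b) \<partial>coord_measure N)"
proof -
  have "integrable (coord_measure N) (weight N b)"
    using integrable_htrs_weight[where h = 0 and ms = "[]" and N = N and b = b] assms by simp
  hence "integrable (coord_measure N) (\<lambda>x. cmod (weight N b x))" by (rule integrable_norm)
  thus int: "integrable (coord_measure N) (\<lambda>x. detw N x powr (- b))" by (simp add: cmod_weight)
  show "moment N b [] = complex_of_real (\<integral>x. detw N x powr (- b) \<partial>coord_measure N)"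
    by (simp add: moment_def weight_def)
  have "(\<integral>x. detw N x powr (- b) \<partial>coord_measure N) \<noteq> 0"
  proof
    assume "(\<integral>x. detw N x powr (- b) \<partial>coord_measure N) = 0"
    hence "AE x in coord_measure N. detw N x powr (- b) = 0"
      using int by (subst (asm) integral_nonneg_eq_0_iff_AE) auto
    moreover have "detw N x \<noteq> 0" for x using detw_ge_1[of N x] by simp
    ultimately have "AE x in coord_measure N. False" by simp
    hence "emeasure (coord_measure N) (space (coord_measure N)) = 0"
      by (simp add: eventually_False ae_filter_eq_bot_iff)
    moreover have "emeasure (coord_measure N) (space (coord_measure N)) = (\<Prod>i\<in>{..<N} \<times> {..<N}. emeasure lborel (UNIV :: real set))"
      by (subst coords.emeasure_PiM[symmetric]) (auto simp: space_PiM)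
    ultimately show False by (simp add: prod_zero_iff)
  qed
  thus "(\<integral>x. detw N x powr (- b) \<partial>coord_measure N) > 0"
    by (simp add: integral_nonneg_AE order_less_le)
qed

lemma normalized_moment_Nil:
  assumes "s > - 1 / 2" shows "normalized_moment [] s N = 1"
  using partition_function(2,3)[of N "s + real N"] assms by (simp add: normalized_moment_def)

text \<open>Each entry 0 is a factor Tr 1 = N. In the recursion this is the only source of powers of
  N.\<close>

lemma normalized_moment_remove_zeros:
  "normalized_moment ms s N = real N ^ length (filter ((=) 0) ms) * normalized_moment (filter ((\<noteq>) 0) ms) s N"
proof -
  have "htrs N x ms = of_nat N ^ length (filter ((=) 0) ms) * htrs N x (filter ((\<noteq>) 0) ms)" for x
    by (induction ms) (auto simp: mult_ac)
  hence "moment N b ms = of_real (real N ^ length (filter ((=) 0) ms)) * moment N b (filter ((\<noteq>) 0) ms)" for b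
    by (simp add: moment_def mult.assoc)
  hence "Re (moment N b ms) = real N ^ length (filter ((=) 0) ms) * Re (moment N b (filter ((\<noteq>) 0) ms))" for b
    by (simp only: Re_complex_of_real Im_complex_of_real times_complex.simps mult_zero_left diff_zero)
  thus ?thesis by (simp add: normalized_moment_def)
qed

text \<open>The terms of top degree in the loop equation for the field
  \<open>H\<^bsup>l-1\<^esup> (1 + H\<^sup>2)\<close>, except the two splittings \<open>l = 0 + l = l + 0\<close>: these contribute \<open>2 N\<close> times the
  moment itself, which cancels the \<open>N\<close> in the exponent of the weight.\<close>

fun top_terms :: "nat list \<Rightarrow> (nat \<times> nat list) list" where
  "top_terms [] = []"
| "top_terms (l # ms) = map (\<lambda>a. (1, a # (l - a) # ms)) [1..<l] @ joins (\<lambda>m. l + m) ms"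

text \<open>The terms of the same loop equation that come from the summand H^(l-1) of the field, two
  degrees below the top. Here zeros may appear in the lists: an end of a splitting, or a join of two
  entries equal to 1.\<close>

fun lower_terms :: "nat list \<Rightarrow> (nat \<times> nat list) list" where
  "lower_terms [] = []"
| "lower_terms (l # ms) = map (\<lambda>a. (1, a # (l - 2 - a) # ms)) [0..<l - 1] @ joins (\<lambda>m. l + m - 2) ms"

lemma joins_cong: "(\<And>m. m \<in> set ms \<Longrightarrow> f m = g m) \<Longrightarrow> joins f ms = joins g ms"
  by (induction ms) auto

lemma joins_nonzero: "(c, ns) \<in> set (joins f ms) \<Longrightarrow> 0 \<notin> set ms \<Longrightarrow> (\<And>m. f m > 0) \<Longrightarrow> 0 \<notin> set ns"
proof (induction ms arbitrary: c ns)
  case (Cons m ms)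
  thus ?case by (auto simp: less_not_refl2)
qed simp

lemma sum_joins_coeffs: "(\<Sum>(c, ns)\<leftarrow>joins f ms. real c) = real (sum_list ms)"
  by (induction ms) (auto simp: o_def case_prod_unfold)

lemma loop_equation_normalized:
  assumes s: "s > real h - 1 / 2" and ms: "0 \<notin> set (l # ms)" "sum_list (l # ms) = 2 * h"
  shows "2 * s * normalized_moment (l # ms) s N =
    (\<Sum>(c, ns)\<leftarrow>top_terms (l # ms). real c * normalized_moment ns s N) +
    (\<Sum>(c, ns)\<leftarrow>lower_terms (l # ms). real c * normalized_moment ns s N)"
proof -
  obtain j where j: "l = Suc j" using ms(1) by (cases l) auto
  define b where "b = s + real N"
  have b: "2 * b > 2 * real h + 2 * real N - 1" using s by (simp add: b_def)
  define Z where "Z = Re (moment N b [])"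
  define X where "X ns = normalized_moment ns s N" for ns
  have X: "X ns = Re (moment N b ns) / Z" for ns by (simp add: X_def normalized_moment_def Z_def b_def)
  have Re_list: "Re (\<Sum>(c, ns)\<leftarrow>xs. of_nat c * moment N b ns) / Z = (\<Sum>(c, ns)\<leftarrow>xs. real c * X ns)" for xs
    by (induction xs) (auto simp: add_divide_distrib X)
  have deg: "j + 1 + sum_list ms = 2 * h" "0 \<notin> set ms" using ms j by auto
  \<comment> \<open>The two truncated subtractions agree because no entry of \<open>ms\<close> is
    0.\<close>
  have j1: "joins (\<lambda>m. j + (m - 1)) ms = joins (\<lambda>m. l + m - 2) ms"
  proof (rule joins_cong)
    fix m assume "m \<in> set ms"
    hence "m \<noteq> 0" using deg(2) by metis
    thus "j + (m - 1) = l + m - 2" unfolding j by arith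
  qed
  have j2: "joins (\<lambda>m. j + 2 + (m - 1)) ms = joins (\<lambda>m. l + m) ms"
  proof (rule joins_cong)
    fix m assume "m \<in> set ms"
    hence "m \<noteq> 0" using deg(2) by metis
    thus "j + 2 + (m - 1) = l + m" unfolding j by arith
  qed
  have rhs: "Re (2 * complex_of_real b * moment N b ((j + 1) # ms)) / Z = 2 * b * X (l # ms)"
    by (simp add: X j)
  have "Re ((\<Sum>a<j. moment N b (a # (j - 1 - a) # ms)) + (\<Sum>a<j + 2. moment N b (a # (j + 1 - a) # ms))
    + (\<Sum>(c, ns)\<leftarrow>joins (\<lambda>m. j + (m - 1)) ms. of_nat c * moment N b ns)
    + (\<Sum>(c, ns)\<leftarrow>joins (\<lambda>m. j + 2 + (m - 1)) ms. of_nat c * moment N b ns)) / Z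
    = Re (2 * complex_of_real b * moment N b ((j + 1) # ms)) / Z"
    unfolding loop_equation[OF deg b] ..
  hence eq: "(\<Sum>a<j. X (a # (j - 1 - a) # ms)) + (\<Sum>a<j + 2. X (a # (j + 1 - a) # ms))
    + (\<Sum>(c, ns)\<leftarrow>joins (\<lambda>m. l + m - 2) ms. real c * X ns) + (\<Sum>(c, ns)\<leftarrow>joins (\<lambda>m. l + m) ms. real c * X ns)
    = 2 * b * X (l # ms)"
    by (simp only: j1 j2 plus_complex.simps add_divide_distrib Re_list Re_sum sum_divide_distrib X[symmetric] rhs)
  \<comment> \<open>The two extreme splittings; together they balance the 2 N contained in 2
    b.\<close>
  have z: "X (0 # l # ms) = real N * X (l # ms)" "X (l # 0 # ms) = real N * X (l # ms)"
    unfolding X_def using normalized_moment_remove_zeros[of "0 # l # ms" s N]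
      normalized_moment_remove_zeros[of "l # 0 # ms" s N] normalized_moment_remove_zeros[of "l # ms" s N] j
    by simp_all
  have sh: "(\<Sum>a<j + 2. g a) = g 0 + (\<Sum>a<j. g (Suc a)) + g (Suc j)" for g :: "nat \<Rightarrow> real"
    by (simp only: add_2_eq_Suc' sum.lessThan_Suc[of _ "Suc j"] sum.lessThan_Suc_shift[of _ j])
  have "(\<Sum>a<j + 2. X (a # (j + 1 - a) # ms)) = X (0 # l # ms) + (\<Sum>a<j. X (Suc a # (j - a) # ms)) + X (l # 0 # ms)"
    unfolding sh by (simp add: j)
  also have "(\<Sum>a<j. X (Suc a # (j - a) # ms)) = (\<Sum>a\<leftarrow>[1..<l]. X (a # (l - a) # ms))"
  proof -
    have "[1..<l] = map Suc [0..<j]" by (simp add: j map_Suc_upt del: upt_Suc)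
    thus ?thesis by (simp only: map_map o_def interv_sum_list_conv_sum_set_nat atLeast0LessThan set_upt) (simp add: j)
  qed
  finally have 1: "(\<Sum>a<j + 2. X (a # (j + 1 - a) # ms)) = 2 * real N * X (l # ms) + (\<Sum>a\<leftarrow>[1..<l]. X (a # (l - a) # ms))"
    by (simp add: z)
  have 2: "(\<Sum>a<j. X (a # (j - 1 - a) # ms)) = (\<Sum>a\<leftarrow>[0..<l - 1]. X (a # (l - 2 - a) # ms))"
    by (simp add: j interv_sum_list_conv_sum_set_nat atLeast0LessThan numeral_2_eq_2)
  have t: "(\<Sum>(c, ns)\<leftarrow>top_terms (l # ms). real c * X ns) =
      (\<Sum>a\<leftarrow>[1..<l]. X (a # (l - a) # ms)) + (\<Sum>(c, ns)\<leftarrow>joins (\<lambda>m. l + m) ms. real c * X ns)"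
    by (simp add: o_def)
  have u: "(\<Sum>(c, ns)\<leftarrow>lower_terms (l # ms). real c * X ns) =
      (\<Sum>a\<leftarrow>[0..<l - 1]. X (a # (l - 2 - a) # ms)) + (\<Sum>(c, ns)\<leftarrow>joins (\<lambda>m. l + m - 2) ms. real c * X ns)"
    by (simp add: o_def)
  have "2 * b * X (l # ms) = 2 * s * X (l # ms) + 2 * real N * X (l # ms)" by (simp add: b_def algebra_simps)
  thus ?thesis using eq unfolding X_def[symmetric] t u 1 2 by linarith
qed

text \<open>The order of the entries is kept: permuted lists are separate unknowns with the same
  value. Each unknown gets one equation, taken at the head of its list.\<close>

definition compositions :: "nat \<Rightarrow> nat list set" where
  "compositions n = {ms. 0 \<notin> set ms \<and> sum_list ms = n}"

lemma finite_compositions: "finite (compositions n)"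
proof (rule finite_subset)
  have "length ms \<le> sum_list ms" if "0 \<notin> set ms" for ms :: "nat list"
    using that by (induction ms) auto
  thus "compositions n \<subseteq> {ms. set ms \<subseteq> {..n} \<and> length ms \<le> n}"
    by (auto simp: compositions_def member_le_sum_list)
qed (simp add: finite_lists_length_le)

lemma top_terms_compositions:
  assumes "(c, ns) \<in> set (top_terms ms)" "ms \<in> compositions n"
  shows "ns \<in> compositions n"
proof (cases ms)
  case (Cons l ms')
  hence l: "l > 0" "0 \<notin> set ms'" "l + sum_list ms' = n" using assms(2) by (auto simp: compositions_def)
  consider a where "a \<in> {1..<l}" "ns = a # (l - a) # ms'" | "(c, ns) \<in> set (joins (\<lambda>m. l + m) ms')"
    using assms(1) Cons by auto
  thus ?thesis
  proof cases
    case 1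
    thus ?thesis using l by (auto simp: compositions_def)
  next
    case 2
    thus ?thesis using l joins_nonzero[OF 2] sum_list_joins[OF 2 l(2), of 0 l] by (auto simp: compositions_def)
  qed
qed (use assms in simp)

lemma lower_terms_sum_list:
  assumes "(c, ns) \<in> set (lower_terms ms)" "ms \<in> compositions (n + 2)"
  shows "sum_list ns = n"
proof (cases ms)
  case (Cons l ms')
  hence l: "l > 0" "0 \<notin> set ms'" "l + sum_list ms' = n + 2" using assms(2) by (auto simp: compositions_def)
  consider a where "a < l - 1" "ns = a # (l - 2 - a) # ms'" | "(c, ns) \<in> set (joins (\<lambda>m. l + m - 2) ms')"
    using assms(1) Cons by auto
  thus ?thesis
  proof cases
    case 2
    have "sum_list ns + 2 = sum_list ms' + l" by (rule sum_list_joins[OF 2 l(2)]) (use l in simp)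
    thus ?thesis using l by simp
  qed (use l in auto)
qed (use assms in simp)

text \<open>For a head l there are l - 1 splittings with coefficient 1, and the joins carry the
  remaining entries as coefficients, which add up to n - l.\<close>

lemma sum_top_terms_coeffs:
  assumes "ms \<in> compositions n" "n > 0"
  shows "(\<Sum>(c, ns)\<leftarrow>top_terms ms. real c) = real n - 1"
proof (cases ms)
  case (Cons l ms')
  hence "l > 0" "l + sum_list ms' = n" using assms(1) by (auto simp: compositions_def)
  thus ?thesis using Cons
    by (auto simp: o_def sum_list_triv sum_joins_coeffs of_nat_diff)
qed (use assms in \<open>simp add: compositions_def\<close>)

text \<open>The term lists may contain the same list several times; collecting the coefficients
  turns them into a row of a matrix.\<close>

lemma sum_list_group:
  assumes "finite I" "\<And>c ns. (c, ns) \<in> set xs \<Longrightarrow> ns \<in> I"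
  shows "(\<Sum>(c, ns)\<leftarrow>xs. real c * f ns) = (\<Sum>\<nu>\<in>I. (\<Sum>(c, ns)\<leftarrow>xs. if ns = \<nu> then real c else 0) * f \<nu>)"
  using assms(2)
proof (induction xs)
  case (Cons p xs)
  obtain c ns where p: "p = (c, ns)" by force
  have ns: "ns \<in> I" using Cons.prems p by auto
  have "(\<Sum>\<nu>\<in>I. (\<Sum>(c, ns)\<leftarrow>p # xs. if ns = \<nu> then real c else 0) * f \<nu>) =
    (\<Sum>\<nu>\<in>I. (if ns = \<nu> then real c * f \<nu> else 0)) + (\<Sum>\<nu>\<in>I. (\<Sum>(c, ns)\<leftarrow>xs. if ns = \<nu> then real c else 0) * f \<nu>)"
    unfolding sum.distrib[symmetric] by (intro sum.cong refl) (simp add: p distrib_right)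
  also have "(\<Sum>\<nu>\<in>I. (if ns = \<nu> then real c * f \<nu> else 0)) = real c * f ns"
    using ns assms(1) by (simp add: sum.delta)
  finally have "(\<Sum>\<nu>\<in>I. (\<Sum>(c, ns)\<leftarrow>p # xs. if ns = \<nu> then real c else 0) * f \<nu>) =
      real c * f ns + (\<Sum>\<nu>\<in>I. (\<Sum>(c, ns)\<leftarrow>xs. if ns = \<nu> then real c else 0) * f \<nu>)" .
  moreover have "(\<Sum>(c, ns)\<leftarrow>xs. real c * f ns) = (\<Sum>\<nu>\<in>I. (\<Sum>(c, ns)\<leftarrow>xs. if ns = \<nu> then real c else 0) * f \<nu>)"
    by (rule Cons.IH) (use Cons.prems in auto)
  ultimately show ?case by (simp only: p list.map sum_list.Cons prod.case)
qed simp

lemma ratpoly_sum_list: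
  "(\<And>c ns. (c, ns) \<in> set xs \<Longrightarrow> ratpoly r (F ns)) \<Longrightarrow> ratpoly r (\<lambda>s N. \<Sum>(c, ns)\<leftarrow>xs. real c * F ns s N)"
proof (induction xs)
  case (Cons p xs)
  obtain c ns where p: "p = (c, ns)" by force
  have "ratpoly r (\<lambda>s N. real c * F ns s N + (\<Sum>(c, ns)\<leftarrow>xs. real c * F ns s N))"
    using Cons p by (intro ratpoly_add ratpoly_scale ratfun_const Cons.IH) auto
  thus ?case by (simp add: p)
qed (simp add: ratpoly_zero)

lemma ratpoly_remove_zeros:
  assumes "\<And>ms. ms \<in> compositions n \<Longrightarrow> ratpoly c (normalized_moment ms)" "sum_list ms = n"
  shows "ratpoly c (normalized_moment ms)"
proof -
  have "sum_list (filter ((\<noteq>) 0) ms) = sum_list ms" by (induction ms) auto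
  hence "filter ((\<noteq>) 0) ms \<in> compositions n" using assms(2) by (auto simp: compositions_def)
  from ratpoly_mult_N_power[OF assms(1)[OF this], of "length (filter ((=) 0) ms)"]
  show ?thesis by (rule ratpoly_cong) (rule normalized_moment_remove_zeros[symmetric])
qed

text \<open>In degree \<open>n = 2 h\<close> the coefficients of the top-degree terms are nonnegative and add up to
  \<open>n - 1\<close>, so the linear system is strictly diagonally dominant exactly when \<open>2 s > n - 1\<close>.\<close>

theorem ratpoly_normalized_moment:
  "ms \<in> compositions (2 * h) \<Longrightarrow> ratpoly (real h - 1 / 2) (normalized_moment ms)"
proof (induction h arbitrary: ms)
  case 0
  hence "ms = []" by (cases ms) (auto simp: compositions_def)
  have "ratpoly (real 0 - 1 / 2) (\<lambda>s N. 1)" by (rule ratpoly_ratfun[OF ratfun_const])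
  thus ?case by (rule ratpoly_cong) (simp add: normalized_moment_Nil \<open>ms = []\<close>)
next
  case (Suc h)
  define n where "n = 2 * Suc h"
  define I where "I = compositions n"
  define t where "t ms \<nu> = (\<Sum>(c, ns)\<leftarrow>top_terms ms. if ns = \<nu> then real c else 0)" for ms \<nu>
  define M where "M ms \<nu> s = (if ms = \<nu> then 2 * s else 0) - t ms \<nu>" for ms \<nu> s
  have fin: "finite I" by (simp add: I_def finite_compositions)
  have t0: "t ms \<nu> \<ge> 0" for ms \<nu> unfolding t_def by (intro sum_list_nonneg) auto
  have group: "(\<Sum>(c, ns)\<leftarrow>top_terms ms. real c * f ns) = (\<Sum>\<nu>\<in>I. t ms \<nu> * f \<nu>)" if "ms \<in> I" for ms f
    unfolding t_def by (rule sum_list_group[OF fin]) (use top_terms_compositions that in \<open>auto simp: I_def\<close>)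
  have tsum: "(\<Sum>\<nu>\<in>I. t ms \<nu>) = real n - 1" if "ms \<in> I" for ms
    using group[OF that, of "\<lambda>_. 1"] sum_top_terms_coeffs[of ms n] that by (simp add: I_def n_def case_prod_unfold)
  show ?case
  proof (rule ratpoly_solve_set[where I = I and M = M and x = normalized_moment and
        y = "\<lambda>ms s N. \<Sum>(c, ns)\<leftarrow>lower_terms ms. real c * normalized_moment ns s N"])
    show "ratfun (real (Suc h) - 1 / 2) (M i j)" for i j
    proof -
      have "M i j = poly (if i = j then [:- t i j, 2:] else [:- t i j:])" by (auto simp: M_def fun_eq_iff)
      thus ?thesis by (simp only: ratfun_poly)
    qed
    show "(\<Sum>j\<in>I - {i}. \<bar>M i j s\<bar>) < \<bar>M i i s\<bar>" if i: "i \<in> I" and s: "s > real (Suc h) - 1 / 2" for i s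
    proof -
      have "(\<Sum>j\<in>I - {i}. \<bar>M i j s\<bar>) = (\<Sum>j\<in>I - {i}. t i j)"
        using t0 by (intro sum.cong) (auto simp: M_def)
      \<comment> \<open>A list may occur among its own top-degree terms. Its coefficient leaves the
        off-diagonal sum and reduces the diagonal entry 2 s by the same amount, so the comparison
        remains that of n - 1 with 2 s.\<close>
      also have "\<dots> = real n - 1 - t i i" using tsum[OF i] fin i by (simp add: sum_diff1)
      also have "\<dots> < 2 * s - t i i" using s by (simp add: n_def)
      also have "\<dots> \<le> \<bar>M i i s\<bar>" by (simp add: M_def)
      finally show ?thesis .
    qed
    show "ratpoly (real (Suc h) - 1 / 2) (\<lambda>s N. \<Sum>(c, ns)\<leftarrow>lower_terms i. real c * normalized_moment ns s N)" if i: "i \<in> I" for i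
    proof (rule ratpoly_sum_list)
      fix c ns assume "(c, ns) \<in> set (lower_terms i)"
      hence "sum_list ns = 2 * h" using lower_terms_sum_list[of c ns i "2 * h"] i by (simp add: I_def n_def)
      from ratpoly_remove_zeros[OF Suc.IH this] show "ratpoly (real (Suc h) - 1 / 2) (normalized_moment ns)"
        by (rule ratpoly_mono) auto
    qed
    show "(\<Sum>j\<in>I. M i j s * normalized_moment j s N) =
        (\<Sum>(c, ns)\<leftarrow>lower_terms i. real c * normalized_moment ns s N)"
      if i: "i \<in> I" and s: "s > real (Suc h) - 1 / 2" for i s and N :: nat
    proof -
      obtain l ns where l: "i = l # ns" using i by (cases i) (auto simp: I_def n_def compositions_def)
      have "2 * s * normalized_moment i s N = (\<Sum>(c, ns)\<leftarrow>top_terms i. real c * normalized_moment ns s N) +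
        (\<Sum>(c, ns)\<leftarrow>lower_terms i. real c * normalized_moment ns s N)"
        unfolding l by (rule loop_equation_normalized[OF s]) (use i l in \<open>auto simp: I_def n_def compositions_def\<close>)
      moreover have "(\<Sum>j\<in>I. M i j s * normalized_moment j s N) =
        (\<Sum>j\<in>I. if i = j then 2 * s * normalized_moment j s N else 0) - (\<Sum>j\<in>I. t i j * normalized_moment j s N)"
        unfolding sum_subtractf[symmetric] by (intro sum.cong refl) (simp add: M_def left_diff_distrib)
      ultimately show ?thesis using fin i by (simp add: group[OF i])
    qed
    show "ms \<in> I" using Suc.prems by (simp add: I_def n_def)
  qed (rule fin)
qed

section \<open>The Hua--Pickrell average\<close>

text \<open>Transfer from the measure on matrices to coordinates: the injective embedding becomes an
  image measure, the weight becomes a power of \<open>detw\<close>, and the normalizing integral is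
  \<open>moment N b []\<close>. The bound on s is the integrability threshold for h = k + 1, that
  is, for the larger exponent 2k + 2.\<close>

lemma Q_moment_eq:
  assumes s: "s > real k + 1 / 2"
  shows "Q_moment k s N = normalized_moment [2 * k + 2] s N + normalized_moment [2 * k] s N"
proof -
  define b where "b = s + real N"
  define D where "D = coord_measure N"
  define H where "H = herm_of_coords N"
  define Z where "Z = (\<integral>x. detw N x powr (- b) \<partial>D)"
  define f where "f X = trace_abs_power X (2 * k + 2) + trace_abs_power X (2 * k)" for X
  have b: "2 * b > 2 * real (Suc k) + 2 * real N - 1" using s by (simp add: b_def)
  have b': "2 * b > 2 * real N - 1" using b by simp
  have Z: "Z > 0" "integrable D (\<lambda>x. detw N x powr (- b))" "moment N b [] = complex_of_real Z"
    using partition_function[OF b'] by (simp_all add: Z_def D_def)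
  have herm: "H x \<in> carrier_mat N N" "mat_adjoint (H x) = H x" for x
    using herm_of_coords_hermitian[of N x] by (auto simp: hermitian_mats_def H_def)
  have w: "cauchy_weight s N (H x) = detw N x powr (- b)" for x
    unfolding cauchy_weight_eq_det[OF herm] by (simp add: H_def det_one_plus_H2 b_def)
  have tr: "trace_abs_power (H x) (2 * m) = Re (htr N x (2 * m))" for x m
    using arg_cong[OF trace_abs_power_even[OF herm, of x m], of Re] by (simp add: htr_eq_mtrace H_def)
  have f: "f (H x) = Re (htr N x (2 * k + 2)) + Re (htr N x (2 * k))" for x
    using tr[of x "Suc k"] tr[of x k] by (simp add: f_def)
  have htr_meas: "(\<lambda>x. htr N x m) \<in> borel_measurable D" for m
    unfolding D_def by (rule polybounded_measurable[OF polybounded_htr])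
  have L: "herm_lebesgue N = embed_measure D H" by (simp add: herm_lebesgue_def D_def H_def)
  have inj: "inj_on H (space D)" unfolding H_def D_def by (rule inj_on_herm_of_coords)
  have H_meas: "H \<in> measurable D (embed_measure D H)" by (rule measurable_embed_measure2'[OF inj])
  have w_meas: "cauchy_weight s N \<in> borel_measurable (embed_measure D H)"
    by (rule measurable_embed_measure1) (simp add: w D_def)
  have f_meas: "f \<in> borel_measurable (embed_measure D H)"
    by (rule measurable_embed_measure1) (use htr_meas in \<open>simp add: f\<close>)
  have "(\<integral>\<^sup>+Y. ennreal (cauchy_weight s N Y) \<partial>herm_lebesgue N) = (\<integral>\<^sup>+x. ennreal (detw N x powr (- b)) \<partial>D)"
    unfolding L using w_meas by (subst nn_integral_embed_measure'[OF inj]) (auto simp: w)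
  also have "\<dots> = ennreal Z" unfolding Z_def by (rule nn_integral_eq_integral[OF Z(2)]) auto
  finally have "hua_pickrell s N = density (embed_measure D H) (\<lambda>X. ennreal (cauchy_weight s N X) / ennreal Z)"
    by (simp add: hua_pickrell_def L)
  also have "\<dots> = density (embed_measure D H) (\<lambda>X. ennreal (cauchy_weight s N X / Z))"
  proof (rule density_cong)
    show "AE X in embed_measure D H. ennreal (cauchy_weight s N X) / ennreal Z = ennreal (cauchy_weight s N X / Z)"
    proof (rule AE_I2)
      fix X assume "X \<in> space (embed_measure D H)"
      then obtain x where "X = H x" by (auto simp: space_embed_measure)
      thus "ennreal (cauchy_weight s N X) / ennreal Z = ennreal (cauchy_weight s N X / Z)"
        using Z(1) by (simp add: w divide_ennreal)
    qed
  qed (use w_meas in auto)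
  finally have "Q_moment k s N = (\<integral>X. f X \<partial>density (embed_measure D H) (\<lambda>X. ennreal (cauchy_weight s N X / Z)))"
    by (simp add: Q_moment_def f_def)
  also have "\<dots> = (\<integral>X. cauchy_weight s N X / Z * f X \<partial>embed_measure D H)"
  proof (subst integral_real_density)
    show "AE X in embed_measure D H. 0 \<le> cauchy_weight s N X / Z"
    proof (rule AE_I2)
      fix X assume "X \<in> space (embed_measure D H)"
      then obtain x where "X = H x" by (auto simp: space_embed_measure)
      thus "0 \<le> cauchy_weight s N X / Z" using Z(1) by (simp add: w)
    qed
  qed (use w_meas f_meas in auto)
  also have "\<dots> = (\<integral>X. cauchy_weight s N X / Z * f X \<partial>distr D (embed_measure D H) H)"
    by (subst embed_measure_eq_distr'[OF inj, symmetric]) simp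
  also have "\<dots> = (\<integral>x. cauchy_weight s N (H x) / Z * f (H x) \<partial>D)"
    by (rule integral_distr[OF H_meas]) (use w_meas f_meas in measurable)
  also have "\<dots> = (\<integral>x. (Re (htrs N x [2 * k + 2] * weight N b x) + Re (htrs N x [2 * k] * weight N b x)) / Z \<partial>D)"
    by (intro Bochner_Integration.integral_cong refl) (simp add: w f weight_def field_simps)
  also have "\<dots> = (Re (moment N b [2 * k + 2]) + Re (moment N b [2 * k])) / Z"
  proof -
    have i: "integrable D (\<lambda>x. htrs N x [2 * k + 2] * weight N b x)" "integrable D (\<lambda>x. htrs N x [2 * k] * weight N b x)"
      unfolding D_def by (rule integrable_htrs_weight[OF b]; simp)+
    have "(\<integral>x. (Re (htrs N x [2 * k + 2] * weight N b x) + Re (htrs N x [2 * k] * weight N b x)) / Z \<partial>D) =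
        ((\<integral>x. Re (htrs N x [2 * k + 2] * weight N b x) \<partial>D) + (\<integral>x. Re (htrs N x [2 * k] * weight N b x) \<partial>D)) / Z"
      unfolding integral_divide_zero using integrable_Re[OF i(1)] integrable_Re[OF i(2)]
      by (simp only: Bochner_Integration.integral_add)
    moreover have "(\<integral>x. Re (htrs N x [2 * k + 2] * weight N b x) \<partial>D) = Re (moment N b [2 * k + 2])"
      "(\<integral>x. Re (htrs N x [2 * k] * weight N b x) \<partial>D) = Re (moment N b [2 * k])"
      unfolding moment_def D_def[symmetric] by (rule integral_Re[OF i(1)], rule integral_Re[OF i(2)])
    ultimately show ?thesis by (simp only:)
  qed
  finally show ?thesis by (simp add: normalized_moment_def Z(3) b_def[symmetric] add_divide_distrib)
qed

theorem mainTheorem4: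
  fixes k :: nat
  shows "\<exists>(d :: nat) (a :: nat \<Rightarrow> real poly) (b :: nat \<Rightarrow> real poly).
           \<forall>s :: real. s > 1 / 2 \<and> real k < s - 1 / 2 \<longrightarrow>
             (\<forall>i\<le>d. poly (b i) s \<noteq> 0) \<and>
             (\<forall>N :: nat. N \<ge> 1 \<longrightarrow>
                Q_moment k s N = (\<Sum>i\<le>d. poly (a i) s / poly (b i) s * real N ^ i))"
proof -
  \<comment> \<open>Equal to k + 1/2: the range of \<open>ratpoly_normalized_moment\<close> at h = k
    + 1 is exactly the range of s in the claim.\<close>
  define c where "c = real (Suc k) - 1 / 2"
  have "ratpoly c (\<lambda>s N. normalized_moment [2 * k + 2] s N + normalized_moment [2 * k] s N)"
  proof (rule ratpoly_add)
    show "ratpoly c (normalized_moment [2 * k + 2])"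
    proof (rule ratpoly_remove_zeros[where n = "2 * Suc k"])
      show "ratpoly c (normalized_moment ms)" if "ms \<in> compositions (2 * Suc k)" for ms
        unfolding c_def by (rule ratpoly_normalized_moment[OF that])
    qed simp
    have "ratpoly (real k - 1 / 2) (normalized_moment [2 * k])"
    \<comment> \<open>For k = 0 the list \<open>[0]\<close> is not a composition; removing the zero
      covers this case, where the average is N.\<close>
    proof (rule ratpoly_remove_zeros[where n = "2 * k"])
      show "ratpoly (real k - 1 / 2) (normalized_moment ms)" if "ms \<in> compositions (2 * k)" for ms
        by (rule ratpoly_normalized_moment[OF that])
    qed simp
    thus "ratpoly c (normalized_moment [2 * k])" by (rule ratpoly_mono) (simp add: c_def)
  qed
  then obtain d r where r: "\<And>i. i \<le> d \<Longrightarrow> ratfun c (r i)"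
    and Q: "\<And>s N. s > c \<Longrightarrow> N \<ge> 1 \<Longrightarrow>
      normalized_moment [2 * k + 2] s N + normalized_moment [2 * k] s N = (\<Sum>i\<le>d. r i s * real N ^ i)"
    unfolding ratpoly_def by blast
  have "\<forall>i. \<exists>a b. i \<le> d \<longrightarrow> (\<forall>s>c. poly b s \<noteq> 0 \<and> r i s = poly a s / poly b s)"
    using r unfolding ratfun_def by blast
  then obtain a b where ab: "\<And>i s. i \<le> d \<Longrightarrow> s > c \<Longrightarrow> poly (b i) s \<noteq> 0 \<and> r i s = poly (a i) s / poly (b i) s"
    by metis
  show ?thesis
  proof (rule exI[of _ d], rule exI[of _ a], rule exI[of _ b], intro allI impI conjI)
    fix s :: real and i assume "s > 1 / 2 \<and> real k < s - 1 / 2" "i \<le> d"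
    thus "poly (b i) s \<noteq> 0" using ab[of i s] by (simp add: c_def)
  next
    fix s :: real and N :: nat assume s: "s > 1 / 2 \<and> real k < s - 1 / 2" and N: "N \<ge> 1"
    have "Q_moment k s N = normalized_moment [2 * k + 2] s N + normalized_moment [2 * k] s N"
      by (rule Q_moment_eq) (use s in simp)
    also have "\<dots> = (\<Sum>i\<le>d. r i s * real N ^ i)"
      by (rule Q) (use s N in \<open>simp_all add: c_def\<close>)
    also have "\<dots> = (\<Sum>i\<le>d. poly (a i) s / poly (b i) s * real N ^ i)"
      using s by (intro sum.cong refl) (simp add: ab c_def)
    finally show "Q_moment k s N = (\<Sum>i\<le>d. poly (a i) s / poly (b i) s * real N ^ i)" .
  qed
qed

end
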